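(* Let $n\ge 2$ be an integer, let $1<p<n$, and put $p_*=\frac{(n-1)p}{n-p}$. Let $f:\mathbb{R}_+\to\mathbb{R}_+$ be continuous and satisfy $$\int_0^1 [f(v)]^{-\frac{1}{p_*-1}}\,\mathrm{d}v<+\infty .$$ Then the anisotropic equation $-\Delta_p^H u=f(u)$ in $\mathbb{R}^n$ admits no positive supersolution.
   Context: $\mathbb{R}_+=(0,\infty)$. $H\in C^2(\mathbb{R}^n\setminus\{0\})\cap C(\mathbb{R}^n)$ is a fixed positively homogeneous function of degree one ($H(t\xi)=tH(\xi)$ for $t>0$, $H(0)=0$), positive on $\mathbb{S}^{n-1}$ (not assumed even), and uniformly convex, i.e. the unit ball $\{\xi: H(\xi)<1\}$ is uniformly convex (its boundary has principal curvatures bounded below by a positive constant). Set $a(\xi)=\frac1p\nabla_\xi H^p(\xi)$ (with $a(0)=0$) and $\Delta_p^H u=\operatorname{div}(a(\nabla u))$. A supersolution of $-\Delta_p^H u=f(u)$ in $\mathbb{R}^n$ is a function $u\in W^{1,p}_{\mathrm{loc}}(\mathbb{R}^n)\cap C(\mathbb{R}^n)$ such that $\int_{\mathbb{R}^n}a(\nabla u)\cdot\nabla\varphi\ge\int_{\mathbb{R}^n}f(u)\varphi$ for all $\varphi\in C_c^\infty(\mathbb{R}^n)$ with $\varphi\ge0$. It is positive if $u>0$ in $\mathbb{R}^n$. *)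

theory Defs
  imports "HOL-Analysis.Analysis"
begin

definition grad :: "(real ^ 'n \<Rightarrow> real) \<Rightarrow> real ^ 'n \<Rightarrow> real ^ 'n" where
  "grad f x = (\<chi> i. frechet_derivative f (at x) (axis i 1))"

(* Only meant for open S: the derivatives are unrestricted ones, taken at the points of S. *)
primrec Ck_on :: "nat \<Rightarrow> (real ^ 'n) set \<Rightarrow> (real ^ 'n \<Rightarrow> real) \<Rightarrow> bool" where
  "Ck_on 0 S f \<longleftrightarrow> continuous_on S f"
| "Ck_on (Suc k) S f \<longleftrightarrow>
     (\<forall>x\<in>S. f differentiable (at x)) \<and> (\<forall>i. Ck_on k S (\<lambda>x. grad f x $ i))"

definition test_function :: "(real ^ 'n \<Rightarrow> real) \<Rightarrow> bool" where
  "test_function \<phi> \<longleftrightarrow> (\<forall>k. Ck_on k UNIV \<phi>) \<and> compact (closure {x. \<phi> x \<noteq> 0})"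

definition Lp_loc :: "real \<Rightarrow> (real ^ 'n \<Rightarrow> 'b::euclidean_space) \<Rightarrow> bool" where
  "Lp_loc p g \<longleftrightarrow> g \<in> borel_measurable lebesgue \<and>
     (\<forall>K. compact K \<longrightarrow> set_integrable lebesgue K (\<lambda>x. norm (g x) powr p))"

definition weak_gradient :: "(real ^ 'n \<Rightarrow> real) \<Rightarrow> (real ^ 'n \<Rightarrow> real ^ 'n) \<Rightarrow> bool" where
  "weak_gradient u G \<longleftrightarrow> Lp_loc 1 u \<and> Lp_loc 1 G \<and>
     (\<forall>\<phi> i. test_function \<phi> \<longrightarrow>
        (LINT x|lebesgue. u x * grad \<phi> x $ i) = - (LINT x|lebesgue. G x $ i * \<phi> x))"

(* Membership of u in W^{1,p}_loc, with G a representative of its weak gradient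
   (unique up to null sets). *)
definition W1p_loc :: "real \<Rightarrow> (real ^ 'n \<Rightarrow> real) \<Rightarrow> (real ^ 'n \<Rightarrow> real ^ 'n) \<Rightarrow> bool" where
  "W1p_loc p u G \<longleftrightarrow> Lp_loc p u \<and> Lp_loc p G \<and> weak_gradient u G"

definition unit_normal :: "(real ^ 'n \<Rightarrow> real) \<Rightarrow> real ^ 'n \<Rightarrow> real ^ 'n" where
  "unit_normal F x = grad F x /\<^sub>R norm (grad F x)"

(* Principal curvatures at x of the level set of F through x: the eigenvalues of the
   Weingarten map, i.e. of the differential of the unit normal restricted to the tangent
   space.  With this orientation the unit sphere, F = norm, has principal curvatures +1. *)
definition principal_curvature :: "(real ^ 'n \<Rightarrow> real) \<Rightarrow> real ^ 'n \<Rightarrow> real \<Rightarrow> bool" where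
  "principal_curvature F x \<kappa> \<longleftrightarrow>
     (\<exists>v. v \<noteq> 0 \<and> v \<bullet> grad F x = 0 \<and>
          frechet_derivative (unit_normal F) (at x) v = \<kappa> *\<^sub>R v)"

definition uniformly_convex_ball :: "(real ^ 'n \<Rightarrow> real) \<Rightarrow> bool" where
  "uniformly_convex_ball H \<longleftrightarrow>
     (\<exists>c>0. \<forall>\<xi>\<in>frontier {\<xi>. H \<xi> < 1}. \<forall>\<kappa>. principal_curvature H \<xi> \<kappa> \<longrightarrow> c \<le> \<kappa>)"

definition anisotropy :: "(real ^ 'n \<Rightarrow> real) \<Rightarrow> bool" where
  "anisotropy H \<longleftrightarrow>
     Ck_on 2 (UNIV - {0}) H \<and> continuous_on UNIV H \<and>
     (\<forall>t>0. \<forall>\<xi>. H (t *\<^sub>R \<xi>) = t * H \<xi>) \<and> H 0 = 0 \<and>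
     (\<forall>\<xi>\<in>sphere 0 1. H \<xi> > 0) \<and>
     uniformly_convex_ball H"

definition flux :: "(real ^ 'n \<Rightarrow> real) \<Rightarrow> real \<Rightarrow> real ^ 'n \<Rightarrow> real ^ 'n" where
  "flux H p \<xi> = (if \<xi> = 0 then 0 else (1 / p) *\<^sub>R grad (\<lambda>\<eta>. H \<eta> powr p) \<xi>)"

definition supersolution ::
  "(real ^ 'n \<Rightarrow> real) \<Rightarrow> real \<Rightarrow> (real \<Rightarrow> real) \<Rightarrow> (real ^ 'n \<Rightarrow> real) \<Rightarrow> bool" where
  "supersolution H p f u \<longleftrightarrow> continuous_on UNIV u \<and>
     (\<exists>G. W1p_loc p u G \<and>
        (\<forall>\<phi>. test_function \<phi> \<and> (\<forall>x. \<phi> x \<ge> 0) \<longrightarrow>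
           (LINT x|lebesgue. flux H p (G x) \<bullet> grad \<phi> x) \<ge> (LINT x|lebesgue. f (u x) * \<phi> x)))"

end

theory Submission
  imports Defs
begin

text \<open>
  Write \<open>n = CARD('n)\<close>, \<open>\<tau> = 1 / (pstar - 1) = (n - p) / (n (p - 1))\<close>, \<open>\<sigma> = p / (n (p - 1))\<close>, and
  let \<open>I\<close> be an antiderivative of \<open>f powr (- \<tau>)\<close> with \<open>I \<ge> 1\<close>, which exists by the integrability
  of \<open>f powr (- \<tau>)\<close> at \<open>0\<close>. Testing with \<open>g(u) \<eta>^n\<close>, where \<open>g = I powr (- 1 / \<sigma>)\<close> is decreasing and
  \<open>\<eta>\<close> is a cutoff, the flux term with \<open>\<nabla>\<eta>\<close> is absorbed by Young's inequality with the three
  exponents \<open>1/p - 1/n\<close>, \<open>1 - 1/p\<close> and \<open>1/n\<close> into \<open>f(u) g(u) \<eta>^n\<close>, \<open>|g'(u)| |\<nabla>u|^p \<eta>^n\<close> and \<open>|\<nabla>\<eta>|^n\<close>; the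
  function \<open>g\<close> is chosen to make the powers match. Hence \<open>\<integral> f(u) g(u) \<eta>^n \<le> K \<integral> |\<nabla>\<eta>|^n\<close> with \<open>K\<close>
  independent of \<open>\<eta>\<close>. As \<open>n \<ge> 2\<close>, the unit ball has zero \<open>n\<close>-capacity, so the left side would vanish
  on it.

  To justify the nonsmooth test function, mollify \<open>u\<close> to \<open>u_m\<close>, test with \<open>g(u_m) \<eta>^n\<close>, and let \<open>m\<close> tend
  to infinity.
\<close>

section \<open>Smooth functions and mollifiers\<close>

text \<open>Matching powers determines every exponent. Put \<theta> = 1/p - 1/n and \<beta> = 1 -
  1/p. In the product of the two energy densities raised to \<theta> and \<beta>, the function f
  cancels exactly when \<tau> \<beta> = \<theta>, that is \<tau> = 1 / (pstar - 1); this is where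
  the critical exponent enters. For g = I powr (- s), the powers of I agree when s (\<theta> +
  \<beta>) + \<beta> = s; as \<theta> + \<beta> = 1 - 1/n, this says s = n \<beta> = 1 / \<sigma>.
  The same sum turns \<eta>^n into \<eta>^(n-1), the factor left by differentiating \<eta>^n, and p
  \<beta> = p - 1 is the growth of the flux. The infimum of u may be 0, so no constant may depend on
  a lower bound for u; I \<ge> 1 keeps g defined and positive on all of (0, \<infinity>). As g
  decreases, the energy term sits on the favourable side, and half of it, with half of the source
  term, pays for the cutoff term. In the limit of the mollifications the delicate term pairs the
  flux with grad u_m - grad u. It is treated by convergence in L^1 together with a uniform bound in
  L^p, which replaces strong convergence in L^p.\<close>

lemma grad_eqI:
  assumes "(f has_derivative (\<lambda>h. g \<bullet> h)) (at x)"
  shows "grad f x = g"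
proof -
  have "frechet_derivative f (at x) = (\<lambda>h. g \<bullet> h)"
    using frechet_derivative_at[OF assms] by simp
  then show ?thesis
    by (simp add: grad_def vec_eq_iff inner_axis)
qed

lemma has_derivative_grad:
  assumes "f differentiable (at x)"
  shows "(f has_derivative (\<lambda>h. grad f x \<bullet> h)) (at x)"
proof -
  let ?D = "frechet_derivative f (at x)"
  have D: "(f has_derivative ?D) (at x)"
    using assms frechet_derivative_works by blast
  then have lin: "linear ?D"
    by (rule has_derivative_linear)
  have "?D h = grad f x \<bullet> h" for h
  proof -
    have "?D h = ?D (\<Sum>i\<in>UNIV. h $ i *\<^sub>R axis i 1)"
      using basis_expansion[of h] by (simp add: scalar_mult_eq_scaleR)
    also have "\<dots> = (\<Sum>i\<in>UNIV. h $ i * ?D (axis i 1))"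
      by (simp add: linear_sum[OF lin] linear_cmul[OF lin])
    also have "\<dots> = grad f x \<bullet> h"
      by (simp add: grad_def inner_vec_def mult.commute)
    finally show ?thesis .
  qed
  then show ?thesis
    using D by presburger
qed

section \<open>Smoothness under sums, products, composition and reflection\<close>

lemma Ck_on_UNIV_SucI:
  assumes "\<And>x. (f has_derivative (\<lambda>h. g x \<bullet> h)) (at x)" "\<And>i. Ck_on k UNIV (\<lambda>x. g x $ i)"
  shows "Ck_on (Suc k) UNIV f"
proof -
  have "grad f = g"
    using grad_eqI[OF assms(1)] by auto
  then show ?thesis
    using assms unfolding Ck_on.simps differentiable_def by metis
qed

lemma Ck_on_SucD: "Ck_on (Suc k) S f \<Longrightarrow> Ck_on k S f"
proof (induction k arbitrary: f)
  case 0
  then have "\<forall>x\<in>S. f differentiable at x" by simp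
  then show ?case
    by (simp add: continuous_at_imp_continuous_on differentiable_imp_continuous_within)
next
  case (Suc k)
  then show ?case by (metis Ck_on.simps(2))
qed

lemma Ck_on_const: "Ck_on k UNIV (\<lambda>x. c)"
proof (induction k arbitrary: c)
  case (Suc k)
  then show ?case
    by (intro Ck_on_UNIV_SucI[where g="\<lambda>x. 0"]) auto
qed auto

lemma Ck_on_add:
  "Ck_on k UNIV f \<Longrightarrow> Ck_on k UNIV g \<Longrightarrow> Ck_on k UNIV (\<lambda>x. f x + g x)"
proof (induction k arbitrary: f g)
  case 0
  then show ?case by (auto intro: continuous_intros)
next
  case (Suc k)
  have d: "\<And>x. f differentiable at x" "\<And>x. g differentiable at x"
    using Suc.prems by auto
  show ?case
    by (rule Ck_on_UNIV_SucI[where g="\<lambda>x. grad f x + grad g x"])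
      (use Suc in \<open>auto simp: inner_add_left
        intro!: has_derivative_add has_derivative_grad d\<close>)
qed

lemma Ck_on_mult:
  "Ck_on k UNIV f \<Longrightarrow> Ck_on k UNIV g \<Longrightarrow> Ck_on k UNIV (\<lambda>x. f x * g x)"
proof (induction k arbitrary: f g)
  case 0
  then show ?case by (auto intro: continuous_intros)
next
  case (Suc k)
  have d: "\<And>x. f differentiable at x" "\<And>x. g differentiable at x"
    using Suc.prems by auto
  show ?case
  proof (rule Ck_on_UNIV_SucI[where g="\<lambda>x. f x *\<^sub>R grad g x + g x *\<^sub>R grad f x"])
    show "((\<lambda>x. f x * g x) has_derivative (\<bullet>) (f x *\<^sub>R grad g x + g x *\<^sub>R grad f x)) (at x)" for x
      using has_derivative_mult[OF has_derivative_grad[OF d(1)] has_derivative_grad[OF d(2)]]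
      by (rule has_derivative_eq_rhs) (auto simp: inner_add_left)
    show "Ck_on k UNIV (\<lambda>x. (f x *\<^sub>R grad g x + g x *\<^sub>R grad f x) $ i)" for i
      using Suc.prems Ck_on_SucD[OF Suc.prems(1)] Ck_on_SucD[OF Suc.prems(2)]
      by (auto intro!: Ck_on_add Suc.IH)
  qed
qed

lemma Ck_on_component: "Ck_on k UNIV (\<lambda>x. x $ i)"
proof (cases k)
  case 0
  then show ?thesis by (auto intro: continuous_intros)
next
  case (Suc m)
  show ?thesis unfolding Suc
    by (rule Ck_on_UNIV_SucI[where g="\<lambda>x. axis i 1"])
      (auto simp: inner_axis' intro!: Ck_on_const bounded_linear.has_derivative[OF bounded_linear_vec_nth] has_derivative_ident)
qed

text \<open>The outer function comes with the whole sequence of its derivatives: differentiating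
  \<open>g j \<circ> f\<close> yields \<open>g (Suc j) \<circ> f\<close> times
  \<open>grad f\<close>, so the induction on \<open>k\<close> runs over all \<open>j\<close> at
  once. Smoothness of \<open>f\<close> to every order keeps that hypothesis fixed while
  \<open>k\<close> varies.\<close>

lemma Ck_on_compose:
  fixes g :: "nat \<Rightarrow> real \<Rightarrow> real"
  assumes "\<And>j t. (g j has_real_derivative g (Suc j) t) (at t)"
  shows "\<forall>m. Ck_on m UNIV f \<Longrightarrow> Ck_on k UNIV (\<lambda>x. g j (f x))"
proof (induction k arbitrary: j)
  case 0
  then have "continuous_on UNIV f" by (metis Ck_on.simps(1))
  moreover have "continuous_on UNIV (g j)"
    using assms DERIV_isCont continuous_at_imp_continuous_on by blast
  ultimately show ?case
    by (simp add: continuous_on_compose2)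
next
  case (Suc k)
  then have f: "Ck_on (Suc k) UNIV f" by blast
  show ?case
  proof (rule Ck_on_UNIV_SucI[where g="\<lambda>x. g (Suc j) (f x) *\<^sub>R grad f x"])
    fix x
    have "(f has_derivative (\<lambda>h. grad f x \<bullet> h)) (at x)"
      using f by (intro has_derivative_grad) auto
    moreover have "(g j has_derivative (\<lambda>h. g (Suc j) (f x) * h)) (at (f x))"
      using assms[of j "f x"] by (simp add: has_field_derivative_def)
    ultimately show "((\<lambda>x. g j (f x)) has_derivative (\<bullet>) (g (Suc j) (f x) *\<^sub>R grad f x)) (at x)"
      by (rule has_derivative_eq_rhs[OF has_derivative_compose]) auto
  next
    fix i
    have "Ck_on k UNIV (\<lambda>x. grad f x $ i)" using f by simp
    then show "Ck_on k UNIV (\<lambda>x. (g (Suc j) (f x) *\<^sub>R grad f x) $ i)"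
      using Ck_on_mult[OF Suc.IH[OF Suc.prems]] by simp
  qed
qed

lemma Ck_on_reflect:
  assumes "Ck_on k UNIV f"
  shows "Ck_on k UNIV (\<lambda>y. f (a - y))"
  using assms
proof (induction k arbitrary: f)
  case 0
  then show ?case by (auto intro!: continuous_on_compose2[of UNIV f] continuous_intros)
next
  case (Suc k)
  show ?case
  proof (rule Ck_on_UNIV_SucI[where g="\<lambda>y. - 1 *\<^sub>R grad f (a - y)"])
    fix y
    have 1: "(f has_derivative (\<lambda>h. grad f (a - y) \<bullet> h)) (at (a - y))"
      using Suc by (intro has_derivative_grad) auto
    have 2: "((\<lambda>y. a - y) has_derivative (\<lambda>h. - h)) (at y)"
      by (auto intro!: derivative_eq_intros)
    show "((\<lambda>y. f (a - y)) has_derivative (\<bullet>) (- 1 *\<^sub>R grad f (a - y))) (at y)"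
      by (rule has_derivative_eq_rhs[OF has_derivative_compose[OF 2 1]]) auto
  next
    fix i
    show "Ck_on k UNIV (\<lambda>y. (- 1 *\<^sub>R grad f (a - y)) $ i)"
      using Ck_on_mult[OF Ck_on_const[of k "-1"] Suc.IH[of "\<lambda>x. grad f x $ i"]] Suc.prems by simp
  qed
qed

section \<open>A smooth bump function built from exp (- 1 / t)\<close>

definition flat_fun :: "real poly \<Rightarrow> real \<Rightarrow> real" where
  "flat_fun P t = (if t \<le> 0 then 0 else poly P (1 / t) * exp (- (1 / t)))"

lemma poly_times_exp_tendsto_0: "((\<lambda>s::real. poly P s * exp (- s)) \<longlongrightarrow> 0) at_top"
proof -
  have "((\<lambda>s. \<Sum>i\<le>degree P. coeff P i * (s ^ i / exp s)) \<longlongrightarrow> (\<Sum>i\<le>degree P. coeff P i * 0)) at_top"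
    by (intro tendsto_intros tendsto_power_div_exp_0)
  then show ?thesis
    by (simp add: poly_altdef sum_distrib_right exp_minus field_simps sum_divide_distrib)
qed

text \<open>The family P(1/t) exp(-1/t) is closed under differentiation: for s = 1/t one has ds/dt =
  - s^2, so P is replaced by s^2 (P - P'). At t = 0 the right difference quotient is s P(s) exp(-s)
  with s tending to infinity, and the left one is 0.\<close>

lemma flat_fun_deriv:
  "(flat_fun P has_real_derivative flat_fun ([:0, 0, 1:] * (P - pderiv P)) t) (at t)"
proof -
  consider "t < 0" | "t = 0" | "t > 0" by linarith
  then show ?thesis
  proof cases
    case 1
    have "((\<lambda>t. 0) has_real_derivative 0) (at t)" by simp
    moreover have "\<forall>\<^sub>F s in nhds t. flat_fun P s = 0"
      using eventually_nhds_in_open[of "{..<0}" t] 1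
      by (auto elim!: eventually_mono simp: flat_fun_def)
    ultimately have "(flat_fun P has_real_derivative 0) (at t)"
      by (subst DERIV_cong_ev[OF refl _ refl])
    then show ?thesis using 1 by (simp add: flat_fun_def)
  next
    case 2
    have "((\<lambda>h. flat_fun P h / h) \<longlongrightarrow> 0) (at_right 0)"
    proof -
      have "((\<lambda>h::real. poly ([:0,1:] * P) (inverse h) * exp (- (inverse h))) \<longlongrightarrow> 0) (at_right 0)"
        by (rule filterlim_compose[OF poly_times_exp_tendsto_0 filterlim_inverse_at_top_right])
      then show ?thesis
        by (rule Lim_transform_eventually)
          (auto simp: eventually_at_right_less flat_fun_def field_simps
            intro!: eventually_mono[OF eventually_at_right_less[of 0]])
    qed
    moreover have "((\<lambda>h. flat_fun P h / h) \<longlongrightarrow> 0) (at_left 0)"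
      by (rule Lim_transform_eventually[of "\<lambda>h. 0"])
        (auto simp: flat_fun_def eventually_at_filter)
    ultimately have "((\<lambda>h. flat_fun P h / h) \<longlongrightarrow> 0) (at 0)"
      by (simp add: filterlim_split_at)
    then show ?thesis using 2
      by (simp add: DERIV_def flat_fun_def)
  next
    case 3
    have "((\<lambda>t. poly P (1 / t) * exp (- (1 / t))) has_real_derivative
       flat_fun ([:0, 0, 1:] * (P - pderiv P)) t) (at t)"
      using 3 by (auto intro!: derivative_eq_intros simp: flat_fun_def power2_eq_square field_simps)
    moreover have "\<forall>\<^sub>F s in nhds t. flat_fun P s = poly P (1 / s) * exp (- (1 / s))"
      using eventually_nhds_in_open[of "{0<..}" t] 3
      by (auto elim!: eventually_mono simp: flat_fun_def)
    ultimately show ?thesis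
      by (subst DERIV_cong_ev[OF refl _ refl])
  qed
qed

lemma ex_bump:
  fixes e :: real
  assumes "e > 0"
  obtains b :: "real ^ 'n \<Rightarrow> real" where "\<And>k. Ck_on k UNIV b"
    "\<And>x. norm x < e \<Longrightarrow> b x > 0" "\<And>x. norm x \<ge> e \<Longrightarrow> b x = 0"
proof
  \<comment> \<open>The iterates of P \<mapsto> s^2 (P - P') starting from 1 encode the successive
    derivatives of exp(-1/t), in the sequence form that \<open>Ck_on_compose\<close>
    expects.\<close>
  define P where "P j = ((\<lambda>P. [:0, 0, 1:] * (P - pderiv P)) ^^ j) (1 :: real poly)" for j :: nat
  define b where "b x = flat_fun (P 0) (e\<^sup>2 + (-1) * (\<Sum>i\<in>UNIV. x $ i * x $ i))" for x :: "real ^ 'n"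
  have sm: "Ck_on k UNIV (\<lambda>x::real^'n. \<Sum>i\<in>A. x $ i * x $ i)" for k and A :: "'n set"
  proof (induction A rule: infinite_finite_induct)
    case (insert i A)
    then show ?case by (auto intro!: Ck_on_add Ck_on_mult Ck_on_component)
  qed (auto intro: Ck_on_const)
  have "Ck_on m UNIV (\<lambda>x::real^'n. e\<^sup>2 + (-1) * (\<Sum>i\<in>UNIV. x $ i * x $ i))" for m
    by (intro sm Ck_on_add Ck_on_mult Ck_on_const)
  moreover have "(flat_fun (P j) has_real_derivative flat_fun (P (Suc j)) t) (at t)" for j t
    using flat_fun_deriv[of "P j" t] by (simp add: P_def)
  ultimately show "Ck_on k UNIV b" for k
    unfolding b_def
    using Ck_on_compose[where g="\<lambda>j. flat_fun (P j)"] by blast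
  have eq: "b x = flat_fun 1 (e\<^sup>2 - (norm x)\<^sup>2)" for x
    by (simp add: b_def P_def power2_norm_eq_inner inner_vec_def)
  show "b x > 0" if "norm x < e" for x
  proof -
    have "(norm x)\<^sup>2 < e\<^sup>2" using that by (simp add: power_strict_mono)
    then show ?thesis by (simp add: eq flat_fun_def)
  qed
  show "b x = 0" if "norm x \<ge> e" for x
  proof -
    have "e\<^sup>2 \<le> (norm x)\<^sup>2" using that assms by (simp add: power_mono)
    then show ?thesis by (simp add: eq flat_fun_def)
  qed
qed

section \<open>Test functions and mollifying kernels\<close>

lemma Ck_on_UNIV_continuous: "Ck_on k UNIV f \<Longrightarrow> continuous_on UNIV f"
proof (induction k)
  case (Suc k)
  then show ?case using Ck_on_SucD by blast
qed auto

lemma test_functionI: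
  assumes "\<And>k. Ck_on k UNIV \<phi>" "\<forall>x. norm x > R \<longrightarrow> \<phi> x = 0"
  shows "test_function \<phi>"
proof -
  have "{x. \<phi> x \<noteq> 0} \<subseteq> cball 0 R"
    using assms(2) by (force simp: not_less)
  then have "bounded {x. \<phi> x \<noteq> 0}"
    using bounded_cball bounded_subset by blast
  then show ?thesis
    using assms(1) by (simp add: test_function_def)
qed

lemma integrable_continuous_compact_support:
  fixes k :: "'a::euclidean_space \<Rightarrow> 'b::euclidean_space"
  assumes "continuous_on UNIV k" "\<forall>x. norm x > R \<longrightarrow> k x = 0"
  shows "integrable lborel k"
proof -
  have "integrable lborel (\<lambda>x. indicator (cball 0 R) x *\<^sub>R k x)"
    by (intro borel_integrable_compact continuous_on_subset[OF assms(1)]) auto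
  moreover have "(\<lambda>x. indicator (cball 0 R) x *\<^sub>R k x) = k"
    using assms(2) by (auto simp: indicator_def fun_eq_iff not_le[symmetric])
  ultimately show ?thesis by simp
qed

text \<open>No rescaled family of one kernel is fixed. Every later estimate depends on the kernel
  only through its radius, so it can be stated for all kernels of small radius at once.\<close>

definition mollifier :: "real \<Rightarrow> (real ^ 'n \<Rightarrow> real) \<Rightarrow> bool" where
  "mollifier e \<rho> \<longleftrightarrow> (\<forall>k. Ck_on k UNIV \<rho>) \<and> (\<forall>x. \<rho> x \<ge> 0) \<and>
     (\<forall>x. norm x > e \<longrightarrow> \<rho> x = 0) \<and> (LINT x|lborel. \<rho> x) = 1"

lemma ex_mollifier:
  assumes "e > 0"
  obtains \<rho> :: "real ^ 'n \<Rightarrow> real" where "mollifier e \<rho>"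
proof -
  obtain b :: "real ^ 'n \<Rightarrow> real" where b: "\<And>k. Ck_on k UNIV b"
    "\<And>x. norm x < e \<Longrightarrow> b x > 0" "\<And>x. norm x \<ge> e \<Longrightarrow> b x = 0"
    using ex_bump[OF assms] by metis
  have nn: "b x \<ge> 0" for x using b(2,3)[of x] by (cases "norm x < e") auto
  have int: "integrable lborel b"
    by (rule integrable_continuous_compact_support[of _ e])
      (use b Ck_on_UNIV_continuous[OF b(1)] in auto)
  define c where "c = (LINT x|lborel. b x)"
  \<comment> \<open>A nonnegative bump of zero mass would vanish almost everywhere, making the ball
    on which it is positive a null set.\<close>
  have "c \<noteq> 0"
  proof
    assume "c = 0"
    then have "AE x in lborel. b x = 0"
      using integral_nonneg_eq_0_iff_AE[OF int] nn by (simp add: c_def)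
    then have "AE x in lborel. x \<notin> ball (0::real^'n) e"
      by (rule AE_mp) (use b(2) in \<open>force simp: less_le\<close>)
    then have "emeasure lborel (ball (0::real^'n) e) = 0"
      by (subst (asm) AE_iff_measurable[where N="ball 0 e"]) auto
    then show False
      using content_ball_pos[OF assms, of "0::real^'n"] by (simp add: measure_def)
  qed
  moreover have "c \<ge> 0" unfolding c_def using nn by simp
  ultimately have "c > 0" by simp
  have "Ck_on k UNIV (\<lambda>x. (1/c) * b x)" for k
    by (intro Ck_on_mult Ck_on_const b(1))
  then have "mollifier e (\<lambda>x. (1/c) * b x)"
    unfolding mollifier_def using \<open>c > 0\<close> nn b(3)
    by (auto simp: c_def[symmetric])
  then show ?thesis by (rule that)
qed

section \<open>Convolution\<close>

text \<open>Borel rather than Lebesgue measurability is required because the integrands of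
  convolutions must be measurable on the product space, where Tonelli's theorem is applied. Balls
  about the origin suffice, since they exhaust the compact sets.\<close>

definition loc_int :: "(real ^ 'n \<Rightarrow> 'b::euclidean_space) \<Rightarrow> bool" where
  "loc_int F \<longleftrightarrow> F \<in> borel_measurable borel \<and> (\<forall>R. set_integrable lborel (cball 0 R) F)"

lemma loc_int_borel [measurable_dest]: "loc_int F \<Longrightarrow> F \<in> borel_measurable borel"
  by (simp add: loc_int_def)

lemma loc_int_continuous: "continuous_on UNIV F \<Longrightarrow> loc_int F"
  unfolding loc_int_def set_integrable_def
  by (auto intro!: borel_integrable_compact borel_measurable_continuous_onI elim: continuous_on_subset)

lemma loc_int_dominated:
  fixes F :: "real ^ 'n \<Rightarrow> 'b::euclidean_space" and f :: "real ^ 'n \<Rightarrow> 'c::euclidean_space"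
  assumes "loc_int F" "f \<in> borel_measurable borel"
    "\<And>y. norm (f y) \<le> B * norm (F y)" "\<And>y. norm y > R \<Longrightarrow> f y = 0"
  shows "integrable lborel f"
proof (rule Bochner_Integration.integrable_bound)
  have "integrable lborel (\<lambda>y. indicator (cball 0 R) y *\<^sub>R F y)"
    using assms(1) by (simp add: loc_int_def set_integrable_def)
  then show "integrable lborel (\<lambda>y. B *\<^sub>R (indicator (cball 0 R) y *\<^sub>R F y))"
    by (intro integrable_scaleR_right)
  show "AE y in lborel. norm (f y) \<le> norm (B *\<^sub>R (indicator (cball 0 R) y *\<^sub>R F y))"
  proof (intro AE_I2)
    fix y
    have "norm (f y) \<le> \<bar>B\<bar> * norm (F y)"
      by (rule order_trans[OF assms(3)]) (simp add: mult_right_mono)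
    then show "norm (f y) \<le> norm (B *\<^sub>R (indicator (cball 0 R) y *\<^sub>R F y))"
      using assms(4)[of y] by (cases "norm y > R") (auto simp: indicator_def)
  qed
qed (use assms(2) in auto)

section \<open>Continuity and differentiability of convolutions\<close>

lemma compact_support_bounded:
  fixes K :: "'a::euclidean_space \<Rightarrow> 'b::euclidean_space"
  assumes "continuous_on UNIV K" "\<forall>x. norm x > R \<longrightarrow> K x = 0"
  obtains B where "B > 0" "\<And>x. norm (K x) \<le> B"
proof -
  have "compact (K ` cball 0 R)"
    by (intro compact_continuous_image continuous_on_subset[OF assms(1)]) auto
  then obtain B where "B > 0" "\<And>x. x \<in> cball 0 R \<Longrightarrow> norm (K x) \<le> B"
    using compact_imp_bounded bounded_pos by (metis image_eqI)
  moreover from this have "norm (K x) \<le> B" for x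
    using assms(2)[rule_format, of x] by (cases "norm x > R") auto
  ultimately show ?thesis using that by blast
qed

text \<open>Uniform continuity on a compact ball handles points with norm at most R + 1; beyond
  that, the restriction d \<le> 1 keeps both points outside the support. The same restriction lets
  later proofs enclose the supports of all nearby translates in one ball.\<close>

lemma compact_support_uniformly_continuous:
  fixes K :: "'a::euclidean_space \<Rightarrow> 'b::euclidean_space"
  assumes "continuous_on UNIV K" "\<forall>x. norm x > R \<longrightarrow> K x = 0" "e > 0"
  obtains d where "d > 0" "d \<le> 1" "\<And>x y. norm (x - y) < d \<Longrightarrow> norm (K x - K y) < e"
proof -
  have "uniformly_continuous_on (cball 0 (R + 2)) K"
    by (intro compact_uniformly_continuous continuous_on_subset[OF assms(1)]) auto
  then obtain d where d: "d > 0"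
    "\<And>x y. x \<in> cball 0 (R+2) \<Longrightarrow> y \<in> cball 0 (R+2) \<Longrightarrow> dist x y < d \<Longrightarrow> dist (K x) (K y) < e"
    using \<open>e > 0\<close> unfolding uniformly_continuous_on_def by metis
  have "norm (K x - K y) < e" if "norm (x - y) < min d 1" for x y
  proof (cases "norm x \<le> R + 1")
    case True
    moreover have "norm y \<le> norm x + norm (x - y)"
      by norm
    ultimately show ?thesis
      using d(2)[of x y] that by (auto simp: dist_norm)
  next
    case False
    moreover have "norm x \<le> norm y + norm (x - y)"
      by norm
    ultimately show ?thesis
      using assms(2)[rule_format, of x] assms(2)[rule_format, of y] that \<open>e > 0\<close> by simp
  qed
  then show ?thesis using d(1) that[of "min d 1"] by auto
qed

lemma kernel_integrable:
  fixes w :: "real ^ 'n \<Rightarrow> real" and K :: "real ^ 'n \<Rightarrow> 'b::euclidean_space"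
  assumes w: "loc_int w" and K: "continuous_on UNIV K" "\<forall>x. norm x > R \<longrightarrow> K x = 0"
  shows "integrable lborel (\<lambda>y. w y *\<^sub>R K (x - y))"
proof -
  obtain B where B: "B > 0" "\<And>x. norm (K x) \<le> B"
    using compact_support_bounded[OF K] by blast
  have [measurable]: "K \<in> borel_measurable borel"
    using K(1) borel_measurable_continuous_onI by blast
  have [measurable]: "w \<in> borel_measurable borel" using w by (rule loc_int_borel)
  show ?thesis
  proof (rule loc_int_dominated[OF w])
    show "norm (w y *\<^sub>R K (x - y)) \<le> B * norm (w y)" for y
      using mult_left_mono[OF B(2), of "\<bar>w y\<bar>" "x - y"] by (simp add: mult.commute)
    show "w y *\<^sub>R K (x - y) = 0" if "norm y > norm x + R" for y
    proof -
      have "norm (x - y) > R" using that norm_triangle_ineq2[of y x] by (simp add: norm_minus_commute)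
      then show ?thesis using K(2) by simp
    qed
  qed measurable
qed

lemma kernel_integrable':
  fixes k :: "real ^ 'n \<Rightarrow> real" and F :: "real ^ 'n \<Rightarrow> 'b::euclidean_space"
  assumes F: "loc_int F" and k: "continuous_on UNIV k" "\<forall>x. norm x > R \<longrightarrow> k x = 0"
  shows "integrable lborel (\<lambda>y. k (x - y) *\<^sub>R F y)"
proof -
  obtain B where B: "B > 0" "\<And>x. norm (k x) \<le> B"
    using compact_support_bounded[OF k] by blast
  have [measurable]: "k \<in> borel_measurable borel"
    using k(1) borel_measurable_continuous_onI by blast
  have [measurable]: "F \<in> borel_measurable borel" using F by (rule loc_int_borel)
  show ?thesis
  proof (rule loc_int_dominated[OF F])
    show "norm (k (x - y) *\<^sub>R F y) \<le> B * norm (F y)" for y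
      using B(2)[of "x - y"] by (simp add: mult_right_mono)
    show "k (x - y) *\<^sub>R F y = 0" if "norm y > norm x + R" for y
    proof -
      have "norm (x - y) > R" using that norm_triangle_ineq2[of y x] by (simp add: norm_minus_commute)
      then show ?thesis using k(2) by simp
    qed
  qed measurable
qed

text \<open>Applied with \<open>f\<close> an increment, or a linearisation error, of a translated
  kernel: a uniform bound on the kernel side becomes a bound on the convolution, with the local L^1
  norm of \<open>w\<close> as the factor.\<close>

lemma convolution_increment_bound:
  fixes w :: "real ^ 'n \<Rightarrow> real" and f :: "real ^ 'n \<Rightarrow> 'b::euclidean_space"
  assumes w: "loc_int w" and f: "integrable lborel (\<lambda>y. w y *\<^sub>R f y)"
    and b: "\<And>y. norm (f y) \<le> c" "\<And>y. norm y > R \<Longrightarrow> f y = 0"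
  shows "norm (LINT y|lborel. w y *\<^sub>R f y) \<le> c * (LINT y:cball 0 R|lborel. \<bar>w y\<bar>)"
proof -
  have "integrable lborel (\<lambda>y. indicator (cball 0 R) y *\<^sub>R w y)"
    using w by (simp add: loc_int_def set_integrable_def)
  from integrable_norm[OF this] have i: "integrable lborel (\<lambda>y. indicator (cball 0 R) y *\<^sub>R \<bar>w y\<bar>)"
    by (simp add: abs_mult)
  have "norm (LINT y|lborel. w y *\<^sub>R f y) \<le> (LINT y|lborel. c * (indicator (cball 0 R) y *\<^sub>R \<bar>w y\<bar>))"
  proof (rule Bochner_Integration.integral_norm_bound_integral[OF f])
    fix y
    show "norm (w y *\<^sub>R f y) \<le> c * (indicator (cball 0 R) y *\<^sub>R \<bar>w y\<bar>)"
      using b(2)[of y] mult_left_mono[OF b(1), of "\<bar>w y\<bar>" y]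
      by (cases "norm y > R") (auto simp: indicator_def mult.commute)
  qed (use i in simp)
  then show ?thesis by (simp add: set_lebesgue_integral_def)
qed

lemma set_integral_abs_nonneg: "(LINT y:A|M. \<bar>w y :: real\<bar>) \<ge> 0"
  unfolding set_lebesgue_integral_def by (rule Bochner_Integration.integral_nonneg) auto

lemma convolution_continuous:
  fixes w :: "real ^ 'n \<Rightarrow> real" and K :: "real ^ 'n \<Rightarrow> 'b::euclidean_space"
  assumes w: "loc_int w" and K: "continuous_on UNIV K" "\<forall>x. norm x > R \<longrightarrow> K x = 0"
  shows "continuous_on UNIV (\<lambda>x. LINT y|lborel. w y *\<^sub>R K (x - y))"
  unfolding continuous_on_iff
proof (intro ballI allI impI)
  fix x :: "real ^ 'n" and e :: real assume "e > 0"
  define A where "A = (LINT y:cball 0 (norm x + 1 + R)|lborel. \<bar>w y\<bar>)"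
  have "A \<ge> 0" unfolding A_def by (rule set_integral_abs_nonneg)
  then have "e / (A + 1) > 0" using \<open>e > 0\<close> by simp
  then obtain d where d: "d > 0" "d \<le> 1" "\<And>x y. norm (x - y) < d \<Longrightarrow> norm (K x - K y) < e / (A + 1)"
    using compact_support_uniformly_continuous[OF K] by blast
  have "norm ((LINT y|lborel. w y *\<^sub>R K (x' - y)) - (LINT y|lborel. w y *\<^sub>R K (x - y))) < e"
    if x': "norm (x' - x) < d" for x'
  proof -
    have "(LINT y|lborel. w y *\<^sub>R K (x' - y)) - (LINT y|lborel. w y *\<^sub>R K (x - y)) =
        (LINT y|lborel. w y *\<^sub>R (K (x' - y) - K (x - y)))"
      using Bochner_Integration.integral_diff[OF kernel_integrable[OF w K, of x'] kernel_integrable[OF w K, of x]]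
      by (simp add: scaleR_diff_right)
    also have "norm \<dots> \<le> (e / (A + 1)) * A"
      unfolding A_def
    proof (rule convolution_increment_bound[OF w])
      show "integrable lborel (\<lambda>y. w y *\<^sub>R (K (x' - y) - K (x - y)))"
        using Bochner_Integration.integrable_diff[OF kernel_integrable[OF w K] kernel_integrable[OF w K]]
        by (simp add: scaleR_diff_right)
      show "norm (K (x' - y) - K (x - y)) \<le> e / ((LINT y:cball 0 (norm x + 1 + R)|lborel. \<bar>w y\<bar>) + 1)" for y
        using d(3)[of "x' - y" "x - y"] x' by (simp add: A_def less_imp_le)
      show "K (x' - y) - K (x - y) = 0" if "norm y > norm x + 1 + R" for y
      proof -
        have "norm (x - y) > R" "norm (x' - y) > R"
          using that x' d(2) norm_triangle_ineq2[of y x] norm_triangle_ineq2[of y x'] norm_triangle_ineq2[of x' x]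
          by (auto simp: norm_minus_commute)
        then show ?thesis using K(2) by simp
      qed
    qed
    also have "\<dots> < e"
      using \<open>e > 0\<close> \<open>A \<ge> 0\<close> by (simp add: field_simps)
    finally show ?thesis .
  qed
  then show "\<exists>d>0. \<forall>x'\<in>UNIV. dist x' x < d \<longrightarrow>
      dist (LINT y|lborel. w y *\<^sub>R K (x' - y)) (LINT y|lborel. w y *\<^sub>R K (x - y)) < e"
    using d(1) by (auto simp: dist_norm)
qed

text \<open>The linearisation error of \<open>k\<close> is at most e' times the norm of h, uniformly
  in the base point, because its gradient \<open>K\<close> is uniformly continuous. Integrated
  against \<open>w\<close>, this is directly the definition of the derivative. Only the kernel is
  differentiated, so \<open>w\<close> may be merely locally integrable.\<close>

lemma convolution_has_derivative:
  fixes w k :: "real ^ 'n \<Rightarrow> real" and K :: "real ^ 'n \<Rightarrow> real ^ 'n"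
  assumes w: "loc_int w"
    and k: "\<And>x. (k has_derivative (\<lambda>h. K x \<bullet> h)) (at x)" "\<forall>x. norm x > R \<longrightarrow> k x = 0"
    and K: "continuous_on UNIV K" "\<forall>x. norm x > R \<longrightarrow> K x = 0"
  shows "((\<lambda>x. LINT y|lborel. w y * k (x - y)) has_derivative
     (\<lambda>h. (LINT y|lborel. w y *\<^sub>R K (x - y)) \<bullet> h)) (at x)"
  unfolding has_derivative_at_alt
proof (intro conjI allI impI)
  show "bounded_linear ((\<bullet>) (LINT y|lborel. w y *\<^sub>R K (x - y)))"
    by (rule bounded_linear_inner_right)
  have kc: "continuous_on UNIV k"
    using k(1) by (meson continuous_at_imp_continuous_on has_derivative_continuous)
  have ik: "integrable lborel (\<lambda>y. w y * k (x - y))" for x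
    using kernel_integrable[OF w kc k(2)] by simp
  note iK = kernel_integrable[OF w K]
  have ikK: "integrable lborel (\<lambda>y. w y * (k (x' - y) - k (x - y) - K (x - y) \<bullet> h))" for x' h
  proof -
    have "integrable lborel (\<lambda>y. w y * (K (x - y) \<bullet> h))"
      using integrable_inner_left[OF iK[of x]] by (simp add: mult.commute)
    then show ?thesis
      using ik[of x'] ik[of x] by (simp add: right_diff_distrib)
  qed
  fix e :: real assume "e > 0"
  define A where "A = (LINT y:cball 0 (norm x + 1 + R)|lborel. \<bar>w y\<bar>)"
  have "A \<ge> 0" unfolding A_def by (rule set_integral_abs_nonneg)
  define e' where "e' = e / (A + 1)"
  have "e' > 0" using \<open>A \<ge> 0\<close> \<open>e > 0\<close> by (simp add: e'_def)
  then obtain d where d: "d > 0" "d \<le> 1" "\<And>x y. norm (x - y) < d \<Longrightarrow> norm (K x - K y) < e'"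
    using compact_support_uniformly_continuous[OF K] by blast
  have lin: "\<bar>k (z + h) - k z - K z \<bullet> h\<bar> \<le> e' * norm h" if h: "norm h < d" for z h
  proof -
    have "norm (k (z + h) - k z - (K z) \<bullet> (z + h - z)) \<le> norm (z + h - z) * e'"
    proof (rule differentiable_bound_linearization[where S="ball z d" and f'="\<lambda>x h. K x \<bullet> h"])
      show "z + t *\<^sub>R (z + h - z) \<in> ball z d" if "t \<in> {0..1}" for t
        using h mult_left_le_one_le[of "norm h" t] that by (auto simp: dist_norm)
      show "(k has_derivative (\<bullet>) (K x)) (at x within ball z d)" for x
        using k(1) has_derivative_at_withinI by blast
      show "onorm ((\<lambda>h. K x \<bullet> h) - (\<lambda>h. K z \<bullet> h)) \<le> e'" if "x \<in> ball z d" for x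
      proof (rule onorm_le)
        fix v :: "real ^ 'n"
        have "norm (K x - K z) < e'" using d(3)[of x z] that by (simp add: dist_norm norm_minus_commute)
        then have "norm (K x - K z) * norm v \<le> e' * norm v"
          by (intro mult_right_mono) auto
        then show "norm (((\<lambda>h. K x \<bullet> h) - (\<lambda>h. K z \<bullet> h)) v) \<le> e' * norm v"
          using Cauchy_Schwarz_ineq2[of "K x - K z" v] by (simp add: inner_diff_left)
      qed
      show "z \<in> ball z d" using d(1) by simp
    qed
    then show ?thesis by (simp add: mult.commute)
  qed
  have "norm ((LINT y|lborel. w y * k (x' - y)) - (LINT y|lborel. w y * k (x - y)) -
      (LINT y|lborel. w y *\<^sub>R K (x - y)) \<bullet> (x' - x)) \<le> e * norm (x' - x)"
    if x': "norm (x' - x) < d" for x'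
  proof -
    have "(LINT y|lborel. w y *\<^sub>R K (x - y)) \<bullet> (x' - x) = (LINT y|lborel. w y * (K (x - y) \<bullet> (x' - x)))"
      using integral_inner_left[OF iK[of x]] by simp
    moreover have "integrable lborel (\<lambda>y. w y * (K (x - y) \<bullet> (x' - x)))"
      using integrable_inner_left[OF iK[of x]] by (simp add: mult.commute)
    ultimately have "(LINT y|lborel. w y * k (x' - y)) - (LINT y|lborel. w y * k (x - y)) -
      (LINT y|lborel. w y *\<^sub>R K (x - y)) \<bullet> (x' - x) =
      (LINT y|lborel. w y *\<^sub>R (k (x' - y) - k (x - y) - K (x - y) \<bullet> (x' - x)))"
      using ik by (simp add: right_diff_distrib)
    also have "norm \<dots> \<le> (e' * norm (x' - x)) * A"
      unfolding A_def
    proof (rule convolution_increment_bound[OF w])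
      show "integrable lborel (\<lambda>y. w y *\<^sub>R (k (x' - y) - k (x - y) - K (x - y) \<bullet> (x' - x)))"
        using ikK by simp
      show "norm (k (x' - y) - k (x - y) - K (x - y) \<bullet> (x' - x)) \<le> e' * norm (x' - x)" for y
        using lin[OF x', of "x - y"] by (simp add: algebra_simps)
      show "k (x' - y) - k (x - y) - K (x - y) \<bullet> (x' - x) = 0" if "norm y > norm x + 1 + R" for y
      proof -
        have "norm (x - y) > R" "norm (x' - y) > R"
          using that x' d(2) norm_triangle_ineq2[of y x] norm_triangle_ineq2[of y x'] norm_triangle_ineq2[of x' x]
          by (auto simp: norm_minus_commute)
        then show ?thesis using K(2) k(2) by simp
      qed
    qed
    also have "\<dots> = (e' * A) * norm (x' - x)" by simp
    also have "\<dots> \<le> e * norm (x' - x)"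
      using \<open>e > 0\<close> \<open>A \<ge> 0\<close> by (intro mult_right_mono) (auto simp: e'_def field_simps)
    finally show ?thesis .
  qed
  then show "\<exists>d>0. \<forall>x'. norm (x' - x) < d \<longrightarrow> norm ((LINT y|lborel. w y * k (x' - y)) -
     (LINT y|lborel. w y * k (x - y)) - (LINT y|lborel. w y *\<^sub>R K (x - y)) \<bullet> (x' - x)) \<le> e * norm (x' - x)"
    using d(1) by blast
qed

lemma lborel_integral_reflect:
  fixes f :: "'a::euclidean_space \<Rightarrow> 'b::euclidean_space"
  assumes [measurable]: "f \<in> borel_measurable borel"
  shows "(LINT y|lborel. f (x - y)) = (LINT y|lborel. f y)"
proof -
  have "lborel = density (distr lborel borel (\<lambda>y. x + (-1) *\<^sub>R y)) (\<lambda>_. ennreal (\<bar>-1\<bar> ^ DIM('a)))"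
    by (rule lborel_affine) simp
  then have "(lborel :: 'a measure) = distr lborel borel (\<lambda>y. x - y)"
    by (simp add: density_1)
  then have "(LINT y|lborel. f y) = (LINT y|distr lborel borel (\<lambda>y. x - y). f y)"
    by simp
  also have "\<dots> = (LINT y|lborel. f (x - y))"
    by (subst integral_distr) auto
  finally show ?thesis by simp
qed

lemma grad_eq_0_outside:
  assumes "\<forall>x. norm x > R \<longrightarrow> f x = 0" "norm x > R"
  shows "grad f x = 0"
proof (rule grad_eqI)
  have "((\<lambda>x. 0) has_derivative (\<lambda>h. 0)) (at x)" by simp
  moreover have "open (- cball (0::real^'n) R)" by auto
  ultimately have "(f has_derivative (\<lambda>h. 0)) (at x)"
    by (rule has_derivative_transform_within_open[where s="- cball 0 R"]) (use assms in auto)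
  then show "(f has_derivative (\<bullet>) 0) (at x)"
    by (rule has_derivative_eq_rhs) auto
qed

lemma Ck_on_UNIV_grad_continuous:
  assumes "Ck_on (Suc k) UNIV f"
  shows "continuous_on UNIV (grad f)"
proof -
  have "continuous_on UNIV (\<lambda>x. grad f x $ i)" for i
    using assms by (intro Ck_on_UNIV_continuous[of k]) simp
  then have "continuous_on UNIV (\<lambda>x. \<chi> i. grad f x $ i)"
    by (intro continuous_on_vec_lambda) auto
  then show ?thesis by simp
qed

text \<open>Each derivative falls on the kernel, whose partial derivatives are again smooth and
  supported in the same ball; hence the induction generalises over \<rho>.\<close>

lemma convolution_Ck:
  fixes w \<rho> :: "real ^ 'n \<Rightarrow> real"
  assumes w: "loc_int w" and \<rho>: "\<And>k. Ck_on k UNIV \<rho>" "\<forall>x. norm x > R \<longrightarrow> \<rho> x = 0"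
  shows "Ck_on m UNIV (\<lambda>x. LINT y|lborel. w y * \<rho> (x - y))"
  using \<rho>
proof (induction m arbitrary: \<rho>)
  case 0
  show ?case
    using convolution_continuous[OF w Ck_on_UNIV_continuous[OF 0(1)] 0(2)] by simp
next
  case (Suc m)
  have gc: "continuous_on UNIV (grad \<rho>)"
    using Ck_on_UNIV_grad_continuous Suc.prems(1) by blast
  have g0: "\<forall>x. norm x > R \<longrightarrow> grad \<rho> x = 0"
    using grad_eq_0_outside Suc.prems(2) by blast
  show ?case
  proof (rule Ck_on_UNIV_SucI)
    show "((\<lambda>x. LINT y|lborel. w y * \<rho> (x - y)) has_derivative
       (\<lambda>h. (LINT y|lborel. w y *\<^sub>R grad \<rho> (x - y)) \<bullet> h)) (at x)" for x
    proof (rule convolution_has_derivative[OF w])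
      show "(\<rho> has_derivative (\<bullet>) (grad \<rho> x)) (at x)" for x
        using Suc.prems(1)[of 1] by (intro has_derivative_grad) simp
    qed (use gc g0 Suc.prems(2) in auto)
    fix i
    have "(LINT y|lborel. w y *\<^sub>R grad \<rho> (x - y)) $ i = (LINT y|lborel. w y * grad \<rho> (x - y) $ i)" for x
      using integral_inner_right[OF kernel_integrable[OF w gc g0], of "axis i 1" x]
      by (simp add: inner_axis')
    moreover have "Ck_on m UNIV (\<lambda>x. LINT y|lborel. w y * grad \<rho> (x - y) $ i)"
    proof (rule Suc.IH)
      show "Ck_on k UNIV (\<lambda>a. grad \<rho> a $ i)" for k
        using Suc.prems(1)[of "Suc k"] by simp
    qed (use g0 in auto)
    ultimately show "Ck_on m UNIV (\<lambda>x. (LINT y|lborel. w y *\<^sub>R grad \<rho> (x - y)) $ i)"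
      by simp
  qed
qed

section \<open>Convergence of mollifications\<close>

text \<open>For an indicator, squeeze the set between a closed subset C and an open superset T and
  take a Urysohn function: it differs from the indicator at most on T - C, which has small measure.
  Sums and dominated limits then reach every integrable function.\<close>

lemma L1_approx_continuous:
  fixes F :: "'a::euclidean_space \<Rightarrow> 'b::euclidean_space"
  assumes "integrable lborel F" "e > 0"
  shows "\<exists>g. continuous_on UNIV g \<and> (\<integral>\<^sup>+x. ennreal (norm (F x - g x)) \<partial>lborel) \<le> ennreal e"
  using assms
proof (induction arbitrary: e rule: integrable_induct)
  case (base A c)
  then have A: "A \<in> sets borel" "A \<in> sets lebesgue"
    by simp_all
  \<comment> \<open>Two exceptional sets of measure below d cost at most twice d times the norm of
    c; the summand 1 covers c = 0.\<close>
  define d where "d = e / (2 * (norm c + 1))"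
  have "d > 0" using base by (simp add: d_def add_nonneg_pos)
  obtain T where T: "open T" "A \<subseteq> T" "emeasure lebesgue (T - A) < ennreal d"
    by (rule sets_lebesgue_outer_open[OF A(2) \<open>d > 0\<close>])
  obtain C where C: "closed C" "C \<subseteq> A" "emeasure lebesgue (A - C) < ennreal d"
    by (rule sets_lebesgue_inner_closed[OF A(2) \<open>d > 0\<close>])
  have cl: "closed C" "closed (- T)" "C \<inter> - T = {}"
    using C(1,2) T(1,2) by auto
  have "\<exists>f :: 'a \<Rightarrow> real. continuous_on UNIV f \<and> (\<forall>x. f x \<in> closed_segment 1 0) \<and>
      (\<forall>x\<in>C. f x = 1) \<and> (\<forall>x\<in>- T. f x = 0)"
    by (rule Urysohn[OF cl, of "1::real" 0]) blast
  then obtain f :: "'a \<Rightarrow> real" where f: "continuous_on UNIV f" "\<And>x. f x \<in> closed_segment 1 0"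
    "\<And>x. x \<in> C \<Longrightarrow> f x = 1" "\<And>x. x \<in> - T \<Longrightarrow> f x = 0"
    by blast
  have f01: "0 \<le> f x" "f x \<le> 1" for x
    using f(2)[of x] by (simp_all add: closed_segment_eq_real_ivl)
  have meas: "T - A \<in> sets lborel" "A - C \<in> sets lborel"
    using A(1) borel_open[OF T(1)] borel_closed[OF C(1)] by (simp_all add: sets.Diff)
  have "(\<integral>\<^sup>+x. ennreal (norm (indicat_real A x *\<^sub>R c - f x *\<^sub>R c)) \<partial>lborel) \<le>
     (\<integral>\<^sup>+x. ennreal (norm c) * indicator (T - A) x + ennreal (norm c) * indicator (A - C) x \<partial>lborel)"
  proof (intro nn_integral_mono)
    fix x
    have eq: "norm (indicat_real A x *\<^sub>R c - f x *\<^sub>R c) = \<bar>indicat_real A x - f x\<bar> * norm c"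
      unfolding scaleR_left_diff_distrib[symmetric] by (rule norm_scaleR)
    have "\<bar>indicat_real A x - f x\<bar> * norm c \<le> norm c" if "x \<notin> C" "x \<in> T"
      using f01[of x] by (intro mult_left_le_one_le) (auto simp: indicator_def)
    moreover have "\<bar>indicat_real A x - f x\<bar> * norm c = 0" if "x \<in> C \<or> x \<notin> T"
      using that f(3,4)[of x] C(2) T(2) by (auto simp: indicator_def)
    ultimately show "ennreal (norm (indicat_real A x *\<^sub>R c - f x *\<^sub>R c)) \<le>
       ennreal (norm c) * indicator (T - A) x + ennreal (norm c) * indicator (A - C) x"
      unfolding eq using C(2) T(2)
      by (cases "x \<in> C"; cases "x \<in> A"; cases "x \<in> T") (auto intro: ennreal_leI)
  qed
  also have "\<dots> = ennreal (norm c) * emeasure lborel (T - A) + ennreal (norm c) * emeasure lborel (A - C)"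
    using meas by (subst nn_integral_add) (auto simp: nn_integral_cmult_indicator)
  also have "\<dots> \<le> ennreal (norm c) * ennreal d + ennreal (norm c) * ennreal d"
    using T(3) C(3) meas by (intro add_mono mult_left_mono) (auto simp: less_imp_le)
  also have "\<dots> = ennreal (norm c * d + norm c * d)"
    using \<open>d > 0\<close> by (subst ennreal_plus) (auto simp: ennreal_mult)
  also have "\<dots> \<le> ennreal e"
  proof (rule ennreal_leI)
    have "2 * (norm c + 1) > 0" by (simp add: add_nonneg_pos)
    then have "2 * (norm c + 1) * d = e" unfolding d_def by simp
    then show "norm c * d + norm c * d \<le> e" using \<open>d > 0\<close> by (simp add: algebra_simps)
  qed
  finally show ?case
    by (intro exI[of _ "\<lambda>x. f x *\<^sub>R c"] conjI continuous_on_scaleR f(1) continuous_on_const)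
next
  case (add F1 F2)
  then have "e / 2 > 0" by simp
  obtain g1 where g1: "continuous_on UNIV g1"
    "(\<integral>\<^sup>+x. ennreal (norm (F1 x - g1 x)) \<partial>lborel) \<le> ennreal (e / 2)"
    using add.IH(1)[OF \<open>e / 2 > 0\<close>] by blast
  obtain g2 where g2: "continuous_on UNIV g2"
    "(\<integral>\<^sup>+x. ennreal (norm (F2 x - g2 x)) \<partial>lborel) \<le> ennreal (e / 2)"
    using add.IH(2)[OF \<open>e / 2 > 0\<close>] by blast
  note g = g1(1) g2(1) g1(2) g2(2)
  have [measurable]: "g1 \<in> borel_measurable borel" "g2 \<in> borel_measurable borel"
    "F1 \<in> borel_measurable borel" "F2 \<in> borel_measurable borel"
    using g add.hyps borel_measurable_continuous_onI by auto
  have "(\<integral>\<^sup>+x. ennreal (norm (F1 x + F2 x - (g1 x + g2 x))) \<partial>lborel) \<le>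
     (\<integral>\<^sup>+x. ennreal (norm (F1 x - g1 x)) + ennreal (norm (F2 x - g2 x)) \<partial>lborel)"
  proof (intro nn_integral_mono)
    fix x
    have "norm (F1 x + F2 x - (g1 x + g2 x)) \<le> norm (F1 x - g1 x) + norm (F2 x - g2 x)"
      by (rule norm_diff_triangle_ineq)
    then show "ennreal (norm (F1 x + F2 x - (g1 x + g2 x))) \<le> ennreal (norm (F1 x - g1 x)) + ennreal (norm (F2 x - g2 x))"
      by (simp add: ennreal_leI flip: ennreal_plus)
  qed
  also have "\<dots> = (\<integral>\<^sup>+x. ennreal (norm (F1 x - g1 x)) \<partial>lborel) + (\<integral>\<^sup>+x. ennreal (norm (F2 x - g2 x)) \<partial>lborel)"
    by (intro nn_integral_add) measurable
  also have "\<dots> \<le> ennreal (e / 2) + ennreal (e / 2)"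
    using g by (intro add_mono)
  also have "\<dots> = ennreal e" using \<open>e / 2 > 0\<close> by (simp flip: ennreal_plus)
  finally show ?case
    using g(1,2) by (intro exI[of _ "\<lambda>x. g1 x + g2 x"]) (auto intro!: continuous_intros)
next
  case (lim F s)
  have "(\<lambda>i. \<integral>\<^sup>+x. ennreal (norm (F x - s i x)) \<partial>lborel) \<longlonglongrightarrow> 0"
  proof (rule nn_integral_dominated_convergence_norm[where w="\<lambda>x. 2 * norm (F x)"])
    show "(\<integral>\<^sup>+ x. ennreal (2 * norm (F x)) \<partial>lborel) < \<infinity>"
      using lim.hyps(4)
      by (auto simp: integrable_iff_bounded ennreal_mult nn_integral_cmult ennreal_mult_less_top)
  qed (use lim.hyps in auto)
  moreover have "ennreal (e / 2) > 0" using lim by simp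
  ultimately have "\<forall>\<^sub>F i in sequentially. (\<integral>\<^sup>+x. ennreal (norm (F x - s i x)) \<partial>lborel) < ennreal (e / 2)"
    by (rule order_tendstoD)
  then obtain i where i: "(\<integral>\<^sup>+x. ennreal (norm (F x - s i x)) \<partial>lborel) < ennreal (e / 2)"
    by (auto simp: eventually_sequentially)
  have "e / 2 > 0" using lim by simp
  then obtain g where g: "continuous_on UNIV g" "(\<integral>\<^sup>+x. ennreal (norm (s i x - g x)) \<partial>lborel) \<le> ennreal (e / 2)"
    using lim.IH by blast
  have [measurable]: "g \<in> borel_measurable borel" "F \<in> borel_measurable borel" "s i \<in> borel_measurable borel"
    using g lim.hyps borel_measurable_continuous_onI by auto
  have "(\<integral>\<^sup>+x. ennreal (norm (F x - g x)) \<partial>lborel) \<le>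
     (\<integral>\<^sup>+x. ennreal (norm (F x - s i x)) + ennreal (norm (s i x - g x)) \<partial>lborel)"
  proof (intro nn_integral_mono)
    fix x
    have "norm (F x - g x) \<le> norm (F x - s i x) + norm (s i x - g x)"
      using norm_triangle_ineq[of "F x - s i x" "s i x - g x"] by simp
    then show "ennreal (norm (F x - g x)) \<le> ennreal (norm (F x - s i x)) + ennreal (norm (s i x - g x))"
      by (simp add: ennreal_leI flip: ennreal_plus)
  qed
  also have "\<dots> = (\<integral>\<^sup>+x. ennreal (norm (F x - s i x)) \<partial>lborel) + (\<integral>\<^sup>+x. ennreal (norm (s i x - g x)) \<partial>lborel)"
    by (intro nn_integral_add) measurable
  also have "\<dots> \<le> ennreal (e / 2) + ennreal (e / 2)"
    using g i by (intro add_mono) auto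
  also have "\<dots> = ennreal e" using \<open>e / 2 > 0\<close> by (simp flip: ennreal_plus)
  finally show ?case using g(1) by blast
qed

section \<open>Bounds for mollified functions\<close>

definition mollify :: "(real ^ 'n \<Rightarrow> real) \<Rightarrow> (real ^ 'n \<Rightarrow> 'b::euclidean_space) \<Rightarrow> real ^ 'n \<Rightarrow> 'b" where
  "mollify \<rho> F x = (LINT y|lborel. \<rho> (x - y) *\<^sub>R F y)"

lemma mollifierD:
  assumes "mollifier d \<rho>"
  shows "Ck_on k UNIV \<rho>" "\<rho> x \<ge> 0" "norm x > d \<Longrightarrow> \<rho> x = 0" "(LINT x|lborel. \<rho> x) = 1"
    "continuous_on UNIV \<rho>" "\<rho> \<in> borel_measurable borel" "integrable lborel \<rho>"
    "\<forall>x. norm x > d \<longrightarrow> \<rho> x = 0"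
  using assms Ck_on_UNIV_continuous[of 0 \<rho>] borel_measurable_continuous_onI[of \<rho>]
    integrable_continuous_compact_support[of \<rho> d]
  by (auto simp: mollifier_def)

lemma mollifier_reflect_integral:
  assumes "mollifier d \<rho>"
  shows "(LINT y|lborel. \<rho> (x - y)) = 1"
  using lborel_integral_reflect[OF mollifierD(6)[OF assms], of x] mollifierD(4)[OF assms] by simp

lemma mollifier_reflect_integrable:
  assumes "mollifier d \<rho>"
  shows "integrable lborel (\<lambda>y. \<rho> (x - y))"
  using kernel_integrable'[OF loc_int_continuous mollifierD(5,8)[OF assms], of "\<lambda>_. 1::real" x] by simp

lemma mollify_integrable:
  assumes "mollifier d \<rho>" "loc_int F"
  shows "integrable lborel (\<lambda>y. \<rho> (x - y) *\<^sub>R F y)"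
  using assms by (intro kernel_integrable' mollifierD)

lemma mollify_measurable [measurable]:
  assumes [measurable]: "\<rho> \<in> borel_measurable borel" "F \<in> borel_measurable borel"
  shows "mollify \<rho> F \<in> borel_measurable borel"
  unfolding mollify_def by measurable

text \<open>Tonelli's theorem: the integral of \<rho>(x - y) over all x is 1, and a point x of the
  ball of radius R sees only points y of the ball of radius R + d.\<close>

lemma nn_integral_mollify_le:
  fixes f :: "real ^ 'n \<Rightarrow> ennreal"
  assumes \<rho>: "mollifier d \<rho>" and f[measurable]: "f \<in> borel_measurable borel"
  shows "(\<integral>\<^sup>+x\<in>cball 0 R. (\<integral>\<^sup>+y. ennreal (\<rho> (x - y)) * f y \<partial>lborel) \<partial>lborel) \<le> (\<integral>\<^sup>+y\<in>cball 0 (R + d). f y \<partial>lborel)"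
proof -
  note [measurable] = mollifierD(6)[OF \<rho>]
  have [measurable]: "f \<in> borel_measurable lborel" "cball (0 :: real ^ 'n) R \<in> sets borel"
    "cball (0 :: real ^ 'n) R \<in> sets lborel"
    using f by auto
  have "(\<integral>\<^sup>+x\<in>cball 0 R. (\<integral>\<^sup>+y. ennreal (\<rho> (x - y)) * f y \<partial>lborel) \<partial>lborel) =
     (\<integral>\<^sup>+x. (\<integral>\<^sup>+y. ennreal (\<rho> (x - y)) * indicator (cball 0 R) x * f y \<partial>lborel) \<partial>lborel)"
    by (intro nn_integral_cong) (simp add: nn_integral_cmult[symmetric] mult_ac)
  also have "\<dots> = (\<integral>\<^sup>+y. (\<integral>\<^sup>+x. ennreal (\<rho> (x - y)) * indicator (cball 0 R) x * f y \<partial>lborel) \<partial>lborel)"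
    by (rule lborel_pair.Fubini') measurable
  also have "\<dots> \<le> (\<integral>\<^sup>+y\<in>cball 0 (R + d). f y \<partial>lborel)"
  proof (intro nn_integral_mono)
    fix y :: "real ^ 'n"
    show "(\<integral>\<^sup>+x. ennreal (\<rho> (x - y)) * indicator (cball 0 R) x * f y \<partial>lborel) \<le> f y * indicator (cball 0 (R + d)) y"
    proof (cases "y \<in> cball 0 (R + d)")
      case True
      have "(\<integral>\<^sup>+x. ennreal (\<rho> (x - y)) \<partial>lborel) = (\<integral>\<^sup>+x. ennreal (\<rho> x) \<partial>distr lborel borel ((+) (- y)))"
        by (subst nn_integral_distr) auto
      also have "\<dots> = (\<integral>\<^sup>+x. ennreal (\<rho> x) \<partial>lborel)"
        by (simp add: lborel_distr_plus)
      also have "\<dots> = 1"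
        using nn_integral_eq_integral[OF mollifierD(7)[OF \<rho>]] mollifierD(2,4)[OF \<rho>] by simp
      finally have 1: "(\<integral>\<^sup>+x. ennreal (\<rho> (x - y)) \<partial>lborel) = 1" .
      have "(\<integral>\<^sup>+x. ennreal (\<rho> (x - y)) * indicator (cball 0 R) x * f y \<partial>lborel) \<le>
          (\<integral>\<^sup>+x. ennreal (\<rho> (x - y)) * f y \<partial>lborel)"
        by (intro nn_integral_mono) (auto simp: indicator_def)
      also have "\<dots> = f y"
        using 1 by (simp add: nn_integral_multc)
      finally show ?thesis using True by simp
    next
      case False
      have 0: "ennreal (\<rho> (x - y)) * indicator (cball 0 R) x * f y = 0" for x
      proof (cases "norm x \<le> R")
        case True
        then have "norm (x - y) > d"
          using False norm_triangle_ineq2[of y x] by (simp add: norm_minus_commute)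
        then show ?thesis using mollifierD(3)[OF \<rho>] by simp
      qed simp
      show ?thesis unfolding 0 by simp
    qed
  qed
  finally show ?thesis .
qed

text \<open>Rearranged, this says that the graph of t powr p lies above its tangent at s. It is the
  form of convexity that can be integrated against a probability density.\<close>

lemma young_tangent:
  fixes s t p :: real
  assumes "p > 1" "s \<ge> 0" "t \<ge> 0"
  shows "s powr (p - 1) * t \<le> t powr p / p + (1 - 1 / p) * s powr p"
proof -
  have q: "p / (p - 1) > 1" "1 / p + 1 / (p / (p - 1)) = 1"
    using assms(1) by (auto simp: field_simps)
  have "t * s powr (p - 1) \<le> t powr p / p + (s powr (p - 1)) powr (p / (p - 1)) / (p / (p - 1))"
    by (rule Youngs_inequality[OF assms(1) q]) (use assms in auto)
  also have "(s powr (p - 1)) powr (p / (p - 1)) = s powr p"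
    using assms(1) by (simp add: powr_powr)
  also have "s powr p / (p / (p - 1)) = (1 - 1 / p) * s powr p"
    using assms(1) by (simp add: field_simps)
  finally show ?thesis by (simp add: mult.commute)
qed

text \<open>Jensen's inequality for the probability density \<rho>(x - y): integrate the tangent
  inequality at the point s, the \<rho>-mean of the norm of \<open>F\<close>.\<close>

lemma mollify_powr_le:
  fixes F :: "real ^ 'n \<Rightarrow> 'b::euclidean_space"
  assumes \<rho>: "mollifier d \<rho>" and F: "loc_int F" and p: "p > 1" and Fp: "loc_int (\<lambda>y. norm (F y) powr p)"
  shows "norm (mollify \<rho> F x) powr p \<le> (LINT y|lborel. \<rho> (x - y) * norm (F y) powr p)"
proof -
  note i = mollify_integrable[OF \<rho> F, of x]
  define s where "s = (LINT y|lborel. \<rho> (x - y) * norm (F y))"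
  have is1: "integrable lborel (\<lambda>y. \<rho> (x - y) * norm (F y))"
    using integrable_norm[OF i] mollifierD(2)[OF \<rho>] by simp
  have ip: "integrable lborel (\<lambda>y. \<rho> (x - y) * norm (F y) powr p)"
    using mollify_integrable[OF \<rho> Fp] by simp
  have i1: "integrable lborel (\<lambda>y. \<rho> (x - y))"
    by (rule mollifier_reflect_integrable[OF \<rho>])
  have "s \<ge> 0" unfolding s_def using mollifierD(2)[OF \<rho>] by simp
  have "norm (mollify \<rho> F x) \<le> s"
    using integral_norm_bound[of lborel "\<lambda>y. \<rho> (x - y) *\<^sub>R F y"] mollifierD(2)[OF \<rho>]
    by (simp add: mollify_def s_def)
  then have 1: "norm (mollify \<rho> F x) powr p \<le> s powr p"
    using p by (simp add: powr_mono2)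
  have "s powr (p - 1) * s = (LINT y|lborel. s powr (p - 1) * (\<rho> (x - y) * norm (F y)))"
    by (simp add: s_def)
  also have "\<dots> \<le> (LINT y|lborel. (1 / p) * (\<rho> (x - y) * norm (F y) powr p) + ((1 - 1 / p) * s powr p) * \<rho> (x - y))"
  proof (rule integral_mono)
    show "s powr (p - 1) * (\<rho> (x - y) * norm (F y)) \<le>
      (1 / p) * (\<rho> (x - y) * norm (F y) powr p) + ((1 - 1 / p) * s powr p) * \<rho> (x - y)" for y
      using mult_left_mono[OF young_tangent[OF p \<open>s \<ge> 0\<close> norm_ge_zero[of "F y"]] mollifierD(2)[OF \<rho>, of "x - y"]]
      by (simp add: algebra_simps)
  qed (use is1 ip i1 in auto)
  also have "\<dots> = (1 / p) * (LINT y|lborel. \<rho> (x - y) * norm (F y) powr p) + ((1 - 1 / p) * s powr p) * (LINT y|lborel. \<rho> (x - y))"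
    using ip i1 by simp
  also have "s powr (p - 1) * s = s powr p"
    using \<open>s \<ge> 0\<close> p by (cases "s = 0") (auto simp: powr_diff)
  finally have "s powr p / p \<le> (LINT y|lborel. \<rho> (x - y) * norm (F y) powr p) / p"
    using mollifier_reflect_integral[OF \<rho>, of x] by (simp add: algebra_simps)
  then show ?thesis using 1 p by (simp add: divide_le_cancel)
qed

lemma nn_integral_mollify_powr_le:
  fixes F :: "real ^ 'n \<Rightarrow> 'b::euclidean_space"
  assumes \<rho>: "mollifier d \<rho>" and F: "loc_int F" and p: "p > 1" and Fp: "loc_int (\<lambda>y. norm (F y) powr p)"
  shows "(\<integral>\<^sup>+x\<in>cball 0 R. ennreal (norm (mollify \<rho> F x) powr p) \<partial>lborel) \<le>
     (\<integral>\<^sup>+x\<in>cball 0 (R + d). ennreal (norm (F x) powr p) \<partial>lborel)"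
proof -
  have [measurable]: "F \<in> borel_measurable borel" using F by (rule loc_int_borel)
  have ip: "integrable lborel (\<lambda>y. \<rho> (x - y) * norm (F y) powr p)" for x
    using mollify_integrable[OF \<rho> Fp] by simp
  have "(\<integral>\<^sup>+x\<in>cball 0 R. ennreal (norm (mollify \<rho> F x) powr p) \<partial>lborel) \<le>
    (\<integral>\<^sup>+x\<in>cball 0 R. (\<integral>\<^sup>+y. ennreal (\<rho> (x - y)) * ennreal (norm (F y) powr p) \<partial>lborel) \<partial>lborel)"
  proof (intro nn_integral_mono mult_right_mono)
    fix x
    have "ennreal (norm (mollify \<rho> F x) powr p) \<le> ennreal (LINT y|lborel. \<rho> (x - y) * norm (F y) powr p)"
      by (rule ennreal_leI[OF mollify_powr_le[OF assms]])
    also have "\<dots> = (\<integral>\<^sup>+y. ennreal (\<rho> (x - y) * norm (F y) powr p) \<partial>lborel)"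
      using mollifierD(2)[OF \<rho>] by (intro nn_integral_eq_integral[symmetric] ip) auto
    also have "\<dots> = (\<integral>\<^sup>+y. ennreal (\<rho> (x - y)) * ennreal (norm (F y) powr p) \<partial>lborel)"
      using mollifierD(2)[OF \<rho>] by (simp add: ennreal_mult)
    finally show "ennreal (norm (mollify \<rho> F x) powr p) \<le> \<dots>" .
  qed simp
  also have "\<dots> \<le> (\<integral>\<^sup>+x\<in>cball 0 (R + d). ennreal (norm (F x) powr p) \<partial>lborel)"
    by (rule nn_integral_mollify_le[OF \<rho>]) measurable
  finally show ?thesis .
qed

text \<open>Replace \<open>F\<close> on a ball by a continuous g that is close in L^1. Averaging
  F(y) - F(x) against the kernel leaves the oscillation of g, which costs e/2 over the ball, and two
  copies of the approximation error, one at y and one at x, costing e/4 each. The error at y is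
  mollified, which by \<open>nn_integral_mollify_le\<close> does not increase its integral.\<close>

lemma mollify_L1_convergence:
  fixes F :: "real ^ 'n \<Rightarrow> 'b::euclidean_space"
  assumes F: "loc_int F" and e: "e > 0"
  obtains d where "d > 0" "d \<le> 1"
    "\<And>\<delta> \<rho>. mollifier \<delta> \<rho> \<Longrightarrow> \<delta> \<le> d \<Longrightarrow>
      (\<integral>\<^sup>+x\<in>cball 0 R. ennreal (norm (mollify \<rho> F x - F x)) \<partial>lborel) \<le> ennreal e"
proof -
  \<comment> \<open>Kernels of radius at most 1 evaluate \<open>F\<close> only within distance 1 of
    the ball of radius R, so the truncation is invisible there.\<close>
  define F1 where "F1 x = indicator (cball 0 (R + 1)) x *\<^sub>R F x" for x
  have F1i: "integrable lborel F1"
    using F unfolding loc_int_def set_integrable_def F1_def by blast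
  then obtain g where g: "continuous_on UNIV g"
    "(\<integral>\<^sup>+x. ennreal (norm (F1 x - g x)) \<partial>lborel) \<le> ennreal (e / 4)"
    using L1_approx_continuous[OF F1i, of "e / 4"] e by auto
  have Fm[measurable]: "F \<in> borel_measurable borel" using F by (rule loc_int_borel)
  have [measurable]: "F1 \<in> borel_measurable borel"
    using borel_measurable_integrable[OF F1i] by simp
  have [measurable]: "g \<in> borel_measurable borel" using g(1) borel_measurable_continuous_onI by blast
  have [measurable]: "cball (0 :: real ^ 'n) R \<in> sets borel" by simp
  define v where "v = measure lborel (cball (0 :: real ^ 'n) R)"
  have v: "emeasure lborel (cball (0 :: real ^ 'n) R) = ennreal v" "v \<ge> 0"
    using emeasure_lborel_cball_finite[of "0 :: real ^ 'n" R]
    by (auto simp: v_def emeasure_eq_ennreal_measure)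
  define e2 where "e2 = e / (2 * (v + 1))"
  have e2: "e2 > 0" "e2 * v \<le> e / 2"
    using v(2) e by (auto simp: e2_def field_simps)
  have "uniformly_continuous_on (cball 0 (R + 2)) g"
    by (intro compact_uniformly_continuous continuous_on_subset[OF g(1)]) auto
  then obtain d where d: "d > 0"
    "\<And>x y. x \<in> cball 0 (R + 2) \<Longrightarrow> y \<in> cball 0 (R + 2) \<Longrightarrow> dist y x < d \<Longrightarrow> dist (g y) (g x) < e2"
    using \<open>e2 > 0\<close> unfolding uniformly_continuous_on_def by meson
  show ?thesis
  proof
    show "min (d / 2) 1 > 0" "min (d / 2) 1 \<le> 1" using d(1) by auto
    fix \<delta> and \<rho> :: "real ^ 'n \<Rightarrow> real"
    assume \<rho>: "mollifier \<delta> \<rho>" and \<delta>: "\<delta> \<le> min (d / 2) 1"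
    note [measurable] = mollifierD(6)[OF \<rho>]
    have i1: "integrable lborel (\<lambda>y. \<rho> (x - y))" for x
      by (rule mollifier_reflect_integrable[OF \<rho>])
    have nn1: "(\<integral>\<^sup>+y. ennreal (\<rho> (x - y)) \<partial>lborel) = 1" for x
      using nn_integral_eq_integral[OF i1[of x]] mollifierD(2)[OF \<rho>] mollifier_reflect_integral[OF \<rho>]
      by simp
    have pt: "ennreal (norm (mollify \<rho> F x - F x)) \<le>
       (\<integral>\<^sup>+y. ennreal (\<rho> (x - y)) * ennreal (norm (F1 y - g y)) \<partial>lborel) + (ennreal e2 + ennreal (norm (F1 x - g x)))"
      if x: "x \<in> cball 0 R" for x
    proof -
      have "mollify \<rho> F x - F x = (LINT y|lborel. \<rho> (x - y) *\<^sub>R F y) - (LINT y|lborel. \<rho> (x - y)) *\<^sub>R F x"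
        using mollifier_reflect_integral[OF \<rho>] by (simp add: mollify_def)
      also have "\<dots> = (LINT y|lborel. \<rho> (x - y) *\<^sub>R (F y - F x))"
        using mollify_integrable[OF \<rho> F, of x] i1[of x] by (simp add: scaleR_diff_right)
      finally have eq: "mollify \<rho> F x - F x = (LINT y|lborel. \<rho> (x - y) *\<^sub>R (F y - F x))" .
      have "ennreal (norm (mollify \<rho> F x - F x)) \<le> (\<integral>\<^sup>+y. ennreal (norm (\<rho> (x - y) *\<^sub>R (F y - F x))) \<partial>lborel)"
        unfolding eq
        by (rule integral_norm_bound_ennreal)
          (use mollify_integrable[OF \<rho> F, of x] i1[of x] in \<open>auto simp: scaleR_diff_right\<close>)
      also have "\<dots> \<le> (\<integral>\<^sup>+y. ennreal (\<rho> (x - y)) * ennreal (norm (F1 y - g y)) +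
           ennreal (\<rho> (x - y)) * (ennreal e2 + ennreal (norm (F1 x - g x))) \<partial>lborel)"
      proof (intro nn_integral_mono)
        fix y
        have "norm (\<rho> (x - y) *\<^sub>R (F y - F x)) \<le> \<rho> (x - y) * (norm (F1 y - g y) + (e2 + norm (F1 x - g x)))"
        proof (cases "norm (x - y) > \<delta>")
          case True
          then show ?thesis using mollifierD(3)[OF \<rho>] by simp
        next
          case False
          then have ny: "norm y \<le> R + 1"
            using x \<delta> norm_triangle_ineq2[of y x] by (simp add: norm_minus_commute)
          then have F1: "F1 y = F y" "F1 x = F x"
            using x by (auto simp: F1_def)
          have "norm (g y - g x) < e2"
            using d(2)[of x y] ny x False \<delta> d(1) by (simp add: dist_norm norm_minus_commute)
          moreover have "norm (F y - F x) \<le> norm (F1 y - g y) + norm (g y - g x) + norm (F1 x - g x)"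
            unfolding F1 by norm
          ultimately have "norm (F y - F x) \<le> norm (F1 y - g y) + (e2 + norm (F1 x - g x))" by simp
          then show ?thesis
            using mollifierD(2)[OF \<rho>, of "x - y"] by (simp add: mult_left_mono)
        qed
        then have "ennreal (norm (\<rho> (x - y) *\<^sub>R (F y - F x))) \<le>
            ennreal (\<rho> (x - y) * (norm (F1 y - g y) + (e2 + norm (F1 x - g x))))"
          by (rule ennreal_leI)
        also have "\<dots> = ennreal (\<rho> (x - y)) * ennreal (norm (F1 y - g y)) +
            ennreal (\<rho> (x - y)) * (ennreal e2 + ennreal (norm (F1 x - g x)))"
          using mollifierD(2)[OF \<rho>] e2(1)
          by (simp add: distrib_left ennreal_mult ennreal_plus)
        finally show "ennreal (norm (\<rho> (x - y) *\<^sub>R (F y - F x))) \<le> \<dots>" .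
      qed
      also have "\<dots> = (\<integral>\<^sup>+y. ennreal (\<rho> (x - y)) * ennreal (norm (F1 y - g y)) \<partial>lborel) +
           (ennreal e2 + ennreal (norm (F1 x - g x)))"
        by (subst nn_integral_add) (auto simp: nn_integral_multc nn1)
      finally show ?thesis .
    qed
    have "(\<integral>\<^sup>+x\<in>cball 0 R. ennreal (norm (mollify \<rho> F x - F x)) \<partial>lborel) \<le>
      (\<integral>\<^sup>+x. (\<integral>\<^sup>+y. ennreal (\<rho> (x - y)) * ennreal (norm (F1 y - g y)) \<partial>lborel) * indicator (cball 0 R) x +
        (ennreal e2 * indicator (cball 0 R) x + ennreal (norm (F1 x - g x))) \<partial>lborel)"
    proof (intro nn_integral_mono)
      fix x
      show "ennreal (norm (mollify \<rho> F x - F x)) * indicator (cball 0 R) x \<le>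
        (\<integral>\<^sup>+y. ennreal (\<rho> (x - y)) * ennreal (norm (F1 y - g y)) \<partial>lborel) * indicator (cball 0 R) x +
        (ennreal e2 * indicator (cball 0 R) x + ennreal (norm (F1 x - g x)))"
        using pt[of x] by (cases "x \<in> cball 0 R") auto
    qed
    also have "\<dots> = (\<integral>\<^sup>+x\<in>cball 0 R. (\<integral>\<^sup>+y. ennreal (\<rho> (x - y)) * ennreal (norm (F1 y - g y)) \<partial>lborel) \<partial>lborel) +
        (ennreal e2 * ennreal v + (\<integral>\<^sup>+x. ennreal (norm (F1 x - g x)) \<partial>lborel))"
      by (subst nn_integral_add, measurable)
        (subst nn_integral_add, auto simp: nn_integral_cmult_indicator v)
    also have "\<dots> \<le> ennreal (e / 4) + (ennreal (e / 2) + ennreal (e / 4))"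
    proof (intro add_mono g(2))
      have "(\<integral>\<^sup>+x\<in>cball 0 R. (\<integral>\<^sup>+y. ennreal (\<rho> (x - y)) * ennreal (norm (F1 y - g y)) \<partial>lborel) \<partial>lborel) \<le>
         (\<integral>\<^sup>+x\<in>cball 0 (R + \<delta>). ennreal (norm (F1 x - g x)) \<partial>lborel)"
        by (rule nn_integral_mollify_le[OF \<rho>]) measurable
      also have "\<dots> \<le> (\<integral>\<^sup>+x. ennreal (norm (F1 x - g x)) \<partial>lborel)"
        by (intro nn_integral_mono) (auto simp: indicator_def)
      also note g(2)
      finally show "(\<integral>\<^sup>+x\<in>cball 0 R. (\<integral>\<^sup>+y. ennreal (\<rho> (x - y)) * ennreal (norm (F1 y - g y)) \<partial>lborel) \<partial>lborel) \<le> ennreal (e / 4)" .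
      show "ennreal e2 * ennreal v \<le> ennreal (e / 2)"
        using e2 v(2) by (simp add: ennreal_leI flip: ennreal_mult)
    qed
    also have "\<dots> = ennreal (e / 4 + (e / 2 + e / 4))"
      using e by (subst ennreal_plus, simp, simp, subst ennreal_plus) auto
    also have "e / 4 + (e / 2 + e / 4) = e" by simp
    finally show "(\<integral>\<^sup>+x\<in>cball 0 R. ennreal (norm (mollify \<rho> F x - F x)) \<partial>lborel) \<le> ennreal e" .
  qed
qed

section \<open>Pairing mollified gradients with the flux\<close>

lemma nn_integral_tail_le:
  fixes h k :: "'a::euclidean_space \<Rightarrow> real"
  assumes [measurable]: "h \<in> borel_measurable borel" "k \<in> borel_measurable borel" "A \<in> sets borel"
    and fin: "(\<integral>\<^sup>+x\<in>A. ennreal (h x) \<partial>lborel) < \<infinity>" and "e > 0"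
  obtains m :: nat where "(\<integral>\<^sup>+x\<in>A. ennreal (h x) * indicator {x. k x > real m} x \<partial>lborel) \<le> ennreal e"
proof -
  have "(\<lambda>m. \<integral>\<^sup>+x. ennreal (h x) * indicator {x. k x > real m} x * indicator A x \<partial>lborel)
      \<longlonglongrightarrow> (\<integral>\<^sup>+(x::'a). 0 \<partial>lborel)"
  proof (rule nn_integral_dominated_convergence)
    show "(\<integral>\<^sup>+x. ennreal (h x) * indicator A x \<partial>lborel) < \<infinity>" by (rule fin)
    show "AE x in lborel. (\<lambda>m. ennreal (h x) * indicator {x. k x > real m} x * indicator A x) \<longlonglongrightarrow> 0"
    proof (intro AE_I2)
      fix x
      obtain m0 where "k x < real m0" using reals_Archimedean2 by blast
      then have "\<forall>\<^sub>F m in sequentially. ennreal (h x) * indicator {x. k x > real m} x * indicator A x = 0"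
        by (auto simp: eventually_sequentially intro!: exI[of _ m0])
      then show "(\<lambda>m. ennreal (h x) * indicator {x. k x > real m} x * indicator A x) \<longlonglongrightarrow> 0"
        by (rule tendsto_eventually)
    qed
  qed (auto simp: indicator_def)
  then have lim: "(\<lambda>m. \<integral>\<^sup>+x. ennreal (h x) * indicator {x. k x > real m} x * indicator A x \<partial>lborel) \<longlonglongrightarrow> 0"
    by simp
  have "\<forall>\<^sub>F m in sequentially.
      (\<integral>\<^sup>+x. ennreal (h x) * indicator {x. k x > real m} x * indicator A x \<partial>lborel) < ennreal e"
    by (rule order_tendstoD(2)[OF lim]) (use \<open>e > 0\<close> in simp)
  then show ?thesis
    using that by (meson eventually_sequentially less_imp_le order_refl)
qed

text \<open>Compare s with g / \<mu>: either s is absorbed by g, or g is absorbed by \<mu> s. The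
  gain is that a small \<mu> makes the coefficient of s powr p small, at the price of a large one in
  front of g powr p.\<close>

lemma powr_product_split:
  fixes g s \<mu> p :: real
  assumes "p > 1" "\<mu> > 0" "g \<ge> 0" "s \<ge> 0"
  shows "g powr (p - 1) * s \<le> \<mu> powr (p - 1) * s powr p + g powr p / \<mu>"
proof (cases "s \<le> g / \<mu>")
  case True
  then have "g powr (p - 1) * s \<le> g powr (p - 1) * (g / \<mu>)"
    by (intro mult_left_mono) auto
  also have "\<dots> = g powr p / \<mu>"
    using assms by (cases "g = 0") (auto simp: powr_diff)
  finally show ?thesis by (simp add: add_increasing)
next
  case False
  then have "g \<le> \<mu> * s" using assms by (simp add: field_simps)
  then have "g powr (p - 1) \<le> (\<mu> * s) powr (p - 1)"
    using assms by (intro powr_mono2) auto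
  then have "g powr (p - 1) * s \<le> \<mu> powr (p - 1) * (s powr (p - 1) * s)"
    using assms by (simp add: powr_mult mult_right_mono flip: mult.assoc)
  also have "s powr (p - 1) * s = s powr p"
    using assms by (cases "s = 0") (auto simp: powr_diff)
  finally show ?thesis using assms by (simp add: add_increasing2)
qed

text \<open>Where the norm of \<open>G\<close> is at most m, \<open>V\<close> is bounded and
  convergence in L^1 is enough. Where it exceeds m, \<open>powr_product_split\<close> separates the
  mollified gradient from \<open>G\<close>: the p-th power of the former has a bounded integral by
  Jensen and carries a small factor, while the p-th power of \<open>G\<close> over this set is a
  small tail. The constants are fixed in the order \<mu>, m, d, since each depends on the earlier
  ones.\<close>

lemma mollify_pairing_convergence:
  fixes G V :: "real ^ 'n \<Rightarrow> real ^ 'n"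
  assumes G: "loc_int G" and p: "p > 1" and Gp: "loc_int (\<lambda>y. norm (G y) powr p)"
    and V[measurable]: "V \<in> borel_measurable borel"
    and VC: "\<And>x. norm (V x) \<le> C * norm (G x) powr (p - 1)" and C: "C \<ge> 0" and e: "e > 0"
  obtains d where "d > 0" "d \<le> 1"
    "\<And>\<delta> \<rho>. mollifier \<delta> \<rho> \<Longrightarrow> \<delta> \<le> d \<Longrightarrow>
      (\<integral>\<^sup>+x\<in>cball 0 R. ennreal (norm (V x) * norm (mollify \<rho> G x - G x)) \<partial>lborel) \<le> ennreal e"
proof -
  have [measurable]: "G \<in> borel_measurable borel" using G by (rule loc_int_borel)
  have ball[measurable]: "cball (0 :: real ^ 'n) r \<in> sets borel" for r by simp
  define B where "B = (LINT x:cball 0 (R + 1)|lborel. norm (G x) powr p)"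
  have B: "(\<integral>\<^sup>+x\<in>cball 0 (R + 1). ennreal (norm (G x) powr p) \<partial>lborel) = ennreal B"
  proof -
    have "set_integrable lborel (cball 0 (R + 1)) (\<lambda>x. norm (G x) powr p)"
      using Gp by (simp add: loc_int_def)
    then show ?thesis
      unfolding B_def set_integrable_def set_lebesgue_integral_def
      by (subst nn_integral_eq_integral[symmetric])
        (auto simp: indicator_def intro!: nn_integral_cong)
  qed
  have "B \<ge> 0" unfolding B_def set_lebesgue_integral_def by (rule Bochner_Integration.integral_nonneg) auto
  \<comment> \<open>Chosen so that \<open>C * \<mu> powr (p - 1) * B \<le> e / 3\<close>, where
    \<open>B\<close> bounds the p-energy of every mollification of radius at most 1.\<close>
  define \<mu> where "\<mu> = (e / (3 * (C * B + 1))) powr (1 / (p - 1))"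
  have "C * B + 1 > 0" using C \<open>B \<ge> 0\<close> by (simp add: add_nonneg_pos)
  then have q: "e / (3 * (C * B + 1)) > 0" using e by simp
  then have "\<mu> > 0" unfolding \<mu>_def powr_gt_zero by linarith
  have "\<mu> powr (p - 1) = e / (3 * (C * B + 1))"
  proof -
    have "1 / (p - 1) * (p - 1) = 1" using p by simp
    then show ?thesis using q unfolding \<mu>_def powr_powr by (simp only: powr_one less_imp_le)
  qed
  moreover have "C * B * (e / (3 * (C * B + 1))) \<le> e / 3"
    using \<open>C * B + 1 > 0\<close> e by (simp add: field_simps)
  ultimately have \<mu>: "C * \<mu> powr (p - 1) * B \<le> e / 3"
    by (simp only: mult_ac)
  define c where "c = C * (1 + 1 / \<mu>)"
  have "c \<ge> 0" using C \<open>\<mu> > 0\<close> by (simp add: c_def)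
  have "(\<integral>\<^sup>+x\<in>cball 0 R. ennreal (norm (G x) powr p) \<partial>lborel) \<le> ennreal B"
    unfolding B[symmetric] by (intro nn_integral_mono) (auto simp: indicator_def)
  then have fin: "(\<integral>\<^sup>+x\<in>cball 0 R. ennreal (norm (G x) powr p) \<partial>lborel) < \<infinity>"
    using order_le_less_trans by fastforce
  have "e / (3 * (c + 1)) > 0" using e \<open>c \<ge> 0\<close> by simp
  then obtain m :: nat where m: "(\<integral>\<^sup>+x\<in>cball 0 R. ennreal (norm (G x) powr p) *
       indicator {x. norm (G x) > real m} x \<partial>lborel) \<le> ennreal (e / (3 * (c + 1)))"
    using nn_integral_tail_le[OF _ _ ball fin, of "\<lambda>x. norm (G x)" "e / (3 * (c + 1))"] by auto
  \<comment> \<open>The bound for \<open>V\<close> where the norm of \<open>G\<close> is at most m,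
    hence the weight of the L^1 error; the radius d is chosen after it.\<close>
  define c2 where "c2 = C * real m powr (p - 1)"
  have "c2 \<ge> 0" using C by (simp add: c2_def)
  then have "e / (3 * (c2 + 1)) > 0" using e by simp
  from mollify_L1_convergence[OF G this, of R] obtain d where d: "d > 0" "d \<le> 1"
    "\<And>\<delta> \<rho>. mollifier \<delta> \<rho> \<Longrightarrow> \<delta> \<le> d \<Longrightarrow>
      (\<integral>\<^sup>+x\<in>cball 0 R. ennreal (norm (mollify \<rho> G x - G x)) \<partial>lborel) \<le> ennreal (e / (3 * (c2 + 1)))"
    by blast
  show ?thesis
  proof
    show "d > 0" "d \<le> 1" by fact+
    fix \<delta> and \<rho> :: "real ^ 'n \<Rightarrow> real"
    assume \<rho>: "mollifier \<delta> \<rho>" and \<delta>: "\<delta> \<le> d"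
    note [measurable] = mollifierD(6)[OF \<rho>]
    have pt: "norm (V x) * norm (mollify \<rho> G x - G x) \<le>
       c2 * norm (mollify \<rho> G x - G x) + (C * \<mu> powr (p - 1)) * norm (mollify \<rho> G x) powr p
        + c * (norm (G x) powr p * indicator {x. norm (G x) > real m} x)" for x
    proof -
      let ?g = "norm (G x)" and ?s = "norm (mollify \<rho> G x)" and ?D = "norm (mollify \<rho> G x - G x)"
      have 1: "norm (V x) * ?D \<le> C * ?g powr (p - 1) * ?D"
        using VC by (intro mult_right_mono) auto
      show ?thesis
      proof (cases "?g > real m")
        case False
        then have "?g powr (p - 1) \<le> real m powr (p - 1)"
          using p by (intro powr_mono2) auto
        then have "C * ?g powr (p - 1) * ?D \<le> c2 * ?D"
          unfolding c2_def using C by (intro mult_right_mono mult_left_mono) auto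
        moreover have "0 \<le> (C * \<mu> powr (p - 1)) * ?s powr p" using C by simp
        ultimately show ?thesis using 1 False by simp
      next
        case True
        have gp: "?g powr (p - 1) * ?g = ?g powr p"
          using p by (cases "?g = 0") (auto simp: powr_diff)
        have "?g powr (p - 1) * ?D \<le> ?g powr (p - 1) * (?s + ?g)"
          by (intro mult_left_mono norm_triangle_ineq4) auto
        also have "\<dots> \<le> \<mu> powr (p - 1) * ?s powr p + (1 + 1 / \<mu>) * ?g powr p"
          using powr_product_split[OF p \<open>\<mu> > 0\<close>, of ?g ?s] gp by (simp add: algebra_simps)
        finally have "C * ?g powr (p - 1) * ?D \<le> C * (\<mu> powr (p - 1) * ?s powr p + (1 + 1 / \<mu>) * ?g powr p)"
          using C by (simp add: mult_left_mono mult.assoc)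
        also have "\<dots> = (C * \<mu> powr (p - 1)) * ?s powr p + c * ?g powr p"
          by (simp add: c_def algebra_simps)
        finally have "norm (V x) * ?D \<le> (C * \<mu> powr (p - 1)) * ?s powr p + c * ?g powr p"
          using 1 by linarith
        moreover have "0 \<le> c2 * ?D" using \<open>c2 \<ge> 0\<close> by simp
        ultimately show ?thesis using True by simp
      qed
    qed
    have "(\<integral>\<^sup>+x\<in>cball 0 R. ennreal (norm (V x) * norm (mollify \<rho> G x - G x)) \<partial>lborel) \<le>
       (\<integral>\<^sup>+x. ennreal c2 * (ennreal (norm (mollify \<rho> G x - G x)) * indicator (cball 0 R) x) +
         (ennreal (C * \<mu> powr (p - 1)) * (ennreal (norm (mollify \<rho> G x) powr p) * indicator (cball 0 R) x) +
         ennreal c * (ennreal (norm (G x) powr p) * indicator {x. norm (G x) > real m} x * indicator (cball 0 R) x)) \<partial>lborel)"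
    proof (intro nn_integral_mono)
      fix x
      have "ennreal (norm (V x) * norm (mollify \<rho> G x - G x)) \<le>
        ennreal (c2 * norm (mollify \<rho> G x - G x) + ((C * \<mu> powr (p - 1)) * norm (mollify \<rho> G x) powr p
        + c * (norm (G x) powr p * indicator {x. norm (G x) > real m} x)))"
        using pt[of x] by (intro ennreal_leI) simp
      also have "\<dots> = ennreal c2 * ennreal (norm (mollify \<rho> G x - G x)) +
         (ennreal (C * \<mu> powr (p - 1)) * ennreal (norm (mollify \<rho> G x) powr p) +
         ennreal c * (ennreal (norm (G x) powr p) * indicator {x. norm (G x) > real m} x))"
        using \<open>c2 \<ge> 0\<close> C \<open>c \<ge> 0\<close>
        by (simp add: ennreal_plus ennreal_mult' ennreal_indicator[symmetric])
      finally show "ennreal (norm (V x) * norm (mollify \<rho> G x - G x)) * indicator (cball 0 R) x \<le>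
         ennreal c2 * (ennreal (norm (mollify \<rho> G x - G x)) * indicator (cball 0 R) x) +
         (ennreal (C * \<mu> powr (p - 1)) * (ennreal (norm (mollify \<rho> G x) powr p) * indicator (cball 0 R) x) +
         ennreal c * (ennreal (norm (G x) powr p) * indicator {x. norm (G x) > real m} x * indicator (cball 0 R) x))"
        by (cases "x \<in> cball 0 R") auto
    qed
    also have "\<dots> = ennreal c2 * (\<integral>\<^sup>+x\<in>cball 0 R. ennreal (norm (mollify \<rho> G x - G x)) \<partial>lborel) +
       (ennreal (C * \<mu> powr (p - 1)) * (\<integral>\<^sup>+x\<in>cball 0 R. ennreal (norm (mollify \<rho> G x) powr p) \<partial>lborel) +
       ennreal c * (\<integral>\<^sup>+x\<in>cball 0 R. ennreal (norm (G x) powr p) * indicator {x. norm (G x) > real m} x \<partial>lborel))"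
      by (subst nn_integral_add, measurable)
        (subst nn_integral_add, auto simp: nn_integral_cmult)
    also have "\<dots> \<le> ennreal c2 * ennreal (e / (3 * (c2 + 1))) +
       (ennreal (C * \<mu> powr (p - 1)) * ennreal B + ennreal c * ennreal (e / (3 * (c + 1))))"
    proof (intro add_mono mult_left_mono d(3)[OF \<rho> \<delta>] m)
      have "(\<integral>\<^sup>+x\<in>cball 0 R. ennreal (norm (mollify \<rho> G x) powr p) \<partial>lborel) \<le>
         (\<integral>\<^sup>+x\<in>cball 0 (R + \<delta>). ennreal (norm (G x) powr p) \<partial>lborel)"
        by (rule nn_integral_mollify_powr_le[OF \<rho> G p Gp])
      also have "\<dots> \<le> ennreal B"
        unfolding B[symmetric] using \<delta> d(2) by (intro nn_integral_mono) (auto simp: indicator_def)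
      finally show "(\<integral>\<^sup>+x\<in>cball 0 R. ennreal (norm (mollify \<rho> G x) powr p) \<partial>lborel) \<le> ennreal B" .
    qed auto
    also have "\<dots> = ennreal (c2 * (e / (3 * (c2 + 1))) + ((C * \<mu> powr (p - 1)) * B + c * (e / (3 * (c + 1)))))"
    proof -
      have "ennreal r1 * ennreal s1 + (ennreal r2 * ennreal s2 + ennreal r3 * ennreal s3) =
          ennreal (r1 * s1 + (r2 * s2 + r3 * s3))"
        if "r1 \<ge> 0" "s1 \<ge> 0" "r2 \<ge> 0" "s2 \<ge> 0" "r3 \<ge> 0" "s3 \<ge> 0" for r1 s1 r2 s2 r3 s3
        using that by (simp add: ennreal_plus ennreal_mult)
      then show ?thesis
        using \<open>c2 \<ge> 0\<close> \<open>c \<ge> 0\<close> C \<open>B \<ge> 0\<close> e by simp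
    qed
    also have "\<dots> \<le> ennreal e"
    proof (rule ennreal_leI)
      have "c2 * (e / (3 * (c2 + 1))) \<le> e / 3" "c * (e / (3 * (c + 1))) \<le> e / 3"
        using \<open>c2 \<ge> 0\<close> \<open>c \<ge> 0\<close> e by (auto simp: field_simps)
      then show "c2 * (e / (3 * (c2 + 1))) + ((C * \<mu> powr (p - 1)) * B + c * (e / (3 * (c + 1)))) \<le> e"
        using \<mu> by linarith
    qed
    finally show "(\<integral>\<^sup>+x\<in>cball 0 R. ennreal (norm (V x) * norm (mollify \<rho> G x - G x)) \<partial>lborel) \<le> ennreal e" .
  qed
qed

section \<open>The anisotropic flux\<close>

context
  fixes H :: "real ^ 'n \<Rightarrow> real"
  assumes H: "anisotropy H"
begin

lemma anisotropy_scale: "t > 0 \<Longrightarrow> H (t *\<^sub>R x) = t * H x"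
  using H by (simp add: anisotropy_def)

lemma anisotropy_pos: "x \<noteq> 0 \<Longrightarrow> H x > 0"
proof -
  assume x: "x \<noteq> 0"
  have "H x = H (norm x *\<^sub>R (x /\<^sub>R norm x))" using x by simp
  also have "\<dots> = norm x * H (x /\<^sub>R norm x)" using x by (intro anisotropy_scale) simp
  also have "\<dots> > 0"
  proof -
    have "\<forall>y\<in>sphere 0 1. H y > 0" using H by (simp add: anisotropy_def)
    then have "H (x /\<^sub>R norm x) > 0" by (rule bspec) (use x in simp)
    then show ?thesis using x by (intro mult_pos_pos) auto
  qed
  finally show ?thesis .
qed

lemma anisotropy_has_derivative:
  assumes "x \<noteq> 0"
  shows "(H has_derivative (\<lambda>h. grad H x \<bullet> h)) (at x)"
proof (rule has_derivative_grad)
  have "Ck_on (Suc 1) (UNIV - {0}) H" using H by (simp add: anisotropy_def numeral_2_eq_2)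
  then show "H differentiable (at x)" using assms by simp
qed

lemma anisotropy_grad_continuous: "continuous_on (- {0}) (grad H)"
proof -
  have "Ck_on (Suc (Suc 0)) (UNIV - {0}) H" using H by (simp add: anisotropy_def numeral_2_eq_2)
  then have "continuous_on (UNIV - {0}) (\<lambda>x. grad H x $ i)" for i
    using Ck_on_SucD[of 0 "UNIV - {0}" "\<lambda>x. grad H x $ i"] by simp
  then have "continuous_on (UNIV - {0}) (\<lambda>x. \<chi> i. grad H x $ i)"
    by (intro continuous_on_vec_lambda) auto
  then show ?thesis by (simp add: Compl_eq_Diff_UNIV)
qed

text \<open>Euler's relation: t \<mapsto> H(t x) has two expressions for its derivative at 1, one by
  the chain rule and one by homogeneity.\<close>

lemma anisotropy_euler:
  assumes x: "x \<noteq> 0"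
  shows "grad H x \<bullet> x = H x"
proof -
  have "((\<lambda>t. t *\<^sub>R x) has_derivative (\<lambda>s. s *\<^sub>R x)) (at 1)"
    by (auto intro!: derivative_eq_intros)
  from has_derivative_compose[OF this, of H "\<lambda>h. grad H x \<bullet> h"]
  have 1: "((\<lambda>t. H (t *\<^sub>R x)) has_derivative (\<lambda>s. grad H x \<bullet> (s *\<^sub>R x))) (at 1)"
    using anisotropy_has_derivative[OF x] by simp
  have "((\<lambda>t. t * H x) has_derivative (\<lambda>s. s * H x)) (at (1::real))"
    by (auto intro!: derivative_eq_intros)
  then have "((\<lambda>t. H (t *\<^sub>R x)) has_derivative (\<lambda>s. s * H x)) (at 1)"
    by (rule has_derivative_transform_within_open[where s="{0<..}"]) (auto simp: anisotropy_scale)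
  from has_derivative_unique[OF 1 this] have "grad H x \<bullet> (1 *\<^sub>R x) = 1 * H x" by metis
  then show ?thesis by simp
qed

lemma anisotropy_grad_scale:
  assumes x: "x \<noteq> 0" and t: "t > 0"
  shows "grad H (t *\<^sub>R x) = grad H x"
proof -
  have "((\<lambda>x. t *\<^sub>R x) has_derivative (\<lambda>h. t *\<^sub>R h)) (at x)"
    by (auto intro!: derivative_eq_intros)
  from has_derivative_compose[OF this anisotropy_has_derivative[of "t *\<^sub>R x"]]
  have 1: "((\<lambda>x. H (t *\<^sub>R x)) has_derivative (\<lambda>h. grad H (t *\<^sub>R x) \<bullet> (t *\<^sub>R h))) (at x)"
    using x t by simp
  have "((\<lambda>x. t * H x) has_derivative (\<lambda>h. t * (grad H x \<bullet> h))) (at x)"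
    using anisotropy_has_derivative[OF x] by (auto intro!: derivative_eq_intros)
  then have 2: "((\<lambda>x. H (t *\<^sub>R x)) has_derivative (\<lambda>h. t * (grad H x \<bullet> h))) (at x)"
    using t by (simp add: anisotropy_scale)
  from has_derivative_unique[OF 1 2] have "grad H (t *\<^sub>R x) \<bullet> (t *\<^sub>R h) = t * (grad H x \<bullet> h)" for h by metis
  then have "(grad H (t *\<^sub>R x) - grad H x) \<bullet> h = 0" for h using t by (simp add: inner_diff_left)
  then have "(grad H (t *\<^sub>R x) - grad H x) \<bullet> (grad H (t *\<^sub>R x) - grad H x) = 0" .
  then show ?thesis by simp
qed

lemma flux_eq:
  assumes x: "x \<noteq> 0" and p: "p > 1"
  shows "flux H p x = (H x powr (p - 1)) *\<^sub>R grad H x"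
proof -
  have "((\<lambda>t. t powr p) has_real_derivative p * H x powr (p - 1)) (at (H x))"
    using anisotropy_pos[OF x] by (auto intro!: derivative_eq_intros)
  then have "((\<lambda>t. t powr p) has_derivative (\<lambda>h. (p * H x powr (p - 1)) * h)) (at (H x))"
    by (simp add: has_field_derivative_def)
  from has_derivative_compose[OF anisotropy_has_derivative[OF x] this]
  have "((\<lambda>y. H y powr p) has_derivative (\<lambda>h. ((p * H x powr (p - 1)) *\<^sub>R grad H x) \<bullet> h)) (at x)"
    by simp
  from grad_eqI[OF this] show ?thesis using x p by (simp add: flux_def)
qed

text \<open>The flux is continuous away from the origin, and its value 0 there is prescribed, so the
  gradient of \<open>H\<close> at 0 never enters. Borel measurability is what makes its composition
  with a merely Lebesgue measurable gradient measurable.\<close>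

lemma flux_measurable:
  assumes p: "p > 1"
  shows "flux H p \<in> borel_measurable borel"
proof -
  have "continuous_on (- {0}) (\<lambda>x. (H x powr (p - 1)) *\<^sub>R grad H x)"
  proof (intro continuous_intros anisotropy_grad_continuous)
    show "continuous_on (- {0}) H" using H by (auto simp: anisotropy_def intro: continuous_on_subset)
    show "\<forall>x\<in>- {0}. H x \<noteq> 0" using anisotropy_pos by force
  qed
  then have "(\<lambda>x. if x \<in> {0} then 0 else (H x powr (p - 1)) *\<^sub>R grad H x) \<in> borel_measurable borel"
    by (intro borel_measurable_continuous_on_if) auto
  moreover have "(\<lambda>x. if x \<in> {0} then 0 else (H x powr (p - 1)) *\<^sub>R grad H x) = flux H p"
    using flux_eq[OF _ p] by (auto simp: flux_def)
  ultimately show ?thesis by simp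
qed

text \<open>Homogeneity reduces everything to the compact unit sphere: \<open>H\<close> lies between
  positive multiples m and M of the norm, and its gradient, homogeneous of degree 0, is bounded by
  K. Euler's relation gives flux(x) \<bullet> x = H(x) powr p, so the coercivity constant is m powr
  p.\<close>

lemma flux_bounds:
  assumes p: "p > 1"
  obtains C c where "C > 0" "c > 0" "\<And>x. norm (flux H p x) \<le> C * norm x powr (p - 1)"
    "\<And>x. flux H p x \<bullet> x \<ge> c * norm x powr p"
proof -
  have sp: "compact (sphere (0::real^'n) 1)" "sphere (0::real^'n) 1 \<noteq> {}" by auto
  have "continuous_on (sphere 0 1) H" using H by (auto simp: anisotropy_def intro: continuous_on_subset)
  from continuous_attains_inf[OF sp this] obtain x0 where x0: "x0 \<in> sphere 0 1" "\<forall>x\<in>sphere 0 1. H x0 \<le> H x" by blast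
  from continuous_attains_sup[OF sp \<open>continuous_on (sphere 0 1) H\<close>] obtain x1 where
    x1: "x1 \<in> sphere 0 1" "\<forall>x\<in>sphere 0 1. H x \<le> H x1" by blast
  define m where "m = H x0" define M where "M = H x1"
  have mM: "m > 0" "M > 0" using x0(1) x1(1) H by (auto simp: m_def M_def anisotropy_def)
  have "continuous_on (sphere 0 1) (grad H)"
    by (rule continuous_on_subset[OF anisotropy_grad_continuous]) auto
  then have "compact (grad H ` sphere 0 1)" using sp compact_continuous_image by blast
  then obtain K where K: "K > 0" "\<And>x. x \<in> sphere 0 1 \<Longrightarrow> norm (grad H x) \<le> K"
    using compact_imp_bounded bounded_pos by (metis image_eqI)
  have nz: "m * norm x \<le> H x" "H x \<le> M * norm x" "norm (grad H x) \<le> K" if x: "x \<noteq> 0" for x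
  proof -
    have s: "x /\<^sub>R norm x \<in> sphere 0 1" using x by simp
    have "H (x /\<^sub>R norm x) = H x / norm x" using x by (simp add: anisotropy_scale divide_inverse mult.commute)
    then have "m \<le> H x / norm x" "H x / norm x \<le> M"
      using bspec[OF x0(2) s] bspec[OF x1(2) s] by (simp_all add: m_def M_def)
    then show "m * norm x \<le> H x" "H x \<le> M * norm x"
      using x by (simp_all add: pos_le_divide_eq pos_divide_le_eq)
    show "norm (grad H x) \<le> K" using K(2)[OF s] anisotropy_grad_scale[OF x, of "inverse (norm x)"] x by simp
  qed
  show ?thesis
  proof (rule that)
    show "M powr (p - 1) * K > 0" "m powr p > 0" using mM K by auto
    show "norm (flux H p x) \<le> (M powr (p - 1) * K) * norm x powr (p - 1)" for x
    proof (cases "x = 0")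
      case False
      have "H x powr (p - 1) \<le> (M * norm x) powr (p - 1)"
        using nz(2)[OF False] anisotropy_pos[OF False] p by (intro powr_mono2) auto
      then have "norm (flux H p x) \<le> (M * norm x) powr (p - 1) * K"
        using nz(3)[OF False] by (simp add: flux_eq[OF False p] mult_mono)
      then show ?thesis using mM by (simp add: powr_mult mult_ac)
    qed (simp add: flux_def)
    show "flux H p x \<bullet> x \<ge> m powr p * norm x powr p" for x
    proof (cases "x = 0")
      case False
      have "(m * norm x) powr p \<le> H x powr p"
        using nz(1)[OF False] mM p by (intro powr_mono2) auto
      also have "H x powr p = H x powr (p - 1) * H x"
        using anisotropy_pos[OF False] by (simp add: powr_diff)
      also have "\<dots> = flux H p x \<bullet> x"
        by (simp add: flux_eq[OF False p] anisotropy_euler[OF False])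
      finally show ?thesis using mM by (simp add: powr_mult)
    qed simp
  qed
qed

end

section \<open>Cutoff functions of small energy\<close>

text \<open>The gradient is carried as an explicit function, so that chain and product rules yield
  it in closed form and it can be compared with its mollification.\<close>

definition C1_grad :: "(real ^ 'n \<Rightarrow> real) \<Rightarrow> (real ^ 'n \<Rightarrow> real ^ 'n) \<Rightarrow> bool" where
  "C1_grad f F \<longleftrightarrow> (\<forall>x. (f has_derivative (\<lambda>h. F x \<bullet> h)) (at x)) \<and> continuous_on UNIV F"

text \<open>Squaring smooths the corner of the positive part just enough to be continuously
  differentiable, which is all that the cutoffs need once the test inequality is extended to C^1
  functions.\<close>

lemma has_real_derivative_max_square:
  "((\<lambda>t. (max 0 t)\<^sup>2) has_real_derivative 2 * max 0 t) (at (t::real))"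
proof -
  consider "t < 0" | "t = 0" | "t > 0" by linarith
  then show ?thesis
  proof cases
    case 1
    have "((\<lambda>t. 0) has_real_derivative 0) (at t)" by simp
    moreover have "\<forall>\<^sub>F s in nhds t. (max 0 s)\<^sup>2 = 0"
      using eventually_nhds_in_open[of "{..<0}" t] 1 by (auto elim!: eventually_mono)
    ultimately have "((\<lambda>t. (max 0 t)\<^sup>2) has_real_derivative 0) (at t)"
      by (subst DERIV_cong_ev[OF refl _ refl])
    then show ?thesis using 1 by simp
  next
    case 2
    have "((\<lambda>h::real. max 0 h) \<longlongrightarrow> 0) (at 0)"
      by (auto intro!: tendsto_eq_intros)
    then have "((\<lambda>h::real. ((max 0 (0 + h))\<^sup>2 - (max 0 0)\<^sup>2) / h) \<longlongrightarrow> 0) (at 0)"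
      by (rule Lim_transform_eventually)
        (auto simp: eventually_at_filter max_def power2_eq_square)
    then show ?thesis using 2 by (simp add: DERIV_def)
  next
    case 3
    have "((\<lambda>t. t\<^sup>2) has_real_derivative 2 * t) (at t)"
      by (auto intro!: derivative_eq_intros)
    moreover have "\<forall>\<^sub>F s in nhds t. (max 0 s)\<^sup>2 = s\<^sup>2"
      using eventually_nhds_in_open[of "{0<..}" t] 3 by (auto elim!: eventually_mono)
    ultimately have "((\<lambda>t. (max 0 t)\<^sup>2) has_real_derivative 2 * t) (at t)"
      by (subst DERIV_cong_ev[OF refl _ refl])
    then show ?thesis using 3 by simp
  qed
qed

text \<open>A C^1 cutoff on the line, equal to 1 up to s = 1 and to 0 from s = 2 on. The inner
  squared positive part makes the junction at 1 differentiable, the outer one the junction at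
  2.\<close>

definition plateau :: "real \<Rightarrow> real" where
  "plateau s = (max 0 (1 - (max 0 (s - 1))\<^sup>2))\<^sup>2"

definition plateau_deriv :: "real \<Rightarrow> real" where
  "plateau_deriv s = - (4 * max 0 (1 - (max 0 (s - 1))\<^sup>2) * max 0 (s - 1))"

lemma plateau_has_derivative: "(plateau has_real_derivative plateau_deriv s) (at s)"
proof -
  have "((\<lambda>s. s - 1) has_real_derivative 1) (at s)" by (auto intro!: derivative_eq_intros)
  from DERIV_chain2[OF has_real_derivative_max_square this]
  have "((\<lambda>s. 1 - (max 0 (s - 1))\<^sup>2) has_real_derivative - (2 * max 0 (s - 1))) (at s)"
    using DERIV_diff[OF DERIV_const] by fastforce
  from DERIV_chain2[OF has_real_derivative_max_square this]
  show ?thesis by (simp add: plateau_def[abs_def] plateau_deriv_def mult_ac)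
qed

lemma max_one_minus_square: "s \<ge> 2 \<Longrightarrow> max 0 (1 - (max 0 (s - 1))\<^sup>2) = (0::real)"
proof -
  assume s: "s \<ge> 2"
  then have "1 \<le> (s - 1)\<^sup>2" by (intro one_le_power) simp
  moreover have "max 0 (s - 1) = s - 1" using s by simp
  ultimately show ?thesis by (simp only: max_def) auto
qed

lemma plateau_bounds:
  "0 \<le> plateau s" "plateau s \<le> 1" "s \<le> 1 \<Longrightarrow> plateau s = 1" "s \<ge> 2 \<Longrightarrow> plateau s = 0"
proof -
  show "plateau s = 0" if "s \<ge> 2"
    unfolding plateau_def max_one_minus_square[OF that] by simp
qed (auto simp: plateau_def max_def power_le_one)

lemma plateau_deriv_bounds:
  "\<bar>plateau_deriv s\<bar> \<le> 4" "s \<le> 1 \<or> s \<ge> 2 \<Longrightarrow> plateau_deriv s = 0"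
proof -
  show z: "plateau_deriv s = 0" if "s \<le> 1 \<or> s \<ge> 2"
  proof (cases "s \<le> 1")
    case False
    then have "s \<ge> 2" using that by simp
    then show ?thesis unfolding plateau_deriv_def max_one_minus_square[OF \<open>s \<ge> 2\<close>] by simp
  qed (simp add: plateau_deriv_def)
  show "\<bar>plateau_deriv s\<bar> \<le> 4"
  proof (cases "s \<le> 1 \<or> s \<ge> 2")
    case False
    then have "max 0 (1 - (max 0 (s - 1))\<^sup>2) * max 0 (s - 1) \<le> 1 * 1"
      by (intro mult_mono) (auto simp: max_def)
    moreover have "0 \<le> max 0 (1 - (max 0 (s - 1))\<^sup>2) * max 0 (s - 1)" by simp
    ultimately show ?thesis unfolding plateau_deriv_def by (simp add: abs_mult)
  qed (simp add: z)
qed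

section \<open>Dyadic cutoffs and their average\<close>

lemma two_power_squared: "((2::real) ^ j)\<^sup>2 = 4 ^ j"
  by (simp add: power2_eq_square flip: power_mult_distrib)

text \<open>The squared radius is used because it is smooth at the origin. The cutoff descends from
  1 to 0 while the radius runs from 2^j to sqrt 2 times 2^j, so the transition shells of different j
  are disjoint.\<close>

definition dyadic_cutoff :: "nat \<Rightarrow> real ^ 'n \<Rightarrow> real" where
  "dyadic_cutoff j x = plateau ((x \<bullet> x) / 4 ^ j)"

definition dyadic_grad :: "nat \<Rightarrow> real ^ 'n \<Rightarrow> real ^ 'n" where
  "dyadic_grad j x = (plateau_deriv ((x \<bullet> x) / 4 ^ j) * (2 / 4 ^ j)) *\<^sub>R x"

lemma dyadic_cutoff_has_derivative:
  "(dyadic_cutoff j has_derivative (\<lambda>h. dyadic_grad j x \<bullet> h)) (at x)"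
proof -
  have 1: "((\<lambda>x. (x \<bullet> x) / 4 ^ j) has_derivative (\<lambda>h. (x \<bullet> h + h \<bullet> x) / 4 ^ j)) (at x)"
    by (auto intro!: derivative_eq_intros)
  have 2: "(plateau has_derivative (\<lambda>h. plateau_deriv ((x \<bullet> x) / 4 ^ j) * h)) (at ((x \<bullet> x) / 4 ^ j))"
    using plateau_has_derivative by (simp add: has_field_derivative_def)
  show ?thesis
    unfolding dyadic_cutoff_def[abs_def]
    by (rule has_derivative_eq_rhs[OF has_derivative_compose[OF 1 2]])
      (auto simp: dyadic_grad_def inner_commute field_simps)
qed

lemma dyadic_grad_continuous: "continuous_on UNIV (dyadic_grad j)"
  unfolding dyadic_grad_def[abs_def] plateau_deriv_def
  by (intro continuous_intros) auto

lemma dyadic_grad_bound: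
  fixes x :: "real ^ 'n"
  shows "norm (dyadic_grad j x) \<le> 16 / 2 ^ j * indicator {x. 4 ^ j < x \<bullet> x \<and> x \<bullet> x < 2 * 4 ^ j} x"
proof (cases "4 ^ j < x \<bullet> x \<and> x \<bullet> x < 2 * 4 ^ j")
  case True
  have "(norm x)\<^sup>2 \<le> (2 * 2 ^ j)\<^sup>2"
    using True by (simp add: power2_norm_eq_inner power_mult_distrib two_power_squared)
  then have nx: "norm x \<le> 2 * 2 ^ j"
    by (rule power2_le_imp_le) simp
  have "norm (dyadic_grad j x) = \<bar>plateau_deriv ((x \<bullet> x) / 4 ^ j)\<bar> * (2 / 4 ^ j) * norm x"
    by (simp add: dyadic_grad_def abs_mult)
  also have "\<dots> \<le> 4 * (2 / 4 ^ j) * (2 * 2 ^ j)"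
    using plateau_deriv_bounds(1) nx by (intro mult_mono) auto
  also have "\<dots> = 16 / 2 ^ j"
  proof -
    have "(4::real) ^ j = 2 ^ j * 2 ^ j" by (simp flip: power_mult_distrib)
    then show ?thesis by (simp add: field_simps)
  qed
  finally show ?thesis using True by simp
next
  case False
  then have "(x \<bullet> x) / 4 ^ j \<le> 1 \<or> (x \<bullet> x) / 4 ^ j \<ge> 2" by (auto simp: field_simps)
  then show ?thesis using plateau_deriv_bounds(2) by (auto simp: dyadic_grad_def False)
qed

text \<open>At most one summand is nonzero. Hence the n-th power of the sum loses no factor
  depending on the number of terms, which is the gain behind averaging over scales.\<close>

lemma norm_sum_single_le:
  fixes a :: "'i \<Rightarrow> 'b::real_normed_vector"
  assumes "finite J" "n > 0" "\<And>i j. i \<in> J \<Longrightarrow> j \<in> J \<Longrightarrow> i \<noteq> j \<Longrightarrow> a i = 0 \<or> a j = 0"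
  shows "norm (sum a J) ^ n \<le> (\<Sum>j\<in>J. norm (a j) ^ n)"
proof (cases "\<exists>i\<in>J. a i \<noteq> 0")
  case True
  then obtain i where i: "i \<in> J" "a i \<noteq> 0" by blast
  then have "a j = 0" if "j \<in> J - {i}" for j using assms(3)[of i j] that by auto
  then have "sum a J = a i" using i assms(1) by (simp add: sum.remove[of J i])
  then show ?thesis using i assms(1) member_le_sum[of i J "\<lambda>j. norm (a j) ^ n"] by simp
next
  case False
  then show ?thesis using assms(2) by (simp add: power_0_left)
qed

text \<open>Averaging the cutoffs at the scales \<open>2, 4, \<dots>, 2 ^ N\<close>, whose gradients have disjoint supports,
  shows that balls have zero n-capacity.\<close>
lemma ex_small_cutoff:
  assumes n: "CARD('n) \<ge> 2" and e: "e > 0"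
  obtains \<eta> :: "real ^ 'n \<Rightarrow> real" and F R where "C1_grad \<eta> F" "\<And>x. 0 \<le> \<eta> x" "\<And>x. \<eta> x \<le> 1"
    "\<And>x. norm x \<le> 1 \<Longrightarrow> \<eta> x = 1" "\<forall>x. norm x > R \<longrightarrow> \<eta> x = 0" "\<forall>x. norm x > R \<longrightarrow> F x = 0"
    "(LINT x|lborel. norm (F x) ^ CARD('n)) \<le> e"
proof -
  let ?n = "CARD('n)"
  \<comment> \<open>The number 32 is the gradient bound 16 / 2^j times the radius 2 * 2^j of a ball
    containing the j-th shell. The scale cancels because the gradient is raised to the power n, the
    dimension.\<close>
  define A where "A = 32 ^ ?n * unit_ball_vol (real ?n)"
  have "A \<ge> 0" by (simp add: A_def unit_ball_vol_nonneg)
  obtain N :: nat where N: "N > 0" "A / e \<le> real N"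
    using real_arch_simple[of "A / e"] reals_Archimedean2[of "max 1 (A / e)"]
    by (metis gr0I less_imp_le max.strict_boundedE not_one_less_zero of_nat_0)
  define \<eta> :: "real ^ 'n \<Rightarrow> real" where "\<eta> x = (\<Sum>j\<in>{1..N}. dyadic_cutoff j x) / N" for x
  define F :: "real ^ 'n \<Rightarrow> real ^ 'n" where "F x = (1 / N) *\<^sub>R (\<Sum>j\<in>{1..N}. dyadic_grad j x)" for x
  define S where "S j = {x :: real ^ 'n. 4 ^ j < x \<bullet> x \<and> x \<bullet> x < 2 * 4 ^ j}" for j :: nat
  have S_open: "open (S j)" for j
    unfolding S_def by (intro open_Collect_conj open_Collect_less continuous_intros)
  have S_sub: "S j \<subseteq> cball 0 (2 * 2 ^ j)" for j
  proof
    fix x assume "x \<in> S j"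
    then have "(norm x)\<^sup>2 \<le> (2 * 2 ^ j)\<^sup>2"
      by (simp add: S_def power2_norm_eq_inner power_mult_distrib two_power_squared)
    then have "norm x \<le> 2 * 2 ^ j" by (rule power2_le_imp_le) simp
    then show "x \<in> cball 0 (2 * 2 ^ j)" by simp
  qed
  have S_meas: "integrable lborel (\<lambda>x. indicat_real (S j) x)"
    "measure lborel (S j) \<le> unit_ball_vol (real ?n) * (2 * 2 ^ j) ^ ?n" for j
  proof -
    have fin: "emeasure lborel (cball (0 :: real ^ 'n) (2 * 2 ^ j)) < \<infinity>"
      by (rule emeasure_lborel_cball_finite)
    have "emeasure lborel (S j) \<le> emeasure lborel (cball (0 :: real ^ 'n) (2 * 2 ^ j))"
      using S_sub by (intro emeasure_mono) auto
    then have "emeasure lborel (S j) < \<infinity>" using fin by (rule order_le_less_trans)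
    then show "integrable lborel (\<lambda>x. indicat_real (S j) x)"
      using S_open by (intro integrable_real_indicator) auto
    have "measure lborel (S j) \<le> measure lborel (cball (0 :: real ^ 'n) (2 * 2 ^ j))"
      using S_sub S_open fin by (intro measure_mono_fmeasurable) (auto simp: fmeasurable_def)
    also have "\<dots> = unit_ball_vol (real ?n) * (2 * 2 ^ j) ^ ?n"
      using content_cball[of "2 * 2 ^ j" "0 :: real ^ 'n"] by simp
    finally show "measure lborel (S j) \<le> unit_ball_vol (real ?n) * (2 * 2 ^ j) ^ ?n" .
  qed
  have C1: "C1_grad \<eta> F"
    unfolding C1_grad_def
  proof (intro conjI allI)
    fix x :: "real ^ 'n"
    have "((\<lambda>x. (\<Sum>j\<in>{1..N}. dyadic_cutoff j x) / N) has_derivative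
        (\<lambda>h. (\<Sum>j\<in>{1..N}. dyadic_grad j x \<bullet> h) / N)) (at x)"
      by (intro bounded_linear.has_derivative[OF bounded_linear_divide] has_derivative_sum dyadic_cutoff_has_derivative)
    then show "(\<eta> has_derivative (\<bullet>) (F x)) (at x)"
      unfolding \<eta>_def[abs_def] F_def
      by (rule has_derivative_eq_rhs) (simp add: inner_sum_left fun_eq_iff)
    show "continuous_on UNIV F"
      unfolding F_def[abs_def] by (intro continuous_intros dyadic_grad_continuous)
  qed
  have pt: "norm (F x) ^ ?n \<le> (\<Sum>j\<in>{1..N}. (16 / 2 ^ j) ^ ?n / real N ^ ?n * indicat_real (S j) x)" for x
  proof -
    \<comment> \<open>Shell i lies below squared radius 2 * 4^i, and shell j > i begins at 4^j,
      which is at least 4 * 4^i.\<close>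
    have dis: "dyadic_grad i x = 0 \<or> dyadic_grad j x = 0" if "i < j" for i j
    proof (rule ccontr)
      assume "\<not> ?thesis"
      moreover have "x \<in> S k" if "dyadic_grad k x \<noteq> 0" for k
      proof (rule ccontr)
        assume "x \<notin> S k"
        then have "norm (dyadic_grad k x) \<le> 16 / 2 ^ k * 0"
          using dyadic_grad_bound[of k x] unfolding S_def by simp
        then show False using that by simp
      qed
      ultimately have "x \<in> S i" "x \<in> S j" by auto
      then have "(4::real) ^ j < 2 * 4 ^ i" by (auto simp: S_def)
      moreover have "(4::real) ^ Suc i \<le> 4 ^ j" using that by (intro power_increasing) auto
      moreover have "(0::real) < 4 ^ i" by simp
      ultimately show False unfolding power_Suc by linarith
    qed
    have "norm (\<Sum>j\<in>{1..N}. dyadic_grad j x) ^ ?n \<le> (\<Sum>j\<in>{1..N}. norm (dyadic_grad j x) ^ ?n)"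
    proof (rule norm_sum_single_le)
      show "dyadic_grad i x = 0 \<or> dyadic_grad j x = 0" if "i \<noteq> j" for i j
        using dis[of i j] dis[of j i] that by (cases "i < j") auto
    qed (use n in auto)
    also have "\<dots> \<le> (\<Sum>j\<in>{1..N}. (16 / 2 ^ j) ^ ?n * indicat_real (S j) x)"
    proof (rule sum_mono)
      fix j
      have "norm (dyadic_grad j x) ^ ?n \<le> (16 / 2 ^ j * indicat_real (S j) x) ^ ?n"
        using dyadic_grad_bound[of j x] by (intro power_mono) (auto simp: S_def)
      also have "\<dots> = (16 / 2 ^ j) ^ ?n * indicat_real (S j) x"
        using n by (simp add: power_mult_distrib indicator_def)
      finally show "norm (dyadic_grad j x) ^ ?n \<le> \<dots>" .
    qed
    finally have "norm (\<Sum>j\<in>{1..N}. dyadic_grad j x) ^ ?n / real N ^ ?n \<le>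
        (\<Sum>j\<in>{1..N}. (16 / 2 ^ j) ^ ?n * indicat_real (S j) x) / real N ^ ?n"
      by (intro divide_right_mono) auto
    then show ?thesis
      by (simp add: F_def power_divide sum_divide_distrib)
  qed
  have gi: "integrable lborel (\<lambda>x. \<Sum>j\<in>{1..N}. (16 / 2 ^ j) ^ ?n / real N ^ ?n * indicat_real (S j) x)"
    by (intro Bochner_Integration.integrable_sum integrable_mult_right S_meas)
  have [measurable]: "F \<in> borel_measurable borel"
    using C1 borel_measurable_continuous_onI unfolding C1_grad_def by blast
  have "(LINT x|lborel. norm (F x) ^ ?n) \<le> (LINT x|lborel. (\<Sum>j\<in>{1..N}. (16 / 2 ^ j) ^ ?n / real N ^ ?n * indicat_real (S j) x))"
  proof (rule integral_mono[OF _ gi pt])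
    show "integrable lborel (\<lambda>x. norm (F x) ^ ?n)"
      by (rule Bochner_Integration.integrable_bound[OF gi])
        (use pt in \<open>auto intro!: AE_I2 order_trans[OF pt] abs_ge_self\<close>)
  qed
  also have "\<dots> = (\<Sum>j\<in>{1..N}. (16 / 2 ^ j) ^ ?n / real N ^ ?n * measure lborel (S j))"
    using S_meas(1) by (subst Bochner_Integration.integral_sum) auto
  also have "\<dots> \<le> (\<Sum>j\<in>{1..N}. A / real N ^ ?n)"
  proof (rule sum_mono)
    fix j
    have "(16 / 2 ^ j) ^ ?n / real N ^ ?n * measure lborel (S j) \<le>
       (16 / 2 ^ j) ^ ?n / real N ^ ?n * (unit_ball_vol (real ?n) * (2 * 2 ^ j) ^ ?n)"
      by (intro mult_left_mono S_meas) auto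
    also have "\<dots> = ((16 / 2 ^ j) * (2 * 2 ^ j)) ^ ?n * unit_ball_vol (real ?n) / real N ^ ?n"
      unfolding power_mult_distrib by simp
    also have "(16 / 2 ^ j) * (2 * 2 ^ j) = (32::real)" by simp
    finally show "(16 / 2 ^ j) ^ ?n / real N ^ ?n * measure lborel (S j) \<le> A / real N ^ ?n"
      by (simp add: A_def)
  qed
  \<comment> \<open>There are N shells, each contributing A / N^n. Since n \<ge> 2, the exponent n -
    1 is positive and the total is at most A / N.\<close>
  also have "\<dots> = A / real N ^ (?n - 1)"
    using N(1) n by (simp add: power_eq_if[of _ ?n])
  also have "\<dots> \<le> A / real N"
  proof (intro divide_left_mono)
    show "real N \<le> real N ^ (?n - 1)" using N(1) n by (intro self_le_power) auto
  qed (use N \<open>A \<ge> 0\<close> in auto)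
  also have "\<dots> \<le> e" using N e by (simp add: field_simps)
  finally have int: "(LINT x|lborel. norm (F x) ^ ?n) \<le> e" .
  have far: "4 ^ j * 2 \<le> x \<bullet> x" if "norm x > 2 * 2 ^ N" "j \<in> {1..N}" for x :: "real ^ 'n" and j
  proof -
    have "(2 * 2 ^ N)\<^sup>2 \<le> (norm x)\<^sup>2" using that by (intro power_mono) auto
    moreover have "(4::real) ^ j \<le> 4 ^ N" using that by (intro power_increasing) auto
    moreover have "((2::real) * 2 ^ N)\<^sup>2 = 4 * 4 ^ N"
      by (simp add: power_mult_distrib two_power_squared)
    moreover have "(0::real) \<le> 4 ^ j" by simp
    ultimately show ?thesis unfolding power2_norm_eq_inner by linarith
  qed
  show ?thesis
  proof (rule that[OF C1])
    show "0 \<le> \<eta> x" "\<eta> x \<le> 1" for x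
    proof -
      show "0 \<le> \<eta> x" unfolding \<eta>_def dyadic_cutoff_def by (intro divide_nonneg_nonneg sum_nonneg plateau_bounds) auto
      have "(\<Sum>j\<in>{1..N}. dyadic_cutoff j x) \<le> (\<Sum>j\<in>{1..N}. 1)"
        unfolding dyadic_cutoff_def by (intro sum_mono plateau_bounds)
      then show "\<eta> x \<le> 1" using N(1) by (simp add: \<eta>_def)
    qed
    show "\<eta> x = 1" if "norm x \<le> 1" for x
    proof -
      have "(norm x)\<^sup>2 \<le> 1" using that by (simp add: power_le_one)
      moreover have "(1::real) \<le> 4 ^ j" for j :: nat by simp
      ultimately have "x \<bullet> x \<le> 4 ^ j" for j :: nat
        unfolding power2_norm_eq_inner using order_trans by blast
      then have "dyadic_cutoff j x = 1" for j
        unfolding dyadic_cutoff_def by (intro plateau_bounds) simp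
      then show ?thesis using N(1) by (simp add: \<eta>_def)
    qed
    show "\<forall>x. norm x > 2 * 2 ^ N \<longrightarrow> \<eta> x = 0"
    proof (intro allI impI)
      fix x :: "real ^ 'n" assume x: "norm x > 2 * 2 ^ N"
      have "dyadic_cutoff j x = 0" if "j \<in> {1..N}" for j
        unfolding dyadic_cutoff_def using far[OF x that] by (intro plateau_bounds) (simp add: field_simps)
      then show "\<eta> x = 0" by (simp add: \<eta>_def)
    qed
    show "\<forall>x. norm x > 2 * 2 ^ N \<longrightarrow> F x = 0"
    proof (intro allI impI)
      fix x :: "real ^ 'n" assume x: "norm x > 2 * 2 ^ N"
      have "dyadic_grad j x = 0" if "j \<in> {1..N}" for j
        unfolding dyadic_grad_def using far[OF x that]
        by (subst plateau_deriv_bounds(2)) (auto simp add: field_simps)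
      then show "F x = 0" by (simp add: F_def)
    qed
    show "(LINT x|lborel. norm (F x) ^ ?n) \<le> e" by (rule int)
  qed
qed

section \<open>Continuously differentiable test functions\<close>

lemma test_function_continuous:
  assumes "test_function \<phi>"
  shows "continuous_on UNIV \<phi>" "continuous_on UNIV (grad \<phi>)"
  using assms Ck_on_UNIV_continuous[of 0 \<phi>] Ck_on_UNIV_grad_continuous[of 0 \<phi>]
  unfolding test_function_def by blast+

section \<open>A Borel representative of the weak gradient\<close>

lemma indicator_cball_measurable:
  fixes F :: "'a::euclidean_space \<Rightarrow> 'b::euclidean_space"
  shows "F \<in> borel_measurable borel \<Longrightarrow> (\<lambda>x. indicator (cball 0 R) x *\<^sub>R F x) \<in> borel_measurable lborel"
  by (intro borel_measurable_scaleR borel_measurable_indicator) auto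

lemma Lp_loc_cball_integrable:
  assumes "Lp_loc q F0" and [measurable]: "F \<in> borel_measurable borel" and ae: "AE x in lborel. F0 x = F x"
  shows "set_integrable lborel (cball 0 R) (\<lambda>x. norm (F x) powr q)"
proof -
  have [measurable]: "F0 \<in> borel_measurable lebesgue"
    and i: "set_integrable lebesgue (cball 0 R) (\<lambda>x. norm (F0 x) powr q)"
    using assms(1) compact_cball unfolding Lp_loc_def by blast+
  have "integrable lebesgue (\<lambda>x. indicator (cball 0 R) x *\<^sub>R norm (F x) powr q)"
  proof (rule integrable_cong_AE_imp[OF i[unfolded set_integrable_def]])
    show "(\<lambda>x. indicator (cball 0 R) x *\<^sub>R norm (F x) powr q) \<in> borel_measurable lebesgue"
      by (rule measurable_completion[OF indicator_cball_measurable]) measurable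
    show "AE x in lebesgue. indicator (cball 0 R) x *\<^sub>R norm (F0 x) powr q = indicator (cball 0 R) x *\<^sub>R norm (F x) powr q"
      using AE_completion[OF ae] by eventually_elim simp
  qed
  moreover have "(\<lambda>x. indicator (cball 0 R) x *\<^sub>R norm (F x) powr q) \<in> borel_measurable lborel"
    by (rule indicator_cball_measurable) measurable
  ultimately show ?thesis
    unfolding set_integrable_def by (simp only: integrable_completion)
qed

lemma loc_int_of_norm:
  assumes [measurable]: "F \<in> borel_measurable borel" and "\<And>R. set_integrable lborel (cball 0 R) (\<lambda>x. norm (F x))"
  shows "loc_int F"
  unfolding loc_int_def
proof (intro conjI allI)
  fix R
  have "integrable lborel (\<lambda>x. indicator (cball 0 R) x *\<^sub>R norm (F x))"
    using assms(2) unfolding set_integrable_def .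
  then show "set_integrable lborel (cball 0 R) F"
    unfolding set_integrable_def
    by (rule Bochner_Integration.integrable_bound) (use indicator_cball_measurable[OF assms(1), of R] in simp_all)
qed fact

text \<open>Convolution and Tonelli's theorem are carried out over \<open>lborel\<close>, while the
  notion of supersolution refers to \<open>lebesgue\<close>. Changing the gradient on a null set
  makes it Borel without affecting any of the integrals; the other functions involved are
  continuous.\<close>

lemma supersolution_borel_gradient:
  fixes H :: "real ^ 'n \<Rightarrow> real"
  assumes H: "anisotropy H" and p: "1 < p" and fc: "continuous_on {0<..} f"
    and u: "supersolution H p f u" "\<forall>x. u x > 0"
  obtains G where "loc_int G" "loc_int (\<lambda>x. norm (G x) powr p)"
    "\<And>\<phi> i. test_function \<phi> \<Longrightarrow> (LINT x|lborel. u x * grad \<phi> x $ i) = - (LINT x|lborel. G x $ i * \<phi> x)"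
    "\<And>\<phi>. test_function \<phi> \<Longrightarrow> (\<forall>x. \<phi> x \<ge> 0) \<Longrightarrow>
       (LINT x|lborel. f (u x) * \<phi> x) \<le> (LINT x|lborel. flux H p (G x) \<bullet> grad \<phi> x)"
proof -
  have uc: "continuous_on UNIV u" using u(1) by (simp add: supersolution_def)
  have fuc: "continuous_on UNIV (\<lambda>x. f (u x))"
    by (rule continuous_on_compose2[OF fc uc]) (use u(2) in auto)
  obtain G0 where G0: "W1p_loc p u G0"
    "\<And>\<phi>. test_function \<phi> \<Longrightarrow> (\<forall>x. \<phi> x \<ge> 0) \<Longrightarrow>
       (LINT x|lebesgue. flux H p (G0 x) \<bullet> grad \<phi> x) \<ge> (LINT x|lebesgue. f (u x) * \<phi> x)"
    using u(1) unfolding supersolution_def by blast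
  then have Lp: "Lp_loc p G0" "Lp_loc 1 G0" and wg: "weak_gradient u G0"
    by (auto simp: W1p_loc_def weak_gradient_def)
  have G0m[measurable]: "G0 \<in> borel_measurable lebesgue" using Lp by (simp add: Lp_loc_def)
  \<comment> \<open>The Borel version is found for each component separately; finitely many null
    sets then combine into one.\<close>
  have "\<exists>g\<in>borel_measurable lborel. AE x in lborel. G0 x $ i = g x" for i
  proof (rule completion_ex_borel_measurable_real)
    have "(\<lambda>v :: real ^ 'n. v $ i) \<in> borel_measurable borel"
      by (intro borel_measurable_continuous_onI continuous_intros)
    then show "(\<lambda>x. G0 x $ i) \<in> borel_measurable lebesgue"
      using G0m by (rule measurable_compose[rotated])
  qed
  then obtain g where g: "\<And>i. g i \<in> borel_measurable lborel" "\<And>i. AE x in lborel. G0 x $ i = g i x"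
    by metis
  define G where "G x = (\<chi> i. g i x)" for x
  have Gm[measurable]: "G \<in> borel_measurable borel"
  proof (rule borel_measurable_euclidean_space[THEN iffD2], intro ballI)
    fix b :: "real ^ 'n" assume "b \<in> Basis"
    then obtain i where "b = axis i 1" by (auto simp: Basis_vec_def)
    then show "(\<lambda>x. G x \<bullet> b) \<in> borel_measurable borel"
      using g(1)[of i] by (simp add: G_def inner_axis)
  qed
  have "AE x in lborel. \<forall>i\<in>UNIV. G0 x $ i = g i x"
    using g(2) by (intro AE_finite_allI) auto
  then have ae: "AE x in lborel. G0 x = G x"
    by eventually_elim (simp add: G_def vec_eq_iff)
  note aeL = AE_completion[OF ae]
  note [measurable] = flux_measurable[OF H p]
  show ?thesis
  proof
    have "set_integrable lborel (cball 0 R) (\<lambda>x. norm (G x))" for R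
      using Lp_loc_cball_integrable[OF Lp(2) Gm ae, of R] by simp
    then show "loc_int G" by (rule loc_int_of_norm[OF Gm])
    have "set_integrable lborel (cball 0 R) (\<lambda>x. norm (norm (G x) powr p))" for R
      using Lp_loc_cball_integrable[OF Lp(1) Gm ae, of R] by simp
    then show "loc_int (\<lambda>x. norm (G x) powr p)" by (intro loc_int_of_norm) measurable
  next
    fix \<phi> :: "real ^ 'n \<Rightarrow> real" and i
    assume \<phi>: "test_function \<phi>"
    have [measurable]: "\<phi> \<in> borel_measurable borel"
      using test_function_continuous(1)[OF \<phi>] by (rule borel_measurable_continuous_onI)
    have Gi: "(\<lambda>x. G x $ i) \<in> borel_measurable borel"
      using g(1) by (simp add: G_def)
    have "(LINT x|lborel. u x * grad \<phi> x $ i) = (LINT x|lebesgue. u x * grad \<phi> x $ i)"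
    proof (rule integral_completion[symmetric])
      have "continuous_on UNIV (\<lambda>x. u x * grad \<phi> x $ i)"
        using uc test_function_continuous(2)[OF \<phi>] by (intro continuous_intros)
      then show "(\<lambda>x. u x * grad \<phi> x $ i) \<in> borel_measurable lborel"
        using borel_measurable_continuous_onI by auto
    qed
    also have "\<dots> = - (LINT x|lebesgue. G0 x $ i * \<phi> x)"
      using wg \<phi> by (simp add: weak_gradient_def)
    also have "(LINT x|lebesgue. G0 x $ i * \<phi> x) = (LINT x|lebesgue. G x $ i * \<phi> x)"
    proof (rule integral_cong_AE)
      have "(\<lambda>v :: real ^ 'n. v $ i) \<in> borel_measurable borel"
        by (intro borel_measurable_continuous_onI continuous_intros)
      then have [measurable]: "(\<lambda>x. G0 x $ i) \<in> borel_measurable lebesgue"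
        using G0m by (rule measurable_compose[rotated])
      have [measurable]: "\<phi> \<in> borel_measurable lebesgue" by (rule measurable_completion) simp
      show "(\<lambda>x. G0 x $ i * \<phi> x) \<in> borel_measurable lebesgue" by measurable
      show "(\<lambda>x. G x $ i * \<phi> x) \<in> borel_measurable lebesgue"
        using Gi by (intro measurable_completion) simp
      show "AE x in lebesgue. G0 x $ i * \<phi> x = G x $ i * \<phi> x"
        using aeL by eventually_elim simp
    qed
    also have "\<dots> = (LINT x|lborel. G x $ i * \<phi> x)"
      using Gi by (intro integral_completion) simp
    finally show "(LINT x|lborel. u x * grad \<phi> x $ i) = - (LINT x|lborel. G x $ i * \<phi> x)" .
  next
    fix \<phi> :: "real ^ 'n \<Rightarrow> real"
    assume \<phi>: "test_function \<phi>" "\<forall>x. \<phi> x \<ge> 0"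
    have gm[measurable]: "grad \<phi> \<in> borel_measurable borel"
      using test_function_continuous(2)[OF \<phi>(1)] by (rule borel_measurable_continuous_onI)
    have "(LINT x|lborel. f (u x) * \<phi> x) = (LINT x|lebesgue. f (u x) * \<phi> x)"
    proof (rule integral_completion[symmetric])
      have "continuous_on UNIV (\<lambda>x. f (u x) * \<phi> x)"
        using fuc test_function_continuous(1)[OF \<phi>(1)] by (intro continuous_intros)
      then show "(\<lambda>x. f (u x) * \<phi> x) \<in> borel_measurable lborel"
        using borel_measurable_continuous_onI by auto
    qed
    also have "\<dots> \<le> (LINT x|lebesgue. flux H p (G0 x) \<bullet> grad \<phi> x)"
      by (rule G0(2)[OF \<phi>])
    also have "\<dots> = (LINT x|lebesgue. flux H p (G x) \<bullet> grad \<phi> x)"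
    proof (rule integral_cong_AE)
      have [measurable]: "grad \<phi> \<in> borel_measurable lebesgue"
        by (rule measurable_completion) (use gm in simp)
      show "(\<lambda>x. flux H p (G0 x) \<bullet> grad \<phi> x) \<in> borel_measurable lebesgue" by measurable
      show "(\<lambda>x. flux H p (G x) \<bullet> grad \<phi> x) \<in> borel_measurable lebesgue"
        by (rule measurable_completion) measurable
      show "AE x in lebesgue. flux H p (G0 x) \<bullet> grad \<phi> x = flux H p (G x) \<bullet> grad \<phi> x"
        using aeL by eventually_elim simp
    qed
    also have "\<dots> = (LINT x|lborel. flux H p (G x) \<bullet> grad \<phi> x)"
      by (rule integral_completion) measurable
    finally show "(LINT x|lborel. f (u x) * \<phi> x) \<le> (LINT x|lborel. flux H p (G x) \<bullet> grad \<phi> x)" .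
  qed
qed

text \<open>The reference value \<open>c\<close> is arbitrary: c = F(x) gives uniform convergence,
  and the midpoint of an interval gives preservation of two-sided bounds.\<close>

lemma mollify_uniform:
  fixes F :: "real ^ 'n \<Rightarrow> 'b::euclidean_space"
  assumes \<rho>: "mollifier d \<rho>" and F: "loc_int F" and e: "\<And>y. norm (x - y) \<le> d \<Longrightarrow> norm (F y - c) \<le> e"
  shows "norm (mollify \<rho> F x - c) \<le> e"
proof -
  have i1: "integrable lborel (\<lambda>y. \<rho> (x - y))"
    by (rule mollifier_reflect_integrable[OF \<rho>])
  have iF: "integrable lborel (\<lambda>y. \<rho> (x - y) *\<^sub>R (F y - c))"
    using mollify_integrable[OF \<rho> F, of x] i1 by (simp add: scaleR_diff_right)
  have "mollify \<rho> F x - c = (LINT y|lborel. \<rho> (x - y) *\<^sub>R F y) - (LINT y|lborel. \<rho> (x - y)) *\<^sub>R c"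
    using mollifier_reflect_integral[OF \<rho>] by (simp add: mollify_def)
  also have "\<dots> = (LINT y|lborel. \<rho> (x - y) *\<^sub>R (F y - c))"
    using mollify_integrable[OF \<rho> F, of x] i1 by (simp add: scaleR_diff_right)
  also have "norm \<dots> \<le> (LINT y|lborel. e * \<rho> (x - y))"
  proof (rule Bochner_Integration.integral_norm_bound_integral[OF iF])
    show "norm (\<rho> (x - y) *\<^sub>R (F y - c)) \<le> e * \<rho> (x - y)" for y
      using e[of y] mollifierD(2)[OF \<rho>, of "x - y"] mollifierD(3)[OF \<rho>, of "x - y"]
      by (cases "norm (x - y) > d") (auto intro: mult_left_mono simp: mult.commute[of e])
  qed (use i1 in simp)
  also have "\<dots> = e" using mollifier_reflect_integral[OF \<rho>] by simp
  finally show ?thesis .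
qed

section \<open>Extension of the weak inequality to C^1 test functions\<close>

lemma loc_int_inner_integrable:
  assumes V: "loc_int V" and F: "continuous_on UNIV F" "\<forall>x. norm x > R \<longrightarrow> F x = 0"
  shows "integrable lborel (\<lambda>x. V x \<bullet> F x)"
proof -
  obtain B where B: "B > 0" "\<And>x. norm (F x) \<le> B"
    using compact_support_bounded[OF F] by blast
  have [measurable]: "F \<in> borel_measurable borel" "V \<in> borel_measurable borel"
    using F(1) borel_measurable_continuous_onI loc_int_borel[OF V] by blast+
  show ?thesis
  proof (rule loc_int_dominated[OF V])
    show "norm (V x \<bullet> F x) \<le> B * norm (V x)" for x
      using Cauchy_Schwarz_ineq2[of "V x" "F x"] mult_left_mono[OF B(2)[of x] norm_ge_zero[of "V x"]]
      by (simp add: mult.commute)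
    show "V x \<bullet> F x = 0" if "norm x > R" for x using F(2) that by simp
  qed measurable
qed

lemma integral_inner_perturbation:
  fixes V F F' :: "real ^ 'n \<Rightarrow> 'b::euclidean_space"
  assumes V: "loc_int V" and F: "continuous_on UNIV F" "\<forall>x. norm x > R \<longrightarrow> F x = 0"
    and F': "continuous_on UNIV F'" "\<forall>x. norm x > R \<longrightarrow> F' x = 0"
    and e: "\<And>x. norm (F' x - F x) \<le> e"
  shows "\<bar>(LINT x|lborel. V x \<bullet> F' x) - (LINT x|lborel. V x \<bullet> F x)\<bar> \<le> e * (LINT x:cball 0 R|lborel. norm (V x))"
proof -
  have "(LINT x|lborel. V x \<bullet> F' x) - (LINT x|lborel. V x \<bullet> F x) = (LINT x|lborel. V x \<bullet> (F' x - F x))"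
    using loc_int_inner_integrable[OF V F] loc_int_inner_integrable[OF V F'] by (simp add: inner_diff_right)
  also have "norm \<dots> \<le> (LINT x|lborel. e * (indicator (cball 0 R) x * norm (V x)))"
  proof (rule Bochner_Integration.integral_norm_bound_integral)
    show "integrable lborel (\<lambda>x. V x \<bullet> (F' x - F x))"
      using loc_int_inner_integrable[OF V F] loc_int_inner_integrable[OF V F'] by (simp add: inner_diff_right)
    have "integrable lborel (\<lambda>x. indicator (cball 0 R) x *\<^sub>R V x)"
      using V by (simp add: loc_int_def set_integrable_def)
    from integrable_norm[OF this] show "integrable lborel (\<lambda>x. e * (indicator (cball 0 R) x * norm (V x)))"
      by simp
    show "norm (V x \<bullet> (F' x - F x)) \<le> e * (indicator (cball 0 R) x * norm (V x))" for x
      using Cauchy_Schwarz_ineq2[of "V x" "F' x - F x"] mult_left_mono[OF e[of x] norm_ge_zero[of "V x"]]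
        F(2) F'(2)
      by (cases "norm x > R") (auto simp: mult.commute)
  qed
  finally show ?thesis by (simp add: set_lebesgue_integral_def)
qed

text \<open>Mollifying \<phi> gives a smooth nonnegative function of compact support that is
  uniformly close to \<phi> together with its gradient. Uniform closeness on a fixed ball is enough,
  since \<open>V\<close> and \<open>w\<close> are integrable there; one kernel of sufficiently small
  radius serves each e.\<close>

lemma test_inequality_C1:
  fixes V :: "real ^ 'n \<Rightarrow> real ^ 'n" and w :: "real ^ 'n \<Rightarrow> real"
  assumes V: "loc_int V" and w: "loc_int w"
    and ineq: "\<And>\<phi>. test_function \<phi> \<Longrightarrow> (\<forall>x. \<phi> x \<ge> 0) \<Longrightarrow>
       (LINT x|lborel. w x * \<phi> x) \<le> (LINT x|lborel. V x \<bullet> grad \<phi> x)"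
    and \<phi>: "C1_grad \<phi> F" "\<And>x. \<phi> x \<ge> 0" "\<forall>x. norm x > R \<longrightarrow> \<phi> x = 0" "\<forall>x. norm x > R \<longrightarrow> F x = 0"
  shows "(LINT x|lborel. w x * \<phi> x) \<le> (LINT x|lborel. V x \<bullet> F x)"
proof (rule field_le_epsilon)
  fix e :: real assume "e > 0"
  define A where "A = (LINT x:cball 0 (R + 1)|lborel. norm (V x)) + (LINT x:cball 0 (R + 1)|lborel. norm (w x))"
  have "A \<ge> 0"
    unfolding A_def set_lebesgue_integral_def
    by (intro add_nonneg_nonneg Bochner_Integration.integral_nonneg) auto
  define e' where "e' = e / (A + 1)"
  have e': "e' > 0" "e' * A \<le> e"
    using \<open>A \<ge> 0\<close> \<open>e > 0\<close> by (auto simp: e'_def field_simps)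
  have \<phi>c: "continuous_on UNIV \<phi>"
    using \<phi>(1) unfolding C1_grad_def by (meson continuous_at_imp_continuous_on has_derivative_continuous)
  have Fc: "continuous_on UNIV F" using \<phi>(1) by (simp add: C1_grad_def)
  obtain d1 where d1: "d1 > 0" "d1 \<le> 1" "\<And>x y. norm (x - y) < d1 \<Longrightarrow> norm (\<phi> x - \<phi> y) < e'"
    using compact_support_uniformly_continuous[OF \<phi>c \<phi>(3) e'(1)] by blast
  obtain d2 where d2: "d2 > 0" "d2 \<le> 1" "\<And>x y. norm (x - y) < d2 \<Longrightarrow> norm (F x - F y) < e'"
    using compact_support_uniformly_continuous[OF Fc \<phi>(4) e'(1)] by blast
  define d where "d = min d1 d2 / 2"
  have d: "d > 0" "d < d1" "d < d2" "d \<le> 1" using d1 d2 by (auto simp: d_def min_def)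
  obtain \<rho> :: "real ^ 'n \<Rightarrow> real" where \<rho>: "mollifier d \<rho>" using ex_mollifier[OF d(1)] by blast
  have l\<phi>: "loc_int \<phi>" and lF: "loc_int F" and l\<rho>: "loc_int \<rho>"
    using \<phi>c Fc mollifierD(5)[OF \<rho>] by (auto intro: loc_int_continuous)
  have far: "mollify \<rho> h x = 0" if "norm x > R + 1" "\<forall>x. norm x > R \<longrightarrow> h x = 0" for x and h :: "real ^ 'n \<Rightarrow> 'c::euclidean_space"
  proof -
    have 0: "\<rho> (x - y) *\<^sub>R h y = 0" for y
    proof (cases "norm y > R")
      case False
      then have "norm (x - y) > d"
        using that(1) d(4) norm_triangle_ineq2[of x y] by simp
      then show ?thesis using mollifierD(3)[OF \<rho>] by simp
    qed (use that(2) in simp)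
    show ?thesis unfolding mollify_def 0 by simp
  qed
  have [measurable]: "\<rho> \<in> borel_measurable borel" by (rule mollifierD(6)[OF \<rho>])
  have [measurable]: "\<phi> \<in> borel_measurable borel" "F \<in> borel_measurable borel"
    using l\<phi> lF loc_int_borel by blast+
  have Ck: "Ck_on k UNIV (mollify \<rho> \<phi>)" for k
    using convolution_Ck[OF l\<phi> mollifierD(1,8)[OF \<rho>], of k]
    by (simp add: mollify_def[abs_def] mult.commute)
  have test: "test_function (mollify \<rho> \<phi>)"
    by (rule test_functionI[OF Ck, of "R + 1"]) (use far \<phi>(3) in blast)
  \<comment> \<open>Here \<phi> takes the role of the kernel, so the derivative falls on \<phi> and
    the gradient is the mollification of \<open>F\<close>. Smoothness was obtained the other way
    round, by differentiating \<rho>.\<close>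
  have gr: "grad (mollify \<rho> \<phi>) x = mollify \<rho> F x" for x
  proof (rule grad_eqI)
    have "((\<lambda>x. LINT y|lborel. \<rho> y * \<phi> (x - y)) has_derivative
         (\<lambda>h. (LINT y|lborel. \<rho> y *\<^sub>R F (x - y)) \<bullet> h)) (at x)"
      by (rule convolution_has_derivative[OF l\<rho> _ \<phi>(3) Fc \<phi>(4)]) (use \<phi>(1) in \<open>simp add: C1_grad_def\<close>)
    moreover have "(LINT y|lborel. \<rho> y * \<phi> (x - y)) = mollify \<rho> \<phi> x" for x
      using lborel_integral_reflect[of "\<lambda>y. \<rho> y * \<phi> (x - y)" x] by (simp add: mollify_def)
    moreover have "(LINT y|lborel. \<rho> y *\<^sub>R F (x - y)) = mollify \<rho> F x" for x
      using lborel_integral_reflect[of "\<lambda>y. \<rho> y *\<^sub>R F (x - y)" x] by (simp add: mollify_def)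
    ultimately show "(mollify \<rho> \<phi> has_derivative (\<bullet>) (mollify \<rho> F x)) (at x)"
      by simp
  qed
  have "mollify \<rho> \<phi> x \<ge> 0" for x
    unfolding mollify_def using mollifierD(2)[OF \<rho>] \<phi>(2) by (intro Bochner_Integration.integral_nonneg) simp
  then have main: "(LINT x|lborel. w x * mollify \<rho> \<phi> x) \<le> (LINT x|lborel. V x \<bullet> mollify \<rho> F x)"
    using ineq[OF test] by (simp add: gr)
  have "grad (mollify \<rho> \<phi>) = mollify \<rho> F" using gr by auto
  then have mFc: "continuous_on UNIV (mollify \<rho> F)"
    using test_function_continuous(2)[OF test] by simp
  have "\<bar>(LINT x|lborel. V x \<bullet> mollify \<rho> F x) - (LINT x|lborel. V x \<bullet> F x)\<bar> \<le> e' * (LINT x:cball 0 (R + 1)|lborel. norm (V x))"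
  proof (rule integral_inner_perturbation[OF V Fc _ mFc])
    show "norm (mollify \<rho> F x - F x) \<le> e'" for x
    proof (rule mollify_uniform[OF \<rho> lF])
      show "norm (F y - F x) \<le> e'" if "norm (x - y) \<le> d" for y
        using d2(3)[of y x] that d(3) by (simp add: norm_minus_commute)
    qed
  qed (use far \<phi>(4) in auto)
  moreover have "\<bar>(LINT x|lborel. w x \<bullet> mollify \<rho> \<phi> x) - (LINT x|lborel. w x \<bullet> \<phi> x)\<bar> \<le> e' * (LINT x:cball 0 (R + 1)|lborel. norm (w x))"
  proof (rule integral_inner_perturbation[OF w \<phi>c _ test_function_continuous(1)[OF test]])
    show "norm (mollify \<rho> \<phi> x - \<phi> x) \<le> e'" for x
    proof (rule mollify_uniform[OF \<rho> l\<phi>])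
      show "norm (\<phi> y - \<phi> x) \<le> e'" if "norm (x - y) \<le> d" for y
        using d1(3)[of y x] that d(2) by (simp add: norm_minus_commute)
    qed
  qed (use far \<phi>(3) in auto)
  ultimately have "(LINT x|lborel. w x * \<phi> x) \<le> (LINT x|lborel. V x \<bullet> F x) + e' * A"
    using main unfolding A_def distrib_left inner_real_def by linarith
  then show "(LINT x|lborel. w x * \<phi> x) \<le> (LINT x|lborel. V x \<bullet> F x) + e"
    using e'(2) by linarith
qed

section \<open>Nonlinear test functions\<close>

text \<open>For fixed x, the function y \<mapsto> \<rho>(x - y) is an admissible test function whose
  gradient is minus the gradient of \<rho> at x - y. This sign cancels the one in the definition of
  the weak gradient and turns the convolution with the gradient of \<rho> into a mollification of
  \<open>G\<close>.\<close>

lemma mollify_weak_gradient: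
  fixes u :: "real ^ 'n \<Rightarrow> real"
  assumes uc: "continuous_on UNIV u" and G: "loc_int G"
    and weak: "\<And>\<phi> i. test_function \<phi> \<Longrightarrow> (LINT x|lborel. u x * grad \<phi> x $ i) = - (LINT x|lborel. G x $ i * \<phi> x)"
    and \<rho>: "mollifier d \<rho>"
  shows "C1_grad (mollify \<rho> u) (mollify \<rho> G)"
proof -
  have lu: "loc_int u" using uc by (rule loc_int_continuous)
  have gc: "continuous_on UNIV (grad \<rho>)"
    using Ck_on_UNIV_grad_continuous mollifierD(1)[OF \<rho>] by blast
  have g0: "\<forall>x. norm x > d \<longrightarrow> grad \<rho> x = 0"
    using grad_eq_0_outside mollifierD(8)[OF \<rho>] by blast
  have d\<rho>: "(\<rho> has_derivative (\<bullet>) (grad \<rho> x)) (at x)" for x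
    using mollifierD(1)[OF \<rho>, of "Suc 0"] by (intro has_derivative_grad) simp
  have eq: "(LINT y|lborel. u y *\<^sub>R grad \<rho> (x - y)) = mollify \<rho> G x" for x
  proof (rule vec_eq_iff[THEN iffD2], rule allI)
    fix i
    define \<phi> where "\<phi> y = \<rho> (x - y)" for y
    have gr: "grad \<phi> y = - grad \<rho> (x - y)" for y
    proof (rule grad_eqI)
      have "((\<lambda>y. x - y) has_derivative (\<lambda>h. - h)) (at y)"
        by (auto intro!: derivative_eq_intros)
      from has_derivative_compose[OF this d\<rho>]
      have "(\<phi> has_derivative (\<lambda>h. grad \<rho> (x - y) \<bullet> (- h))) (at y)"
        by (simp add: \<phi>_def[abs_def])
      then show "(\<phi> has_derivative (\<bullet>) (- grad \<rho> (x - y))) (at y)"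
        by (rule has_derivative_eq_rhs) (simp add: fun_eq_iff)
    qed
    have "test_function \<phi>"
    proof (rule test_functionI)
      show "Ck_on k UNIV \<phi>" for k
        unfolding \<phi>_def[abs_def] by (rule Ck_on_reflect[OF mollifierD(1)[OF \<rho>]])
      show "\<forall>y. norm y > norm x + d \<longrightarrow> \<phi> y = 0"
      proof (intro allI impI)
        fix y :: "real ^ 'n" assume "norm y > norm x + d"
        then have "norm (x - y) > d" using norm_triangle_ineq2[of y x] by (simp add: norm_minus_commute)
        then show "\<phi> y = 0" unfolding \<phi>_def by (rule mollifierD(3)[OF \<rho>])
      qed
    qed
    then have w: "(LINT y|lborel. u y * grad \<phi> y $ i) = - (LINT y|lborel. G y $ i * \<phi> y)" by (rule weak)
    have "(LINT y|lborel. u y *\<^sub>R grad \<rho> (x - y)) $ i = (LINT y|lborel. u y * grad \<rho> (x - y) $ i)"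
      using integral_inner_right[OF kernel_integrable[OF lu gc g0], of "axis i 1" x]
      by (simp add: inner_axis')
    also have "\<dots> = - (LINT y|lborel. u y * grad \<phi> y $ i)" by (simp add: gr)
    also have "\<dots> = (LINT y|lborel. \<rho> (x - y) * G y $ i)" by (simp add: w \<phi>_def mult.commute)
    also have "\<dots> = mollify \<rho> G x $ i"
      using integral_inner_right[OF mollify_integrable[OF \<rho> G], of "axis i 1" x]
      by (simp add: inner_axis' mollify_def)
    finally show "(LINT y|lborel. u y *\<^sub>R grad \<rho> (x - y)) $ i = mollify \<rho> G x $ i" .
  qed
  have mu: "mollify \<rho> u = (\<lambda>x. LINT y|lborel. u y * \<rho> (x - y))"
    by (simp add: mollify_def[abs_def] mult.commute)
  show ?thesis
    unfolding C1_grad_def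
  proof (intro conjI allI)
    show "(mollify \<rho> u has_derivative (\<bullet>) (mollify \<rho> G x)) (at x)" for x
      using convolution_has_derivative[OF lu d\<rho> mollifierD(8)[OF \<rho>] gc g0, of x]
      unfolding mu eq .
    show "continuous_on UNIV (mollify \<rho> G)"
      using convolution_continuous[OF lu gc g0] unfolding eq .
  qed
qed

lemma mollify_between:
  fixes u :: "real ^ 'n \<Rightarrow> real"
  assumes \<rho>: "mollifier d \<rho>" and u: "loc_int u"
    and ab: "\<And>y. norm (x - y) \<le> d \<Longrightarrow> a \<le> u y \<and> u y \<le> b"
  shows "a \<le> mollify \<rho> u x" "mollify \<rho> u x \<le> b"
proof -
  have "norm (mollify \<rho> u x - (a + b) / 2) \<le> (b - a) / 2"
  proof (rule mollify_uniform[OF \<rho> u])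
    show "norm (u y - (a + b) / 2) \<le> (b - a) / 2" if "norm (x - y) \<le> d" for y
      using ab[OF that] by (auto simp: abs_le_iff field_simps)
  qed
  then have "\<bar>mollify \<rho> u x - (a + b) / 2\<bar> \<le> (b - a) / 2" by simp
  then have "mollify \<rho> u x - (a + b) / 2 \<le> (b - a) / 2" "- ((b - a) / 2) \<le> mollify \<rho> u x - (a + b) / 2"
    by linarith+
  then show "a \<le> mollify \<rho> u x" "mollify \<rho> u x \<le> b" by (simp_all add: field_simps)
qed

lemma continuous_pos_bounds:
  fixes u :: "real ^ 'n \<Rightarrow> real"
  assumes uc: "continuous_on UNIV u" and pos: "\<And>x. u x > 0" and r: "r \<ge> 0"
  obtains a b where "0 < a" "\<forall>y. norm (x - y) \<le> r \<longrightarrow> a \<le> u y \<and> u y \<le> b"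
proof -
  have c: "compact (cball x r)" "cball x r \<noteq> {}" "continuous_on (cball x r) u"
    using r continuous_on_subset[OF uc] by auto
  obtain y0 where "\<forall>y\<in>cball x r. u y0 \<le> u y" using continuous_attains_inf[OF c] by blast
  moreover obtain y1 where "\<forall>y\<in>cball x r. u y \<le> u y1" using continuous_attains_sup[OF c] by blast
  ultimately show ?thesis using that[of "u y0" "u y1"] pos by (simp add: dist_norm)
qed

text \<open>For r \<ge> 0 one has r powr (p - 1) \<le> 1 + r powr p, so on a ball the local p-energy
  of \<open>G\<close> controls the flux.\<close>

lemma flux_loc_int:
  fixes V :: "real ^ 'n \<Rightarrow> real ^ 'n"
  assumes Vm[measurable]: "V \<in> borel_measurable borel" and p: "p > 1"
    and Gp: "loc_int (\<lambda>y. norm (G y) powr p)"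
    and VC: "\<And>x. norm (V x) \<le> C * norm (G x) powr (p - 1)" and C: "C \<ge> 0"
  shows "loc_int V"
proof (rule loc_int_of_norm[OF Vm])
  fix R
  have "integrable lborel (\<lambda>x. indicator (cball 0 R) x *\<^sub>R (norm (G x) powr p))"
    using Gp by (simp add: loc_int_def set_integrable_def)
  moreover have "integrable lborel (\<lambda>x :: real ^ 'n. indicator (cball 0 R) x *\<^sub>R (1::real))"
    by (intro borel_integrable_compact) auto
  ultimately have "integrable lborel (\<lambda>x. C * (indicator (cball 0 R) x *\<^sub>R 1 + indicator (cball 0 R) x *\<^sub>R (norm (G x) powr p)))"
    by (intro integrable_mult_right Bochner_Integration.integrable_add)
  then show "set_integrable lborel (cball 0 R) (\<lambda>x. norm (V x))"
    unfolding set_integrable_def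
  proof (rule Bochner_Integration.integrable_bound)
    show "(\<lambda>x. indicator (cball 0 R) x *\<^sub>R norm (V x)) \<in> borel_measurable lborel"
      by (rule indicator_cball_measurable) measurable
    show "AE x in lborel. norm (indicator (cball 0 R) x *\<^sub>R norm (V x)) \<le>
       norm (C * (indicator (cball 0 R) x *\<^sub>R 1 + indicator (cball 0 R) x *\<^sub>R (norm (G x) powr p)))"
    proof (intro AE_I2)
      fix x
      have "norm (G x) powr (p - 1) \<le> 1 + norm (G x) powr p"
      proof (cases "norm (G x) \<le> 1")
        case True
        then have "norm (G x) powr (p - 1) \<le> 1" using p by (intro powr_le1) auto
        then show ?thesis by (simp add: add_increasing2)
      next
        case False
        then have "norm (G x) powr (p - 1) \<le> norm (G x) powr p" by (intro powr_mono) auto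
        then show ?thesis by simp
      qed
      then have "norm (V x) \<le> C * (1 + norm (G x) powr p)"
        using VC[of x] C by (meson mult_left_mono order_trans)
      then show "norm (indicator (cball 0 R) x *\<^sub>R norm (V x)) \<le>
         norm (C * (indicator (cball 0 R) x *\<^sub>R 1 + indicator (cball 0 R) x *\<^sub>R (norm (G x) powr p)))"
        using C by (cases "x \<in> cball 0 R") (auto simp: abs_mult)
    qed
  qed
qed

lemma flux_energy_integrable:
  fixes V :: "real ^ 'n \<Rightarrow> real ^ 'n"
  assumes [measurable]: "V \<in> borel_measurable borel" "G \<in> borel_measurable borel" "k \<in> borel_measurable borel"
    and p: "p > 1" and Gp: "loc_int (\<lambda>y. norm (G y) powr p)"
    and VC: "\<And>x. norm (V x) \<le> C * norm (G x) powr (p - 1)" and C: "C \<ge> 0"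
    and k: "\<And>x. norm x \<le> R \<Longrightarrow> \<bar>k x\<bar> \<le> B" "\<And>x. norm x > R \<Longrightarrow> k x = 0"
  shows "integrable lborel (\<lambda>x. k x * (V x \<bullet> G x))"
proof (rule loc_int_dominated[OF Gp])
  show "norm (k x * (V x \<bullet> G x)) \<le> (\<bar>B\<bar> * C) * norm (norm (G x) powr p)" for x
  proof -
    have "\<bar>k x\<bar> \<le> \<bar>B\<bar>" using k[of x] by (cases "norm x \<le> R") auto
    moreover have "\<bar>V x \<bullet> G x\<bar> \<le> C * norm (G x) powr (p - 1) * norm (G x)"
      using Cauchy_Schwarz_ineq2[of "V x" "G x"] mult_right_mono[OF VC[of x] norm_ge_zero[of "G x"]] by linarith
    moreover have "norm (G x) powr (p - 1) * norm (G x) = norm (G x) powr p"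
      using p by (cases "norm (G x) = 0") (auto simp: powr_diff)
    ultimately have "\<bar>k x\<bar> * \<bar>V x \<bullet> G x\<bar> \<le> \<bar>B\<bar> * (C * norm (G x) powr p)"
      by (intro mult_mono) (auto simp: mult.assoc)
    then show ?thesis by (simp add: abs_mult mult.assoc)
  qed
  show "k x * (V x \<bullet> G x) = 0" if "norm x > R" for x using k(2)[OF that] by simp
qed measurable

text \<open>With u_m the mollification of u, the function g(u_m) \<eta>^n is C^1 with compact
  support, so \<open>test_inequality_C1\<close> applies to it. In the limit, every factor except the
  gradient of u_m converges pointwise and is bounded; that gradient is split into \<open>G\<close>
  and an error which only enters paired with \<open>V\<close>.\<close>

lemma nonlinear_test:
  fixes V G :: "real ^ 'n \<Rightarrow> real ^ 'n" and u w \<eta> :: "real ^ 'n \<Rightarrow> real" and g g' :: "real \<Rightarrow> real"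
  assumes uc: "continuous_on UNIV u" and upos: "\<And>x. u x > 0" and wc: "continuous_on UNIV w"
    and G: "loc_int G" and p: "p > 1" and Gp: "loc_int (\<lambda>y. norm (G y) powr p)"
    and weak: "\<And>\<phi> i. test_function \<phi> \<Longrightarrow> (LINT x|lborel. u x * grad \<phi> x $ i) = - (LINT x|lborel. G x $ i * \<phi> x)"
    and Vm[measurable]: "V \<in> borel_measurable borel"
    and VC: "\<And>x. norm (V x) \<le> C * norm (G x) powr (p - 1)" and C: "C \<ge> 0"
    and ineq: "\<And>\<phi>. test_function \<phi> \<Longrightarrow> (\<forall>x. \<phi> x \<ge> 0) \<Longrightarrow>
       (LINT x|lborel. w x * \<phi> x) \<le> (LINT x|lborel. V x \<bullet> grad \<phi> x)"
    and g: "\<And>t. t > 0 \<Longrightarrow> (g has_real_derivative g' t) (at t)" "continuous_on {0<..} g'" "\<And>t. t > 0 \<Longrightarrow> g t \<ge> 0"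
    and \<eta>: "C1_grad \<eta> F" "\<And>x. 0 \<le> \<eta> x" "\<And>x. \<eta> x \<le> 1" "\<forall>x. norm x > R \<longrightarrow> \<eta> x = 0" "\<forall>x. norm x > R \<longrightarrow> F x = 0"
    and R: "R \<ge> 0" and n: "n > 0"
  shows "(LINT x|lborel. w x * (g (u x) * \<eta> x ^ n)) \<le>
    (LINT x|lborel. (g' (u x) * \<eta> x ^ n) * (V x \<bullet> G x)) + (LINT x|lborel. (g (u x) * (n * \<eta> x ^ (n - 1))) * (V x \<bullet> F x))"
proof -
  have lu: "loc_int u" using uc by (rule loc_int_continuous)
  have lV: "loc_int V" by (rule flux_loc_int[OF Vm p Gp VC C])
  have lw: "loc_int w" using wc by (rule loc_int_continuous)
  have \<eta>c: "continuous_on UNIV \<eta>"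
    using \<eta>(1) unfolding C1_grad_def by (meson continuous_at_imp_continuous_on has_derivative_continuous)
  have Fc: "continuous_on UNIV F" using \<eta>(1) by (simp add: C1_grad_def)
  have gc: "continuous_on {0<..} g"
    by (intro continuous_at_imp_continuous_on ballI DERIV_isCont[OF g(1)]) simp
  have "\<exists>\<rho> :: real ^ 'n \<Rightarrow> real. mollifier (1 / Suc m) \<rho>" for m
    by (rule ex_mollifier[of "1 / Suc m"]) (simp, blast)
  then obtain \<rho> :: "nat \<Rightarrow> real ^ 'n \<Rightarrow> real" where \<rho>: "\<And>m. mollifier (1 / Suc m) (\<rho> m)"
    by metis
  define um where "um m = mollify (\<rho> m) u" for m
  define Gm where "Gm m = mollify (\<rho> m) G" for m
  have C1: "C1_grad (um m) (Gm m)" for m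
    unfolding um_def Gm_def by (rule mollify_weak_gradient[OF uc G _ \<rho>]) (rule weak)
  have umc: "continuous_on UNIV (um m)" for m
    using C1[of m] unfolding C1_grad_def by (meson continuous_at_imp_continuous_on has_derivative_continuous)
  have Gmc: "continuous_on UNIV (Gm m)" for m using C1[of m] by (simp add: C1_grad_def)
  have umpos: "um m x > 0" for m x
  proof -
    have "0 \<le> 1 / real (Suc m)" by simp
    then obtain a b where ab: "0 < a" "\<forall>y. norm (x - y) \<le> 1 / Suc m \<longrightarrow> a \<le> u y \<and> u y \<le> b"
      by (rule continuous_pos_bounds[OF uc upos, of _ x])
    have "a \<le> um m x"
      unfolding um_def by (rule mollify_between(1)[OF \<rho> lu]) (use ab(2) in blast)
    then show ?thesis using ab(1) by linarith
  qed
  \<comment> \<open>All kernels have radius at most 1, so on the ball of radius R every u_m takes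
    values in the range [a, b] of bounds for u on the ball of radius R + 1. As a > 0,
    \<open>g\<close> and \<open>g'\<close> are bounded there uniformly in m.\<close>
  have "R + 1 \<ge> 0" using R by simp
  then obtain a b where ab: "0 < a" "\<forall>y. norm (0 - y) \<le> R + 1 \<longrightarrow> a \<le> u y \<and> u y \<le> b"
    by (rule continuous_pos_bounds[OF uc upos, of _ 0])
  have um_ab: "um m x \<in> {a..b}" if "norm x \<le> R" for m x
  proof -
    have *: "a \<le> u y \<and> u y \<le> b" if "norm (x - y) \<le> 1 / Suc m" for y
    proof -
      have "1 / real (Suc m) \<le> 1" by simp
      then have "norm y \<le> R + 1"
        using that \<open>norm x \<le> R\<close> norm_triangle_ineq2[of y x] norm_minus_commute[of x y] by linarith
      then show ?thesis using ab(2)[rule_format, of y] by simp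
    qed
    have "a \<le> um m x" "um m x \<le> b"
      unfolding um_def by (rule mollify_between[OF \<rho> lu], rule *, assumption)+
    then show ?thesis by simp
  qed
  have um_lim: "(\<lambda>m. um m x) \<longlonglongrightarrow> u x" for x
  proof (rule LIMSEQ_I)
    fix e :: real assume "e > 0"
    then have "e / 2 > 0" by simp
    then have "\<exists>d>0. \<forall>y\<in>UNIV. dist y x < d \<longrightarrow> dist (u y) (u x) < e / 2"
      using uc unfolding continuous_on_iff by blast
    then obtain d where d: "d > 0" "\<And>y. norm (y - x) < d \<Longrightarrow> norm (u y - u x) < e / 2"
      by (auto simp: dist_norm)
    obtain N where N: "1 / real (Suc N) < d" using d(1) nat_approx_posE by blast
    have "norm (um m x - u x) < e" if "m \<ge> N" for m
    proof -
      have "1 / real (Suc m) \<le> 1 / real (Suc N)" using that by (simp add: frac_le)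
      then have *: "norm (u y - u x) \<le> e / 2" if "norm (x - y) \<le> 1 / Suc m" for y
        using d(2)[of y] that N by (simp add: norm_minus_commute)
      have "norm (um m x - u x) \<le> e / 2"
        unfolding um_def by (rule mollify_uniform[OF \<rho> lu]) (rule *)
      then show ?thesis using \<open>e > 0\<close> by simp
    qed
    then show "\<exists>N. \<forall>m\<ge>N. norm (um m x - u x) < e" by blast
  qed
  have comp: "continuous_on UNIV (\<lambda>x. k (v x))" if "continuous_on {0<..} k" "continuous_on UNIV v" "\<And>x. v x > 0"
    for k :: "real \<Rightarrow> real" and v :: "real ^ 'n \<Rightarrow> real"
    by (rule continuous_on_compose2[OF that(1,2)]) (use that(3) in auto)
  note gum = comp[OF gc umc umpos] and g'um = comp[OF g(2) umc umpos]
    and gu = comp[OF gc uc upos] and g'u = comp[OF g(2) uc upos]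
  have [measurable]: "w \<in> borel_measurable borel" "\<eta> \<in> borel_measurable borel" "F \<in> borel_measurable borel"
    "G \<in> borel_measurable borel"
    using wc \<eta>c Fc loc_int_borel[OF G] borel_measurable_continuous_onI by blast+
  have [measurable]: "(\<lambda>x. g (u x)) \<in> borel_measurable borel" "(\<lambda>x. g' (u x)) \<in> borel_measurable borel"
    using gu g'u borel_measurable_continuous_onI by blast+
  have [measurable]: "(\<lambda>x. g (um m x)) \<in> borel_measurable borel" "(\<lambda>x. g' (um m x)) \<in> borel_measurable borel"
    "Gm m \<in> borel_measurable borel" for m
    using gum g'um Gmc borel_measurable_continuous_onI by blast+
  have "bounded (g ` {a..b})" "bounded (g' ` {a..b})"
    using ab(1) by (auto intro!: compact_imp_bounded compact_continuous_image continuous_on_subset[OF gc] continuous_on_subset[OF g(2)])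
  then obtain B1 B2 where B12: "\<forall>y\<in>g ` {a..b}. norm y \<le> B1" "\<forall>y\<in>g' ` {a..b}. norm y \<le> B2"
    unfolding bounded_iff by blast
  define B where "B = \<bar>B1\<bar> + \<bar>B2\<bar>"
  have B: "\<bar>g t\<bar> \<le> B" "\<bar>g' t\<bar> \<le> B" if "t \<in> {a..b}" for t
    using bspec[OF B12(1) imageI[OF that]] bspec[OF B12(2) imageI[OF that]] by (simp_all add: B_def)
  have B0: "B \<ge> 0" by (simp add: B_def)
  have Bg: "\<bar>g (um m x)\<bar> \<le> B" "\<bar>g' (um m x)\<bar> \<le> B" if "norm x \<le> R" for m x
    using B(1,2) um_ab[OF that] by auto
  have \<eta>n: "\<bar>\<eta> x ^ k\<bar> \<le> 1" for x k
    using \<eta>(2,3)[of x] by (simp add: power_le_one)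
  have \<eta>0: "\<eta> x ^ n = 0" if "norm x > R" for x
    using \<eta>(4) that n by simp
  have g_lim: "(\<lambda>m. k (um m x)) \<longlonglongrightarrow> k (u x)" if "continuous_on {0<..} k" for k :: "real \<Rightarrow> real" and x
  proof -
    have "isCont k (u x)"
      using that upos[of x] by (simp add: continuous_on_eq_continuous_at)
    then show ?thesis using um_lim by (rule isCont_tendsto_compose)
  qed
  define L where "L m = (LINT x|lborel. w x * (g (um m x) * \<eta> x ^ n))" for m
  define T2 where "T2 m = (LINT x|lborel. (g' (um m x) * \<eta> x ^ n) * (V x \<bullet> G x))" for m
  define T3 where "T3 m = (LINT x|lborel. (g (um m x) * (n * \<eta> x ^ (n - 1))) * (V x \<bullet> F x))" for m
  \<comment> \<open>The first three integrals converge by dominated convergence. This one collects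
    the replacement of the mollified gradient by \<open>G\<close> and tends to 0 by
    \<open>mollify_pairing_convergence\<close>.\<close>
  define E where "E m = (LINT x|lborel. (g' (um m x) * \<eta> x ^ n) * (V x \<bullet> (Gm m x - G x)))" for m
  have i2: "integrable lborel (\<lambda>x. (g' (um m x) * \<eta> x ^ n) * (V x \<bullet> G x))" for m
  proof (rule flux_energy_integrable[OF _ _ _ p Gp VC C])
    show "\<bar>g' (um m x) * \<eta> x ^ n\<bar> \<le> B" if "norm x \<le> R" for x
      using mult_mono[OF Bg(2)[OF that] \<eta>n[of x n] B0] by (simp add: abs_mult)
    show "g' (um m x) * \<eta> x ^ n = 0" if "norm x > R" for x using \<eta>0[OF that] by simp
  qed measurable
  have i2': "integrable lborel (\<lambda>x. (g' (um m x) * \<eta> x ^ n) * (V x \<bullet> Gm m x))" for m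
  proof -
    have "integrable lborel (\<lambda>x. V x \<bullet> ((g' (um m x) * \<eta> x ^ n) *\<^sub>R Gm m x))"
      by (rule loc_int_inner_integrable[OF lV, of _ R]) (use \<eta>0 in \<open>auto intro!: continuous_intros g'um \<eta>c Gmc\<close>)
    then show ?thesis by simp
  qed
  have iVF: "integrable lborel (\<lambda>x. V x \<bullet> F x)"
    by (rule loc_int_inner_integrable[OF lV Fc \<eta>(5)])
  have i3: "integrable lborel (\<lambda>x. (g (um m x) * (n * \<eta> x ^ (n - 1))) * (V x \<bullet> F x))" for m
  proof -
    have "integrable lborel (\<lambda>x. V x \<bullet> ((g (um m x) * (n * \<eta> x ^ (n - 1))) *\<^sub>R F x))"
      by (rule loc_int_inner_integrable[OF lV, of _ R]) (use \<eta>(5) in \<open>auto intro!: continuous_intros gum \<eta>c Fc\<close>)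
    then show ?thesis by simp
  qed
  have main: "L m \<le> T2 m + T3 m + E m" for m
  proof -
    define Fm where "Fm x = (g' (um m x) * \<eta> x ^ n) *\<^sub>R Gm m x + (g (um m x) * (n * \<eta> x ^ (n - 1))) *\<^sub>R F x" for x
    have FmC1: "C1_grad (\<lambda>x. g (um m x) * \<eta> x ^ n) Fm"
      unfolding C1_grad_def
    proof (intro conjI allI)
      fix x
      have "(g has_derivative (\<lambda>h. g' (um m x) * h)) (at (um m x))"
        using g(1)[OF umpos[of m x]] by (simp add: has_field_derivative_def)
      moreover have "(um m has_derivative (\<bullet>) (Gm m x)) (at x)" using C1[of m] by (simp add: C1_grad_def)
      ultimately have 1: "((\<lambda>x. g (um m x)) has_derivative (\<lambda>h. g' (um m x) * (Gm m x \<bullet> h))) (at x)"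
        using has_derivative_compose by blast
      have "(\<eta> has_derivative (\<bullet>) (F x)) (at x)" using \<eta>(1) by (simp add: C1_grad_def)
      from has_derivative_mult[OF 1 has_derivative_power[OF this, of n]]
      show "((\<lambda>x. g (um m x) * \<eta> x ^ n) has_derivative (\<bullet>) (Fm x)) (at x)"
        by (rule has_derivative_eq_rhs) (simp add: fun_eq_iff Fm_def inner_add_left mult_ac)
      show "continuous_on UNIV Fm"
        unfolding Fm_def[abs_def] by (intro continuous_intros g'um gum \<eta>c Gmc Fc)
    qed
    have "L m \<le> (LINT x|lborel. V x \<bullet> Fm x)"
      unfolding L_def
    proof (rule test_inequality_C1[OF lV lw _ FmC1])
      show "(LINT x|lborel. w x * \<phi> x) \<le> (LINT x|lborel. V x \<bullet> grad \<phi> x)"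
        if "test_function \<phi>" "\<forall>x. \<phi> x \<ge> 0" for \<phi>
        using that by (rule ineq)
      show "g (um m x) * \<eta> x ^ n \<ge> 0" for x using g(3)[OF umpos] \<eta>(2) by simp
      show "\<forall>x. norm x > R \<longrightarrow> g (um m x) * \<eta> x ^ n = 0" using \<eta>0 by simp
      show "\<forall>x. norm x > R \<longrightarrow> Fm x = 0" using \<eta>0 \<eta>(5) by (simp add: Fm_def)
    qed
    also have "(LINT x|lborel. V x \<bullet> Fm x) = (LINT x|lborel. ((g' (um m x) * \<eta> x ^ n) * (V x \<bullet> G x) +
        (g (um m x) * (n * \<eta> x ^ (n - 1))) * (V x \<bullet> F x)) + (g' (um m x) * \<eta> x ^ n) * (V x \<bullet> (Gm m x - G x)))"
      by (intro Bochner_Integration.integral_cong) (auto simp: Fm_def inner_add_right inner_diff_right algebra_simps)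
    also have "\<dots> = T2 m + T3 m + E m"
    proof -
      have "integrable lborel (\<lambda>x. (g' (um m x) * \<eta> x ^ n) * (V x \<bullet> (Gm m x - G x)))"
        using Bochner_Integration.integrable_diff[OF i2'[of m] i2[of m]]
        by (simp add: inner_diff_right right_diff_distrib)
      then show ?thesis
        unfolding T2_def T3_def E_def using i2[of m] i3[of m]
        by (subst Bochner_Integration.integral_add | simp)+
    qed
    finally show ?thesis .
  qed
  have L_lim: "L \<longlonglongrightarrow> (LINT x|lborel. w x * (g (u x) * \<eta> x ^ n))"
    unfolding L_def
  proof (rule integral_dominated_convergence[where w="\<lambda>x. B * (indicator (cball 0 R) x *\<^sub>R \<bar>w x\<bar>)"])
    have "integrable lborel (\<lambda>x. indicator (cball 0 R) x *\<^sub>R w x)"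
      using lw by (simp add: loc_int_def set_integrable_def)
    from integrable_norm[OF this] show "integrable lborel (\<lambda>x. B * (indicator (cball 0 R) x *\<^sub>R \<bar>w x\<bar>))"
      by (simp add: abs_mult)
    show "AE x in lborel. (\<lambda>m. w x * (g (um m x) * \<eta> x ^ n)) \<longlonglongrightarrow> w x * (g (u x) * \<eta> x ^ n)"
      by (intro AE_I2 tendsto_intros g_lim gc)
    show "AE x in lborel. norm (w x * (g (um m x) * \<eta> x ^ n)) \<le> B * (indicator (cball 0 R) x *\<^sub>R \<bar>w x\<bar>)" for m
    proof (intro AE_I2)
      fix x
      show "norm (w x * (g (um m x) * \<eta> x ^ n)) \<le> B * (indicator (cball 0 R) x *\<^sub>R \<bar>w x\<bar>)"
      proof (cases "norm x \<le> R")
        case True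
        have "\<bar>g (um m x)\<bar> * \<bar>\<eta> x ^ n\<bar> \<le> B * 1"
          by (rule mult_mono[OF Bg(1)[OF True] \<eta>n B0]) simp
        from mult_left_mono[OF this, of "\<bar>w x\<bar>"] show ?thesis using True by (simp add: abs_mult mult_ac)
      qed (use \<eta>(4) n in simp)
    qed
  qed measurable
  have T2_lim: "T2 \<longlonglongrightarrow> (LINT x|lborel. (g' (u x) * \<eta> x ^ n) * (V x \<bullet> G x))"
    unfolding T2_def
  proof (rule integral_dominated_convergence[where w="\<lambda>x. \<bar>(B * indicator (cball 0 R) x) * (V x \<bullet> G x)\<bar>"])
    show "integrable lborel (\<lambda>x. \<bar>(B * indicator (cball 0 R) x) * (V x \<bullet> G x)\<bar>)"
    proof (intro integrable_abs flux_energy_integrable[OF _ _ _ p Gp VC C, where R=R and B=B])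
      show "(\<lambda>x. B * indicator (cball 0 R) x) \<in> borel_measurable borel"
        by (intro borel_measurable_times borel_measurable_indicator) auto
    qed (use B0 in auto)
    show "AE x in lborel. (\<lambda>m. (g' (um m x) * \<eta> x ^ n) * (V x \<bullet> G x)) \<longlonglongrightarrow> (g' (u x) * \<eta> x ^ n) * (V x \<bullet> G x)"
      by (intro AE_I2 tendsto_intros g_lim g(2))
    show "AE x in lborel. norm ((g' (um m x) * \<eta> x ^ n) * (V x \<bullet> G x)) \<le> \<bar>(B * indicator (cball 0 R) x) * (V x \<bullet> G x)\<bar>" for m
    proof (intro AE_I2)
      fix x
      show "norm ((g' (um m x) * \<eta> x ^ n) * (V x \<bullet> G x)) \<le> \<bar>(B * indicator (cball 0 R) x) * (V x \<bullet> G x)\<bar>"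
      proof (cases "norm x \<le> R")
        case True
        have "\<bar>g' (um m x)\<bar> * \<bar>\<eta> x ^ n\<bar> \<le> B * 1"
          by (rule mult_mono[OF Bg(2)[OF True] \<eta>n B0]) simp
        from mult_right_mono[OF this, of "\<bar>V x \<bullet> G x\<bar>"] show ?thesis using True B0 by (simp add: abs_mult)
      qed (use \<eta>(4) n in simp)
    qed
  qed measurable
  have T3_lim: "T3 \<longlonglongrightarrow> (LINT x|lborel. (g (u x) * (n * \<eta> x ^ (n - 1))) * (V x \<bullet> F x))"
    unfolding T3_def
  proof (rule integral_dominated_convergence[where w="\<lambda>x. (B * n) * \<bar>V x \<bullet> F x\<bar>"])
    show "integrable lborel (\<lambda>x. (B * n) * \<bar>V x \<bullet> F x\<bar>)"
      using iVF by (intro integrable_mult_right integrable_abs)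
    show "AE x in lborel. (\<lambda>m. (g (um m x) * (n * \<eta> x ^ (n - 1))) * (V x \<bullet> F x)) \<longlonglongrightarrow> (g (u x) * (n * \<eta> x ^ (n - 1))) * (V x \<bullet> F x)"
      by (intro AE_I2 tendsto_intros g_lim gc)
    show "AE x in lborel. norm ((g (um m x) * (n * \<eta> x ^ (n - 1))) * (V x \<bullet> F x)) \<le> (B * n) * \<bar>V x \<bullet> F x\<bar>" for m
    proof (intro AE_I2)
      fix x
      show "norm ((g (um m x) * (n * \<eta> x ^ (n - 1))) * (V x \<bullet> F x)) \<le> (B * n) * \<bar>V x \<bullet> F x\<bar>"
      proof (cases "norm x \<le> R")
        case True
        have "\<bar>g (um m x)\<bar> * \<bar>\<eta> x ^ (n - 1)\<bar> \<le> B * 1"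
          by (rule mult_mono[OF Bg(1)[OF True] \<eta>n B0]) simp
        from mult_right_mono[OF this, of "n * \<bar>V x \<bullet> F x\<bar>"] show ?thesis by (simp add: abs_mult mult_ac)
      qed (use \<eta>(5) in simp)
    qed
  qed measurable
  have E_lim: "E \<longlonglongrightarrow> 0"
  proof (rule LIMSEQ_I)
    fix e :: real assume "e > 0"
    then have "e / (2 * (B + 1)) > 0" using B0 by simp
    then have "\<exists>d>0. \<forall>\<delta> \<rho>. mollifier \<delta> \<rho> \<longrightarrow> \<delta> \<le> d \<longrightarrow>
      (\<integral>\<^sup>+x\<in>cball 0 R. ennreal (norm (V x) * norm (mollify \<rho> G x - G x)) \<partial>lborel) \<le> ennreal (e / (2 * (B + 1)))"
      by (rule mollify_pairing_convergence[OF G p Gp Vm VC C, of _ R]) blast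
    then obtain d where d: "d > 0" "\<forall>\<delta> \<rho>. mollifier \<delta> \<rho> \<longrightarrow> \<delta> \<le> d \<longrightarrow>
      (\<integral>\<^sup>+x\<in>cball 0 R. ennreal (norm (V x) * norm (mollify \<rho> G x - G x)) \<partial>lborel) \<le> ennreal (e / (2 * (B + 1)))"
      by blast
    obtain N where N: "1 / real (Suc N) < d" using d(1) nat_approx_posE by blast
    have "norm (E m) < e" if "m \<ge> N" for m
    proof -
      have "1 / real (Suc m) \<le> 1 / real (Suc N)" using that by (simp add: frac_le)
      then have "1 / real (Suc m) \<le> d" using N by simp
      from d(2)[rule_format, OF \<rho> this]
      have dm: "(\<integral>\<^sup>+x\<in>cball 0 R. ennreal (norm (V x) * norm (Gm m x - G x)) \<partial>lborel) \<le> ennreal (e / (2 * (B + 1)))"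
        by (simp add: Gm_def)
      have "ennreal (norm (E m)) \<le> (\<integral>\<^sup>+x. ennreal (norm ((g' (um m x) * \<eta> x ^ n) * (V x \<bullet> (Gm m x - G x)))) \<partial>lborel)"
        unfolding E_def
      proof (rule integral_norm_bound_ennreal)
        show "integrable lborel (\<lambda>x. (g' (um m x) * \<eta> x ^ n) * (V x \<bullet> (Gm m x - G x)))"
          using Bochner_Integration.integrable_diff[OF i2'[of m] i2[of m]]
          by (simp add: inner_diff_right right_diff_distrib)
      qed
      also have "\<dots> \<le> (\<integral>\<^sup>+x. ennreal B * (ennreal (norm (V x) * norm (Gm m x - G x)) * indicator (cball 0 R) x) \<partial>lborel)"
      proof (intro nn_integral_mono)
        fix x
        show "ennreal (norm ((g' (um m x) * \<eta> x ^ n) * (V x \<bullet> (Gm m x - G x)))) \<le>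
           ennreal B * (ennreal (norm (V x) * norm (Gm m x - G x)) * indicator (cball 0 R) x)"
        proof (cases "norm x \<le> R")
          case True
          have "\<bar>g' (um m x)\<bar> * \<bar>\<eta> x ^ n\<bar> \<le> B * 1"
            by (rule mult_mono[OF Bg(2)[OF True] \<eta>n B0]) simp
          then have "(\<bar>g' (um m x)\<bar> * \<bar>\<eta> x ^ n\<bar>) * \<bar>V x \<bullet> (Gm m x - G x)\<bar> \<le> B * (norm (V x) * norm (Gm m x - G x))"
            using Cauchy_Schwarz_ineq2[of "V x" "Gm m x - G x"] B0 by (intro mult_mono) auto
          then have "norm ((g' (um m x) * \<eta> x ^ n) * (V x \<bullet> (Gm m x - G x))) \<le> B * (norm (V x) * norm (Gm m x - G x))"
            by (simp add: abs_mult)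
          then have "ennreal (norm ((g' (um m x) * \<eta> x ^ n) * (V x \<bullet> (Gm m x - G x)))) \<le>
              ennreal (B * (norm (V x) * norm (Gm m x - G x)))" by (rule ennreal_leI)
          also have "\<dots> = ennreal B * (ennreal (norm (V x) * norm (Gm m x - G x)) * indicator (cball 0 R) x)"
            using True B0 by (simp add: ennreal_mult)
          finally show ?thesis .
        qed (use \<eta>(4) n in simp)
      qed
      also have "\<dots> = ennreal B * (\<integral>\<^sup>+x\<in>cball 0 R. ennreal (norm (V x) * norm (Gm m x - G x)) \<partial>lborel)"
        by (rule nn_integral_cmult) (auto intro!: borel_measurable_times_ennreal borel_measurable_indicator)
      also have "\<dots> \<le> ennreal B * ennreal (e / (2 * (B + 1)))"
        by (intro mult_left_mono dm) simp
      also have "\<dots> = ennreal (B * (e / (2 * (B + 1))))"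
        using B0 \<open>e > 0\<close> by (subst ennreal_mult) auto
      finally have "norm (E m) \<le> B * (e / (2 * (B + 1)))"
        using B0 \<open>e > 0\<close> by (subst (asm) ennreal_le_iff) auto
      also have "\<dots> < e" using B0 \<open>e > 0\<close> by (simp add: field_simps add_nonneg_pos)
      finally show ?thesis .
    qed
    then show "\<exists>N. \<forall>m\<ge>N. norm (E m - 0) < e" by auto
  qed
  have "(LINT x|lborel. w x * (g (u x) * \<eta> x ^ n)) \<le>
    (LINT x|lborel. (g' (u x) * \<eta> x ^ n) * (V x \<bullet> G x)) + (LINT x|lborel. (g (u x) * (n * \<eta> x ^ (n - 1))) * (V x \<bullet> F x)) + 0"
    by (rule LIMSEQ_le[OF L_lim tendsto_add[OF tendsto_add[OF T2_lim T3_lim] E_lim]]) (use main in auto)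
  then show ?thesis by simp
qed

section \<open>The weighted Young inequality\<close>

text \<open>The integral of h from 1 to t is nonnegative for t \<ge> 1, and for t < 1 it is at least
  minus the finite integral K of h over (0, 1]. Adding 1 + K lifts it to at least 1.\<close>

lemma ex_antiderivative_bounded_below:
  fixes h :: "real \<Rightarrow> real"
  assumes hc: "continuous_on {0<..} h" and pos: "\<And>t. t > 0 \<Longrightarrow> h t > 0"
    and fin: "(\<integral>\<^sup>+t\<in>{0<..1}. ennreal (h t) \<partial>lborel) < \<infinity>"
  obtains I where "\<And>t. t > 0 \<Longrightarrow> (I has_real_derivative h t) (at t)" "\<And>t. t > 0 \<Longrightarrow> I t \<ge> 1"
proof -
  define J where "J t = (LBINT y=1..t. h y)" for t :: real
  define K where "K = enn2real (\<integral>\<^sup>+t\<in>{0<..1}. ennreal (h t) \<partial>lborel)"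
  have K: "(\<integral>\<^sup>+t\<in>{0<..1}. ennreal (h t) \<partial>lborel) = ennreal K"
    using fin by (simp add: K_def)
  have "K \<ge> 0" by (simp add: K_def)
  have der: "(J has_real_derivative h t) (at t)" if t: "t > 0" for t
  proof -
    \<comment> \<open>The interval [a, b] lies in (0, \<infinity>), contains the base point 1, and
      has t in its interior, so the fundamental theorem gives a two-sided derivative at t.\<close>
    define a where "a = min t 1 / 2"
    define b where "b = max t 1 + 1"
    have ab: "0 < a" "a < t" "t < b" "a \<le> 1" "1 \<le> b" using t by (auto simp: a_def b_def)
    have "((\<lambda>u. LBINT y=ereal 1..u. h y) has_vector_derivative h t) (at t within {a..b})"
    proof (rule interval_integral_FTC2)
      show "continuous_on {a..b} h" using ab by (intro continuous_on_subset[OF hc]) auto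
    qed (use ab in auto)
    moreover have "at t within {a..b} = at t" using ab by (intro at_within_Icc_at) auto
    ultimately show ?thesis
      by (simp add: J_def[abs_def] has_real_derivative_iff_has_vector_derivative one_ereal_def)
  qed
  have low: "J t \<ge> - K" if t: "t > 0" for t
  proof (cases "t \<ge> 1")
    case True
    have "J t = (LINT y:{1..t}|lborel. h y)"
      unfolding J_def using interval_integral_Icc[OF True, of h] by (simp add: one_ereal_def)
    also have "\<dots> \<ge> 0"
      unfolding set_lebesgue_integral_def
      using pos by (intro Bochner_Integration.integral_nonneg) (auto simp: indicator_def less_imp_le)
    finally show ?thesis using \<open>K \<ge> 0\<close> by simp
  next
    case False
    have hint: "set_integrable lborel {t..1} h"
      using t by (intro borel_integrable_atLeastAtMost' continuous_on_subset[OF hc]) auto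
    have "J t = - (LINT y:{t..1}|lborel. h y)"
      unfolding J_def using False interval_integral_Icc[of t 1 h] interval_integral_endpoints_reverse[of 1 "ereal t" h]
      by (simp add: one_ereal_def)
    moreover have "(LINT y:{t..1}|lborel. h y) \<le> K"
    proof -
      have "ennreal (LINT y:{t..1}|lborel. h y) = (\<integral>\<^sup>+y. ennreal (indicator {t..1} y *\<^sub>R h y) \<partial>lborel)"
        unfolding set_lebesgue_integral_def
        using hint[unfolded set_integrable_def] pos t
        by (intro nn_integral_eq_integral[symmetric]) (auto simp: indicator_def less_imp_le)
      also have "\<dots> \<le> (\<integral>\<^sup>+t\<in>{0<..1}. ennreal (h t) \<partial>lborel)"
        using t by (intro nn_integral_mono) (auto simp: indicator_def)
      finally show ?thesis unfolding K using \<open>K \<ge> 0\<close> by simp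
    qed
    ultimately show ?thesis by simp
  qed
  show ?thesis
  proof
    show "((\<lambda>t. J t + (1 + K)) has_real_derivative h t) (at t)" if "t > 0" for t
      using DERIV_add[OF der[OF that] DERIV_const] by simp
    show "J t + (1 + K) \<ge> 1" if "t > 0" for t using low[OF that] by simp
  qed
qed

text \<open>The exponents \<open>\<sigma>\<close> and \<open>\<tau>\<close> are those for which Young's inequality with exponents
  \<open>1 / p - 1 / n\<close>, \<open>1 - 1 / p\<close>, \<open>1 / n\<close> leaves only the conformally invariant power \<open>D ^ n\<close>.\<close>
lemma weighted_product_identity:
  fixes n :: nat and p c \<sigma> \<tau> f J \<eta> S :: real
  assumes n: "n \<ge> 2" and p: "1 < p" "p < n" and c: "c > 0"
    and \<sigma>: "\<sigma> = p / (n * (p - 1))" and \<tau>: "\<tau> = (n - p) / (n * (p - 1))"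
    and pos: "f > 0" "J > 0" "\<eta> > 0" "S > 0"
  shows "J powr (- (1 / \<sigma>)) * \<eta> ^ (n - 1) * S powr (p - 1) = (\<sigma> / c) powr (1 - 1 / p) *
     (f * J powr (- (1 / \<sigma>)) * \<eta> ^ n) powr (1 / p - 1 / n) *
     (c / \<sigma> * J powr (- (1 / \<sigma>) - 1) * f powr (- \<tau>) * \<eta> ^ n * S powr p) powr (1 - 1 / p)"
proof -
  have "\<sigma> > 0" using n p by (simp add: \<sigma>)
  \<comment> \<open>All quantities are positive, so after taking logarithms the identity is linear
    in a, j, x, y. Below, \<open>E1\<close> cancels f, \<open>E2\<close> produces the power p - 1 of
    S, \<open>E3\<close> the power n - 1 of \<eta>, and \<open>E4\<close> reproduces the power of J;
    the constant k cancels against its negative.\<close>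
  define k where "k = ln (c / \<sigma>)"
  have ck: "c / \<sigma> = exp k" using c \<open>\<sigma> > 0\<close> by (simp add: k_def)
  have ck': "\<sigma> / c = exp (- k)" using ck c \<open>\<sigma> > 0\<close> by (simp add: exp_minus field_simps)
  obtain a j x y where e: "f = exp a" "J = exp j" "\<eta> = exp x" "S = exp y"
    using pos by (metis exp_ln)
  define s \<theta> \<beta> where "s = 1 / \<sigma>" and "\<theta> = 1 / p - 1 / real n" and "\<beta> = 1 - 1 / p"
  have E1: "\<tau> * \<beta> = \<theta>" using n p by (simp add: \<tau> \<beta>_def \<theta>_def field_simps)
  have E2: "p * \<beta> = p - 1" using p by (simp add: \<beta>_def field_simps)
  have E3: "real n * (\<theta> + \<beta>) = real (n - 1)" using n p by (simp add: \<theta>_def \<beta>_def field_simps of_nat_diff)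
  have E4: "s * (\<theta> + \<beta>) + \<beta> = s"
  proof -
    have 1: "\<beta> = s / real n" using n p by (simp add: s_def \<sigma> \<beta>_def field_simps)
    have 2: "\<theta> + \<beta> = 1 - 1 / real n" by (simp add: \<theta>_def \<beta>_def)
    show ?thesis unfolding 2 unfolding 1 by (simp add: right_diff_distrib)
  qed
  have "(- k) * \<beta> + (a + j * (- s) + real n * x) * \<theta> + (k + j * (- s - 1) + a * (- \<tau>) + real n * x + y * p) * \<beta>
     = a * (\<theta> - \<tau> * \<beta>) - j * (s * (\<theta> + \<beta>) + \<beta>) + (real n * (\<theta> + \<beta>)) * x + (p * \<beta>) * y"
    by (simp add: algebra_simps)
  also have "\<dots> = j * (- s) + real (n - 1) * x + y * (p - 1)"
    unfolding E1 E2 E3 E4 by (simp add: algebra_simps)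
  finally show ?thesis
    unfolding e ck ck' s_def[symmetric] \<theta>_def[symmetric] \<beta>_def[symmetric]
    by (simp only: exp_powr_real exp_of_nat_mult[symmetric] exp_add[symmetric])
qed

text \<open>Young's inequality with three factors, obtained by comparison with the larger energy. If
  M = r^n is the maximum of the two densities, their product is at most r^(n-1), and the remaining
  factor 2 P D is compared with r. The coefficient 1/2 on the densities leaves room for absorbing
  them into the left side of the tested inequality.\<close>

lemma weighted_young:
  fixes n :: nat and p c C \<sigma> \<tau> f J \<eta> S D :: real
  assumes n: "n \<ge> 2" and p: "1 < p" "p < n" and c: "c > 0" and C: "C \<ge> 0"
    and \<sigma>: "\<sigma> = p / (n * (p - 1))" and \<tau>: "\<tau> = (n - p) / (n * (p - 1))"
    and pos: "f > 0" "J > 0" "\<eta> \<ge> 0" "S \<ge> 0" "D \<ge> 0"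
  shows "J powr (- (1 / \<sigma>)) * (n * \<eta> ^ (n - 1)) * (C * S powr (p - 1) * D) \<le>
     (f * J powr (- (1 / \<sigma>)) * \<eta> ^ n + c / \<sigma> * J powr (- (1 / \<sigma>) - 1) * f powr (- \<tau>) * \<eta> ^ n * S powr p) / 2
     + (2 * n * C * (\<sigma> / c) powr (1 - 1 / p)) ^ n * D ^ n"
    (is "?lhs \<le> (?A + ?B) / 2 + ?K * D ^ n")
proof -
  have "\<sigma> > 0" using n p by (simp add: \<sigma>)
  have A: "?A \<ge> 0" and B: "?B \<ge> 0" using pos c \<open>\<sigma> > 0\<close> by simp_all
  have K: "?K * D ^ n \<ge> 0" using pos C by simp
  show ?thesis
  proof (cases "\<eta> = 0 \<or> S = 0")
    \<comment> \<open>The product identity needs \<eta> and S positive. If one of them is 0, the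
      left side vanishes, since n - 1 > 0 and \<open>0 powr (p - 1) = 0\<close>.\<close>
    case True
    then have lhs: "?lhs = 0" using n by (auto simp: power_0_left)
    have "(?A + ?B) / 2 \<ge> 0" using A B by simp
    then show ?thesis unfolding lhs using K by (rule add_nonneg_nonneg)
  next
    case False
    then have "\<eta> > 0" "S > 0" using pos by auto
    then have A': "?A > 0" and B': "?B > 0" using pos c \<open>\<sigma> > 0\<close> by simp_all
    define P where "P = n * C * (\<sigma> / c) powr (1 - 1 / p)"
    have P: "P \<ge> 0" using C by (simp add: P_def)
    \<comment> \<open>The exponents 1/p - 1/n and 1 - 1/p add up to 1 - 1/n, so with r = M powr (1 /
      n) the weighted product is at most r^(n-1).\<close>
    define M where "M = max ?A ?B"
    define r where "r = M powr (1 / n)"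
    have M: "M > 0" using A' by (simp add: M_def)
    have r: "r > 0" using M by (simp add: r_def)
    have Mr: "r ^ n = M"
      using M n by (simp add: r_def powr_realpow[symmetric] powr_powr)
    have th: "1 / p - 1 / n \<ge> 0" "1 - 1 / p \<ge> 0" using n p by (auto simp: field_simps)
    have "?A powr (1 / p - 1 / n) * ?B powr (1 - 1 / p) \<le> M powr (1 / p - 1 / n) * M powr (1 - 1 / p)"
      using A B th by (intro mult_mono powr_mono2) (auto simp: M_def)
    also have "\<dots> = M powr (1 - 1 / n)" by (simp add: powr_add[symmetric])
    also have "\<dots> = r ^ (n - 1)"
    proof -
      have "r ^ (n - 1) = M powr (1 / n * real (n - 1))"
        using r by (simp add: powr_realpow[symmetric] r_def powr_powr del: of_nat_diff)
      also have "1 / n * real (n - 1) = 1 - 1 / n" using n by (simp add: of_nat_diff field_simps)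
      finally show ?thesis by simp
    qed
    finally have AB: "?A powr (1 / p - 1 / n) * ?B powr (1 - 1 / p) \<le> r ^ (n - 1)" .
    have "?lhs = (n * C) * D * (J powr (- (1 / \<sigma>)) * \<eta> ^ (n - 1) * S powr (p - 1))"
      by (simp add: mult_ac)
    also have "\<dots> = P * D * (?A powr (1 / p - 1 / n) * ?B powr (1 - 1 / p))"
      unfolding weighted_product_identity[OF n p c \<sigma> \<tau> pos(1,2) \<open>\<eta> > 0\<close> \<open>S > 0\<close>] P_def
      by (simp add: mult_ac)
    also have "\<dots> \<le> P * D * r ^ (n - 1)"
      using AB P pos by (intro mult_left_mono) auto
    also have "\<dots> \<le> M / 2 + (2 * P * D) ^ n"
    proof (cases "2 * P * D \<le> r")
      case True
      then have "P * D * r ^ (n - 1) \<le> r / 2 * r ^ (n - 1)"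
        using r by (intro mult_right_mono) auto
      also have "\<dots> = M / 2"
        using n by (simp add: Mr[symmetric] power_eq_if[of _ n])
      finally show ?thesis using P pos by (simp add: add_increasing2)
    next
      case False
      then have "P * D * r ^ (n - 1) \<le> (2 * P * D) * (2 * P * D) ^ (n - 1)"
        using r P pos by (intro mult_mono power_mono) auto
      also have "\<dots> = (2 * P * D) ^ n" using n by (simp add: power_eq_if[of _ n])
      finally show ?thesis using M by simp
    qed
    also have "\<dots> \<le> (?A + ?B) / 2 + ?K * D ^ n"
    proof -
      have "M \<le> ?A + ?B" using A B by (simp add: M_def)
      moreover have "(2 * P * D) ^ n = ?K * D ^ n"
        unfolding P_def power_mult_distrib[symmetric] by (simp add: mult_ac)
      ultimately show ?thesis by simp
    qed
    finally show ?thesis .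
  qed
qed

section \<open>Nonexistence\<close>

lemma no_positive_supersolution:
  fixes H u :: "real ^ 'n \<Rightarrow> real" and p \<sigma> \<tau> :: real and f :: "real \<Rightarrow> real"
  assumes n: "CARD('n) \<ge> 2" and H: "anisotropy H" and p: "1 < p" "p < real CARD('n)"
    and \<sigma>: "\<sigma> = p / (real CARD('n) * (p - 1))"
    and \<tau>: "\<tau> = (real CARD('n) - p) / (real CARD('n) * (p - 1))"
    and fc: "continuous_on {0<..} f" and fpos: "\<forall>v>0. f v > 0"
    and fin: "(\<integral>\<^sup>+v\<in>{0<..1}. ennreal (f v powr (- \<tau>)) \<partial>lborel) < \<infinity>"
    and u: "supersolution H p f u" "\<forall>x. u x > 0"
  shows False
proof -
  let ?n = "CARD('n)"
  have "\<sigma> > 0" using n p by (simp add: \<sigma>)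
  have uc: "continuous_on UNIV u" using u(1) by (simp add: supersolution_def)
  have upos: "u x > 0" for x using u(2) by blast
  obtain C c where Cc: "C > 0" "c > 0" "\<And>x. norm (flux H p x) \<le> C * norm x powr (p - 1)"
    "\<And>x. flux H p x \<bullet> x \<ge> c * norm x powr p"
    using flux_bounds[OF H p(1)] by blast
  obtain G where G: "loc_int G" "loc_int (\<lambda>x. norm (G x) powr p)"
    and weak: "\<And>\<phi> i. test_function \<phi> \<Longrightarrow> (LINT x|lborel. u x * grad \<phi> x $ i) = - (LINT x|lborel. G x $ i * \<phi> x)"
    and ineq: "\<And>\<phi>. test_function \<phi> \<Longrightarrow> (\<forall>x. \<phi> x \<ge> 0) \<Longrightarrow>
       (LINT x|lborel. f (u x) * \<phi> x) \<le> (LINT x|lborel. flux H p (G x) \<bullet> grad \<phi> x)"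
    using supersolution_borel_gradient[OF H p(1) fc u] by blast
  define V where "V x = flux H p (G x)" for x
  have Gm[measurable]: "G \<in> borel_measurable borel" using G(1) by (rule loc_int_borel)
  have Vm: "V \<in> borel_measurable borel"
    unfolding V_def[abs_def] using flux_measurable[OF H p(1)] Gm by measurable
  have VC: "norm (V x) \<le> C * norm (G x) powr (p - 1)" for x unfolding V_def by (rule Cc(3))
  have Vc: "V x \<bullet> G x \<ge> c * norm (G x) powr p" for x unfolding V_def by (rule Cc(4))
  have lV: "loc_int V" using flux_loc_int[OF Vm p(1) G(2) VC] Cc(1) by simp
  define h where "h t = f t powr (- \<tau>)" for t
  have hc: "continuous_on {0<..} h"
    unfolding h_def[abs_def] by (intro continuous_intros fc) (use fpos in force)
  have hpos: "h t > 0" if "t > 0" for t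
    using fpos that by (simp add: h_def less_imp_neq[symmetric])
  obtain I where I: "\<And>t. t > 0 \<Longrightarrow> (I has_real_derivative h t) (at t)" "\<And>t. t > 0 \<Longrightarrow> I t \<ge> 1"
    using ex_antiderivative_bounded_below[OF hc hpos fin[folded h_def]] by blast
  have Ipos: "I t > 0" if "t > 0" for t using I(2)[OF that] by simp
  have Ic: "continuous_on {0<..} I"
    by (intro continuous_at_imp_continuous_on ballI DERIV_isCont[OF I(1)]) simp
  define g where "g t = I t powr (- (1 / \<sigma>))" for t
  define g' where "g' t = - (1 / \<sigma> * I t powr (- (1 / \<sigma>) - 1) * h t)" for t
  have gder: "(g has_real_derivative g' t) (at t)" if t: "t > 0" for t
  proof -
    have "((\<lambda>s. s powr (- (1 / \<sigma>))) has_real_derivative - (1 / \<sigma>) * I t powr (- (1 / \<sigma>) - 1)) (at (I t))"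
      by (rule has_real_derivative_powr[OF Ipos[OF t]])
    from DERIV_chain2[OF this I(1)[OF t]] show ?thesis
      by (simp add: g_def[abs_def] g'_def)
  qed
  have gc: "continuous_on {0<..} g" unfolding g_def[abs_def]
    by (intro continuous_intros Ic) (use Ipos in force)
  have g'c: "continuous_on {0<..} g'" unfolding g'_def[abs_def]
    by (intro continuous_intros Ic hc) (use Ipos in force)
  have gpos: "g t > 0" if "t > 0" for t using Ipos[OF that] by (simp add: g_def less_imp_neq[symmetric])
  have comp: "continuous_on UNIV (\<lambda>x. k (u x))" if "continuous_on {0<..} k" for k :: "real \<Rightarrow> real"
    by (rule continuous_on_compose2[OF that uc]) (use upos in auto)
  have wpos: "f (u x) > 0" for x using fpos upos by blast
  have "continuous_on UNIV (\<lambda>x. f (u x) * g (u x))"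
    by (intro continuous_intros comp fc gc)
  moreover have "f (u x) * g (u x) > 0" for x using wpos gpos upos by simp
  \<comment> \<open>The positive lower bound a for f(u) g(u) on the unit ball keeps the source
    integral above \<delta> for every cutoff that equals 1 there.\<close>
  ultimately obtain a b where ab: "0 < a" "\<forall>y. norm (0 - y) \<le> 1 \<longrightarrow> a \<le> f (u y) * g (u y) \<and> f (u y) * g (u y) \<le> b"
    by (rule continuous_pos_bounds[of "\<lambda>x. f (u x) * g (u x)" 1 0]) simp
  define K where "K = (2 * ?n * C * (\<sigma> / c) powr (1 - 1 / p)) ^ ?n"
  have "K \<ge> 0" using Cc by (simp add: K_def)
  define \<delta> where "\<delta> = a * measure lborel (cball (0 :: real ^ 'n) 1)"
  have "measure lborel (cball (0 :: real ^ 'n) 1) > 0"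
    using content_cball_gt_0_iff[of "0 :: real ^ 'n" 1] by simp
  then have "\<delta> > 0" using ab(1) by (simp add: \<delta>_def)
  \<comment> \<open>The energy e can be prescribed before the cutoff is chosen because neither K nor
    \<delta> involves the cutoff. The summand 1 makes 2 K e < \<delta> strict and covers K =
    0.\<close>
  define e where "e = \<delta> / (2 * (K + 1))"
  have e: "e > 0" "2 * K * e < \<delta>"
    using \<open>\<delta> > 0\<close> \<open>K \<ge> 0\<close> by (auto simp: e_def field_simps add_nonneg_pos)
  obtain \<eta> :: "real ^ 'n \<Rightarrow> real" and F R0 where \<eta>: "C1_grad \<eta> F" "\<And>x. 0 \<le> \<eta> x" "\<And>x. \<eta> x \<le> 1"
    "\<And>x. norm x \<le> 1 \<Longrightarrow> \<eta> x = 1" "\<forall>x. norm x > R0 \<longrightarrow> \<eta> x = 0" "\<forall>x. norm x > R0 \<longrightarrow> F x = 0"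
    "(LINT x|lborel. norm (F x) ^ ?n) \<le> e"
    using ex_small_cutoff[OF n e(1)] by blast
  define R where "R = max R0 0"
  have R: "R \<ge> 0" "\<forall>x. norm x > R \<longrightarrow> \<eta> x = 0" "\<forall>x. norm x > R \<longrightarrow> F x = 0"
    using \<eta>(5,6) by (auto simp: R_def)
  have \<eta>c: "continuous_on UNIV \<eta>"
    using \<eta>(1) unfolding C1_grad_def by (meson continuous_at_imp_continuous_on has_derivative_continuous)
  have Fc: "continuous_on UNIV F" using \<eta>(1) by (simp add: C1_grad_def)
  define A where "A x = f (u x) * (g (u x) * \<eta> x ^ ?n)" for x
  define k where "k x = g' (u x) * \<eta> x ^ ?n" for x
  define T where "T x = (g (u x) * (?n * \<eta> x ^ (?n - 1))) * (V x \<bullet> F x)" for x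
  have kc: "continuous_on UNIV k" unfolding k_def[abs_def]
    by (intro continuous_intros comp g'c \<eta>c)
  have k0: "\<forall>x. norm x > R \<longrightarrow> k x = 0" using R(2) n by (simp add: k_def)
  have main: "(LINT x|lborel. A x) \<le> (LINT x|lborel. k x * (V x \<bullet> G x)) + (LINT x|lborel. T x)"
    unfolding A_def k_def T_def
  proof (rule nonlinear_test[OF uc upos comp[OF fc] G(1) p(1) G(2) _ Vm VC _ _ gder g'c _ \<eta>(1-3) R(2,3,1)])
    show "(LINT x|lborel. u x * grad \<phi> x $ i) = - (LINT x|lborel. G x $ i * \<phi> x)" if "test_function \<phi>" for \<phi> i
      using that by (rule weak)
    show "(LINT x|lborel. f (u x) * \<phi> x) \<le> (LINT x|lborel. V x \<bullet> grad \<phi> x)"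
      if "test_function \<phi>" "\<forall>x. \<phi> x \<ge> 0" for \<phi>
      using ineq[OF that] by (simp add: V_def)
  qed (use Cc(1) n gpos in \<open>auto simp: less_imp_le\<close>)
  have iA: "integrable lborel A"
    by (rule integrable_continuous_compact_support[of _ R])
      (use R(2) n in \<open>auto simp: A_def[abs_def] intro!: continuous_intros comp fc gc \<eta>c\<close>)
  obtain B where B: "\<And>x. norm (k x) \<le> B"
    using compact_support_bounded[OF kc k0] by blast
  have iB: "integrable lborel (\<lambda>x. k x * (V x \<bullet> G x))"
  proof (rule flux_energy_integrable[OF Vm Gm borel_measurable_continuous_onI[OF kc] p(1) G(2) VC])
    show "\<bar>k x\<bar> \<le> B" for x using B[of x] by simp
  qed (use Cc(1) k0 in auto)
  have iT: "integrable lborel T"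
  proof -
    have "integrable lborel (\<lambda>x. V x \<bullet> ((g (u x) * (?n * \<eta> x ^ (?n - 1))) *\<^sub>R F x))"
      by (rule loc_int_inner_integrable[OF lV, of _ R])
        (use R(3) in \<open>auto intro!: continuous_intros comp gc \<eta>c Fc\<close>)
    then show ?thesis by (simp add: T_def[abs_def])
  qed
  have iF: "integrable lborel (\<lambda>x. norm (F x) ^ ?n)"
    by (rule integrable_continuous_compact_support[of _ R])
      (use R(3) n in \<open>auto intro!: continuous_intros Fc\<close>)
  \<comment> \<open>The factor g'(u) is negative, so the coercivity of the flux becomes an upper
    bound. The weight c / \<sigma> in \<open>weighted_young\<close> is the product of the coercivity
    constant with the factor 1 / \<sigma> from g'.\<close>
  have kneg: "k x * (V x \<bullet> G x) \<le> - (c / \<sigma> * I (u x) powr (- (1 / \<sigma>) - 1) * h (u x) * \<eta> x ^ ?n * norm (G x) powr p)" for x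
  proof -
    have "0 \<le> 1 / \<sigma> * I (u x) powr (- (1 / \<sigma>) - 1) * h (u x) * \<eta> x ^ ?n"
      using \<open>\<sigma> > 0\<close> hpos[OF upos[of x]] \<eta>(2)[of x] by simp
    from mult_left_mono[OF Vc[of x] this] show ?thesis
      by (simp add: k_def g'_def mult_ac)
  qed
  have young: "T x \<le> (A x + - (k x * (V x \<bullet> G x))) / 2 + K * norm (F x) ^ ?n" for x
  proof -
    let ?J = "I (u x)"
    have "V x \<bullet> F x \<le> C * norm (G x) powr (p - 1) * norm (F x)"
      using Cauchy_Schwarz_ineq2[of "V x" "F x"] mult_right_mono[OF VC[of x] norm_ge_zero[of "F x"]] by linarith
    then have "T x \<le> (g (u x) * (?n * \<eta> x ^ (?n - 1))) * (C * norm (G x) powr (p - 1) * norm (F x))"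
      unfolding T_def using gpos[OF upos[of x]] \<eta>(2)[of x] by (intro mult_left_mono) auto
    also have "\<dots> \<le> (f (u x) * ?J powr (- (1 / \<sigma>)) * \<eta> x ^ ?n +
        c / \<sigma> * ?J powr (- (1 / \<sigma>) - 1) * f (u x) powr (- \<tau>) * \<eta> x ^ ?n * norm (G x) powr p) / 2 + K * norm (F x) ^ ?n"
      unfolding g_def K_def
      by (rule weighted_young[OF n p Cc(2) _ \<sigma> \<tau> wpos Ipos[OF upos] \<eta>(2)]) (use Cc(1) in auto)
    also have "\<dots> \<le> (A x + - (k x * (V x \<bullet> G x))) / 2 + K * norm (F x) ^ ?n"
      using kneg[of x] by (simp add: A_def g_def h_def mult.assoc)
    finally show ?thesis .
  qed
  have "(LINT x|lborel. T x) \<le> (LINT x|lborel. (A x + - (k x * (V x \<bullet> G x))) / 2 + K * norm (F x) ^ ?n)"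
    using iA iB iF young by (intro integral_mono iT) auto
  also have "\<dots> = ((LINT x|lborel. A x) - (LINT x|lborel. k x * (V x \<bullet> G x))) / 2 + K * (LINT x|lborel. norm (F x) ^ ?n)"
    using iA iB iF by simp
  finally have T: "(LINT x|lborel. T x) \<le>
    ((LINT x|lborel. A x) - (LINT x|lborel. k x * (V x \<bullet> G x))) / 2 + K * (LINT x|lborel. norm (F x) ^ ?n)" .
  have "0 \<le> (LINT x|lborel. - (k x * (V x \<bullet> G x)))"
  proof (rule Bochner_Integration.integral_nonneg)
    fix x
    have "0 \<le> c / \<sigma> * I (u x) powr (- (1 / \<sigma>) - 1) * h (u x) * \<eta> x ^ ?n * norm (G x) powr p"
      using \<open>\<sigma> > 0\<close> hpos[OF upos[of x]] \<eta>(2)[of x] Cc(2) by simp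
    then show "0 \<le> - (k x * (V x \<bullet> G x))" using kneg[of x] by linarith
  qed
  then have "(LINT x|lborel. k x * (V x \<bullet> G x)) \<le> 0" by simp
  \<comment> \<open>Write X for the integral of \<open>A\<close>, Y for the energy term and Z for
    that of the n-th power of the norm of F. Then X \<le> Y + T and T \<le> (X - Y) / 2 + K Z give X
    \<le> Y + 2 K Z, and Y \<le> 0 may be dropped.\<close>
  then have "(LINT x|lborel. A x) \<le> 2 * (K * (LINT x|lborel. norm (F x) ^ ?n))"
    using main T by argo
  also have "\<dots> \<le> 2 * (K * e)" using \<eta>(7) \<open>K \<ge> 0\<close> by (intro mult_left_mono) auto
  also have "\<dots> < \<delta>" using e(2) by simp
  also have "\<delta> = (LINT x|lborel. a * indicator (cball (0 :: real ^ 'n) 1) x)"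
    by (simp add: \<delta>_def)
  also have "\<dots> \<le> (LINT x|lborel. A x)"
  proof (rule integral_mono[OF _ iA])
    show "integrable lborel (\<lambda>x :: real ^ 'n. a * indicator (cball 0 1) x)"
      using emeasure_lborel_cball_finite by (intro integrable_mult_right integrable_real_indicator) auto
    show "a * indicator (cball 0 1) x \<le> A x" for x
    proof (cases "norm x \<le> 1")
      case True
      then show ?thesis using ab(2)[rule_format, of x] \<eta>(4)[OF True] by (simp add: A_def)
    next
      case False
      have "0 \<le> A x" unfolding A_def using wpos[of x] gpos[OF upos[of x]] \<eta>(2)[of x] by simp
      then show ?thesis using False by simp
    qed
  qed
  finally show False by simp
qed

theorem theorem1p1:
  fixes H :: "real ^ 'n \<Rightarrow> real" and p pstar :: real and f :: "real \<Rightarrow> real"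
  assumes "CARD('n) \<ge> 2"
    and "anisotropy H"
    and "1 < p" and "p < real CARD('n)"
    and "pstar = (real CARD('n) - 1) * p / (real CARD('n) - p)"
    and "continuous_on {0<..} f" and "\<forall>v>0. f v > 0"
    and "(\<integral>\<^sup>+v\<in>{0<..1}. ennreal (f v powr (- 1 / (pstar - 1))) \<partial>lborel) < \<infinity>"
  shows "\<not> (\<exists>u :: real ^ 'n \<Rightarrow> real. supersolution H p f u \<and> (\<forall>x. u x > 0))"
proof
  let ?n = "real CARD('n)"
  assume "\<exists>u :: real ^ 'n \<Rightarrow> real. supersolution H p f u \<and> (\<forall>x. u x > 0)"
  then obtain u :: "real ^ 'n \<Rightarrow> real" where u: "supersolution H p f u" "\<forall>x. u x > 0" by blast
  \<comment> \<open>Since (n - 1) p - (n - p) = n (p - 1), the exponent in the integral condition is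
    exactly - \<tau>.\<close>
  have "pstar - 1 = ?n * (p - 1) / (?n - p)"
    using assms(4) by (simp add: assms(5) field_simps)
  then have "- 1 / (pstar - 1) = - ((?n - p) / (?n * (p - 1)))"
    by (simp add: minus_divide_left)
  then have "(\<integral>\<^sup>+v\<in>{0<..1}. ennreal (f v powr (- ((?n - p) / (?n * (p - 1))))) \<partial>lborel) < \<infinity>"
    using assms(8) by simp
  from no_positive_supersolution[OF assms(1-4) refl refl assms(6,7) this u] show False .
qed

end
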